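(* Let $M,N\ge 0$ and $K\ge 3$ be integers satisfying $$(M+N)^2 = KMN+1 .$$ To such a triple associate the (possibly degenerate) triangles with vertices $$IT(M,N):\quad (0,0),\ (M+N,KN),\ (M,0),$$ $$RT(M,N):\quad (0,0),\ (M,M+N),\ \left(M-\tfrac{M+N}{K},0\right),$$ where $RT(M,N)$ is considered only for $M>0$. Then each of these triangles supports a polynomial $f(x,y)\in k[x^{\pm1},y^{\pm1}]$ defining a negative curve that vanishes at $e=(1,1)$ to order $m$, where $m=M+N$ for $IT(M,N)$ and $m=M$ for $RT(M,N)$. Moreover, the negative curves corresponding to the triangles $IT(M,N)$ with $M\ge N>0$ and to the triangles $RT(M,N)$ with $M>N>1$ (over all $K\geq 3$ and all solutions $(M,N)$ of the equation) are pairwise non-isomorphic.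
   Context: $k$ is an algebraically closed field of characteristic $0$, $T=\mathbb{G}_m^2$ is the two-dimensional torus over $k$ with coordinate ring $k[x^{\pm1},y^{\pm1}]$, and $e=(1,1)\in T$. A polynomial vanishes to order $m$ at $e$ if all its partial derivatives of order at most $m-1$ vanish at $e$. A polynomial is supported in a triangle $\Delta\subset\mathbb{R}^2$ if its Newton polygon is contained in $\Delta$. A triangle $\Delta$ supports a polynomial $f$ defining a negative curve that vanishes to order $m>0$ at $e$ if $\Delta$ has area $\le m^2/2$ and $f$ is an irreducible element of $k[x^{\pm1},y^{\pm1}]$ supported in $\Delta$ that vanishes to order $m$ at $e$; the negative curve is the curve in $T$ defined by $f$. For the triangles in the claim the area is strictly less than $m^2/2$, and $f$ is unique up to a nonzero constant multiple, so each triangle determines one negative curve. When $M,N>0$, $K$ is determined by $(M,N)$. Two negative curves in $T$ are isomorphic if some automorphism of $T$ carries one to the other; here automorphisms of $T$ are those given by affine linear automorphisms of the exponent lattice $\mathbb{Z}^2$ (i.e. acting on exponents of Laurent monomials, translations corresponding to multiplication by a monomial). *)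

theory Defs
  imports
    "HOL-Analysis.Analysis"
    "HOL-Library.Poly_Mapping"
    "HOL-Computational_Algebra.Computational_Algebra"
begin

text \<open>
  The Laurent polynomial ring \<open>k[x\<^sup>\<plusminus>\<^sup>1, y\<^sup>\<plusminus>\<^sup>1]\<close> is the group algebra of the exponent lattice
  \<open>\<int> \<times> \<int>\<close>, i.e. the finitely supported functions with the convolution product.
\<close>

type_synonym 'k laurent = "(int \<times> int) \<Rightarrow>\<^sub>0 'k"

definition eval :: "'k::field laurent \<Rightarrow> 'k \<times> 'k \<Rightarrow> 'k" where
  "eval f p = (\<Sum>(i, j)\<in>Poly_Mapping.keys f.
     Poly_Mapping.lookup f (i, j) * (fst p powi i) * (snd p powi j))"

definition partial_x :: "'k::field laurent \<Rightarrow> 'k laurent" where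
  "partial_x f = (\<Sum>(i, j)\<in>Poly_Mapping.keys f.
     Poly_Mapping.single (i - 1, j) (of_int i * Poly_Mapping.lookup f (i, j)))"

definition partial_y :: "'k::field laurent \<Rightarrow> 'k laurent" where
  "partial_y f = (\<Sum>(i, j)\<in>Poly_Mapping.keys f.
     Poly_Mapping.single (i, j - 1) (of_int j * Poly_Mapping.lookup f (i, j)))"

text \<open>As usual, this means vanishing to order at least \<open>m\<close>.\<close>

definition vanishes_to_order :: "nat \<Rightarrow> 'k::field laurent \<Rightarrow> bool" where
  "vanishes_to_order m f \<longleftrightarrow>
     (\<forall>a b. a + b < m \<longrightarrow> eval ((partial_x ^^ a) ((partial_y ^^ b) f)) (1, 1) = 0)"

definition newton_polygon :: "'k::field laurent \<Rightarrow> (real ^ 2) set" where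
  "newton_polygon f =
     convex hull ((\<lambda>(i, j). vector [of_int i, of_int j]) ` Poly_Mapping.keys f)"

definition supports_negative_curve ::
    "(real ^ 2) set \<Rightarrow> nat \<Rightarrow> 'k::field laurent \<Rightarrow> bool" where
  "supports_negative_curve \<Delta> m f \<longleftrightarrow>
     m > 0 \<and> measure lborel \<Delta> \<le> (real m)\<^sup>2 / 2 \<and>
     irreducible f \<and> newton_polygon f \<subseteq> \<Delta> \<and> vanishes_to_order m f"

definition torus_curve :: "'k::field laurent \<Rightarrow> ('k \<times> 'k) set" where
  "torus_curve f = {p. fst p \<noteq> 0 \<and> snd p \<noteq> 0 \<and> eval f p = 0}"

definition affine_lattice_aut :: "(int \<times> int \<Rightarrow> int \<times> int) \<Rightarrow> bool" where
  "affine_lattice_aut \<phi> \<longleftrightarrow>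
     (\<exists>L t. bij L \<and> (\<forall>u v. L (u + v) = L u + L v) \<and> \<phi> = (\<lambda>u. L u + t))"

definition act_exponents :: "(int \<times> int \<Rightarrow> int \<times> int) \<Rightarrow> 'k::field laurent \<Rightarrow> 'k laurent" where
  "act_exponents \<phi> f =
     (\<Sum>u\<in>Poly_Mapping.keys f. Poly_Mapping.single (\<phi> u) (Poly_Mapping.lookup f u))"

text \<open>
  If \<open>\<phi>\<close> has linear part \<open>L\<close>, then \<open>act_exponents \<phi> f\<close> is, up to a monomial factor, the
  pullback of \<open>f\<close> along the automorphism of the torus with comorphism \<open>\<chi>\<^sup>u \<mapsto> \<chi>\<^sup>L\<^sup>u\<close>.  Its
  curve is therefore the preimage of the curve of \<open>f\<close> under that automorphism.
\<close>

definition isomorphic_curves :: "'k::field laurent \<Rightarrow> 'k laurent \<Rightarrow> bool" where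
  "isomorphic_curves f g \<longleftrightarrow>
     (\<exists>\<phi>. affine_lattice_aut \<phi> \<and> torus_curve (act_exponents \<phi> f) = torus_curve g)"

definition solution :: "nat \<Rightarrow> nat \<Rightarrow> nat \<Rightarrow> bool" where
  "solution K M N \<longleftrightarrow> K \<ge> 3 \<and> (M + N)\<^sup>2 = K * M * N + 1"

text \<open>The arguments of both constructors are \<open>K\<close>, \<open>M\<close>, \<open>N\<close>, in this order.\<close>

datatype triangle = IT nat nat nat | RT nat nat nat

fun region :: "triangle \<Rightarrow> (real ^ 2) set" where
  "region (IT K M N) = convex hull
     {vector [0, 0], vector [real M + real N, real K * real N], vector [real M, 0]}"
| "region (RT K M N) = convex hull
     {vector [0, 0], vector [real M, real M + real N],
      vector [real M - (real M + real N) / real K, 0]}"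

fun vanishing_order :: "triangle \<Rightarrow> nat" where
  "vanishing_order (IT K M N) = M + N"
| "vanishing_order (RT K M N) = M"

definition all_triangles :: "triangle set" where
  "all_triangles =
     {IT K M N | K M N. solution K M N} \<union> {RT K M N | K M N. solution K M N \<and> M > 0}"

definition distinguished_triangles :: "triangle set" where
  "distinguished_triangles =
     {IT K M N | K M N. solution K M N \<and> M \<ge> N \<and> N > 0} \<union>
     {RT K M N | K M N. solution K M N \<and> M > N \<and> N > 1}"

end

theory Submission
  imports Defs "Jordan_Normal_Form.Determinant"
begin

text \<open>The curves are rational: they are the images of \<open>t \<mapsto> (1/X(t), Y(t))\<close> for polynomials
  \<open>Y = t\<^sup>c A B\<close> and \<open>X = t\<^sup>r B\<^sup>K\<close> with \<open>Y - 1\<close> dividing \<open>X - 1\<close>.  Such pairs \<open>(A, B)\<close> exist for all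
  solutions of the equation, since the factorization \<open>1 - H = (1 - A F)(1 - A' F)\<close> with
  \<open>F = t\<^sup>c B\<close> and \<open>H = t\<^sup>r B\<^sup>K\<close> lifts Vieta jumping from the degrees to the polynomials.  The equation
  of the curve is the norm of \<open>x X(t) - 1\<close> from \<open>k[x, t]\<close> to \<open>k[x, y]\<close>, \<open>y = Y(t)\<close>, a determinant of size
  \<open>m = deg Y\<close>.  Its entries vanish at \<open>(1, 1)\<close>, so it vanishes there to order \<open>m\<close>, and its
  Newton polygon is bounded by weighted degrees.

  Any polynomial supported in the triangle that vanishes to order \<open>m\<close> at \<open>(1, 1)\<close> vanishes on the
  parametrized curve: after clearing denominators its pullback is divisible by \<open>(Y - 1)\<^sup>m\<close>, but its
  degree is at most twice the area of the triangle, which is less than \<open>m\<^sup>2\<close>.  This gives irreducibility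
  and uniqueness.  An isomorphism of curves therefore induces an affine equivalence of the
  supports, and the determinants of pairs of edges of the Newton polygon, together with \<open>m\<close>,
  recover the triangle.\<close>

text \<open>By the equation, twice the area of the triangle falls short of \<open>m^2\<close> by
  only 1 (for \<open>IT\<close>) or \<open>1/K\<close> (for \<open>RT\<close>), so the denominators
  along the parametrization must be estimated without any loss. Curves are compared as point sets,
  hence a Nullstellensatz for each equation is needed. It comes from division: the coefficient of
  the norm at \<open>x^m\<close> is a monomial, and below width \<open>m\<close> nothing but 0
  vanishes along the parametrization. The real obstacle is the Newton polygon of the
  \<open>RT\<close> curves. The descent leaves open whether \<open>r = 1\<close> or
  \<open>r = K - 1\<close>, and only in the latter case is the vertex on the x-axis under control;
  besides, an unknown power of \<open>t\<close> divides \<open>B\<close>, so that the edge of slope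
  \<open>K\<close> may be broken at an unknown place. The first difficulty is met by a reflection
  that exchanges \<open>N\<close> with the other root \<open>(K - 2) M - N\<close> of the equation,
  combined with uniqueness; the second by invariants that do not see where the edge is
  broken.\<close>

abbreviation lk :: "('a \<Rightarrow>\<^sub>0 'b::zero) \<Rightarrow> 'a \<Rightarrow> 'b" where "lk \<equiv> Poly_Mapping.lookup"
abbreviation keys :: "('a \<Rightarrow>\<^sub>0 'b::zero) \<Rightarrow> 'a set" where "keys \<equiv> Poly_Mapping.keys"
abbreviation mterm :: "int \<times> int \<Rightarrow> 'k::field \<Rightarrow> 'k laurent" where "mterm \<equiv> Poly_Mapping.single"

subsection \<open>Linear functionals on Laurent polynomials\<close>

text \<open>Coefficients, values at points and exponent moments are all of this form, so that the
  single product rule \<open>lin_mult\<close> serves them all.\<close>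

definition lin :: "(int \<times> int \<Rightarrow> 'k::field) \<Rightarrow> 'k laurent \<Rightarrow> 'k" where
  "lin c f = (\<Sum>u\<in>keys f. lk f u * c u)"

lemma lin_superset:
  assumes "finite A" "keys f \<subseteq> A"
  shows "lin c f = (\<Sum>u\<in>A. lk f u * c u)"
  unfolding lin_def using assms by (intro sum.mono_neutral_left) (auto simp: in_keys_iff)

lemma lin_0 [simp]: "lin c 0 = 0"
  by (simp add: lin_def)

lemma lin_add [simp]: "lin c (f + g) = lin c f + lin c g"
proof -
  have *: "finite (keys f \<union> keys g)" "keys (f + g) \<subseteq> keys f \<union> keys g"
    using Poly_Mapping.keys_add[of f g] by auto
  show ?thesis
    using * by (simp add: lin_superset[where A="keys f \<union> keys g"] lookup_add ring_distribs sum.distrib)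
qed

lemma lin_uminus [simp]: "lin c (- f) = - lin c f"
  using lin_add[of c f "- f"] by (simp add: add_eq_0_iff)

lemma lin_diff [simp]: "lin c (f - g) = lin c f - lin c g"
  using lin_add[of c f "- g"] by simp

lemma lin_sum: "lin c (\<Sum>i\<in>I. F i) = (\<Sum>i\<in>I. lin c (F i))"
  by (induction I rule: infinite_finite_induct) auto

lemma lin_single [simp]: "lin c (mterm u a) = a * c u"
  by (simp add: lin_def)

lemma lin_cong: "(\<And>u. u \<in> keys f \<Longrightarrow> c u = d u) \<Longrightarrow> lin c f = lin d f"
  by (simp add: lin_def)

lemma lin_cmult: "lin (\<lambda>u. a * c u) f = a * lin c f"
  by (simp add: lin_def sum_distrib_left algebra_simps)

lemma lin_add_fun: "lin (\<lambda>u. c u + d u) f = lin c f + lin d f"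
  by (simp add: lin_def sum.distrib algebra_simps)

lemma laurent_decomp: "f = (\<Sum>u\<in>keys f. mterm u (lk f u))"
  by (rule poly_mapping_eqI)
    (auto simp: lookup_sum lookup_single when_def in_keys_iff)

lemma lin_delta: "lin (\<lambda>u. if u = v then a else 0) f = lk f v * a"
proof -
  have "lin (\<lambda>u. if u = v then a else 0) f = (\<Sum>u\<in>keys f. if u = v then lk f u * a else 0)"
    unfolding lin_def by (intro sum.cong) auto
  then show ?thesis by (simp add: in_keys_iff)
qed

lemma lookup_eq_lin: "lk f v = lin (\<lambda>u. if u = v then 1 else 0) f"
  by (simp add: lin_delta)

lemma laurent_induct [case_names add single]:
  assumes "\<And>f g. P f \<Longrightarrow> P g \<Longrightarrow> P (f + g)" "\<And>u a. P (mterm u a)"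
  shows "P f"
proof -
  have "P (\<Sum>u\<in>A. mterm u (lk f u))" if "finite A" for A
    using that
  proof (induction A)
    case empty
    show ?case using assms(2)[of "(0, 0)" 0] by simp
  qed (use assms in auto)
  from this[OF finite_keys, of f] show ?thesis by (simp flip: laurent_decomp)
qed

lemma lin_mult: "lin c (f * g) = lin (\<lambda>u. lin (\<lambda>v. c (u + v)) g) f"
proof (induction f rule: laurent_induct)
  case (single u a)
  show ?case
  proof (induction g rule: laurent_induct)
    case (add g h)
    then show ?case by (simp add: ring_distribs)
  qed (simp add: mult_single algebra_simps)
qed (simp add: ring_distribs)

lemma eval_eq_lin: "eval f p = lin (\<lambda>u. fst p powi fst u * snd p powi snd u) f"
  by (simp add: eval_def lin_def case_prod_unfold mult.assoc)

lemma eval_mult: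
  assumes "fst p \<noteq> 0" "snd p \<noteq> 0"
  shows "eval (f * g) p = eval f p * eval g p"
proof -
  have "lin (\<lambda>v. fst p powi fst (u + v) * snd p powi snd (u + v)) g
      = (fst p powi fst u * snd p powi snd u) * eval g p" for u
    unfolding eval_eq_lin lin_cmult[symmetric]
    by (intro lin_cong) (simp add: power_int_add assms mult_ac)
  then have "eval (f * g) p = lin (\<lambda>u. eval g p * (fst p powi fst u * snd p powi snd u)) f"
    unfolding eval_eq_lin[of "f * g"] lin_mult by (simp add: mult.commute)
  then show ?thesis by (simp add: lin_cmult mult.commute flip: eval_eq_lin)
qed

lemma eval_add [simp]: "eval (f + g) p = eval f p + eval g p"
  and eval_diff [simp]: "eval (f - g) p = eval f p - eval g p"
  and eval_0 [simp]: "eval 0 p = 0"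
  and eval_mterm: "eval (mterm u a) p = a * (fst p powi fst u * snd p powi snd u)"
  and eval_1 [simp]: "eval 1 p = 1"
  by (simp_all add: eval_eq_lin flip: single_one)

lemma mterm_mult: "mterm u a * mterm v b = mterm (u + v) (a * b)"
  by (simp add: mult_single)

lemma lookup_mterm_mult: "lk (mterm u a * f) v = a * lk f (v - u)"
proof -
  have "(if u + v' = v then 1 else 0) = (if v' = v - u then 1 else (0::'a))" for v'
    by (auto simp: algebra_simps)
  then show ?thesis unfolding lookup_eq_lin lin_mult by simp
qed

lemma keys_mterm_mult: "a \<noteq> 0 \<Longrightarrow> keys (mterm u a * f) = (\<lambda>v. u + v) ` keys f"
  by (auto simp: in_keys_iff lookup_mterm_mult intro!: image_eqI[where x="_ - u"])

subsection \<open>Zero divisors and units\<close>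

definition additive :: "(int \<times> int \<Rightarrow> int) \<Rightarrow> bool" where
  "additive w \<longleftrightarrow> (\<forall>u v. w (u + v) = w u + w v)"

lemma additive_add: "additive w \<Longrightarrow> w (u + v) = w u + w v"
  unfolding additive_def by blast

lemma additive_0: "additive w \<Longrightarrow> w 0 = 0"
  using additive_add[of w 0 0] by simp

text \<open>A lexicographic monomial order, encoded by an integer: on a finite set the first
  coordinate dominates once its factor \<open>C\<close> exceeds all differences of second
  coordinates.\<close>

lemma ex_additive_inj:
  assumes "finite (A :: (int \<times> int) set)"
  shows "\<exists>w. additive w \<and> inj_on w A"
proof -
  obtain C where C: "\<And>u v. u \<in> A \<Longrightarrow> v \<in> A \<Longrightarrow> \<bar>snd u - snd v\<bar> < C" "C > 0"
  proof -
    have "finite ((\<lambda>(u, v). \<bar>snd u - snd v\<bar>) ` (A \<times> A))" using assms by simp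
    then obtain B where "\<forall>x\<in>(\<lambda>(u, v). \<bar>snd u - snd v\<bar>) ` (A \<times> A). x \<le> B"
      using bdd_above_finite unfolding bdd_above_def by blast
    then have "\<bar>snd u - snd v\<bar> < max B 0 + 1" if "u \<in> A" "v \<in> A" for u v
      using that by (fastforce simp: image_iff)
    then show ?thesis using that[of "max B 0 + 1"] by auto
  qed
  have "inj_on (\<lambda>u. C * fst u + snd u) A"
  proof (rule inj_onI)
    fix u v assume uv: "u \<in> A" "v \<in> A" "C * fst u + snd u = C * fst v + snd v"
    then have eq: "C * (fst u - fst v) = snd v - snd u" by (simp add: algebra_simps)
    have "fst u = fst v"
    proof (rule ccontr)
      assume "fst u \<noteq> fst v"
      then have "\<bar>C * (fst u - fst v)\<bar> \<ge> C" using C(2) by (simp add: abs_mult)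
      with eq C(1)[OF uv(2,1)] show False by simp
    qed
    with eq show "u = v" by (simp add: prod_eq_iff)
  qed
  moreover have "additive (\<lambda>u. C * fst u + snd u)" by (simp add: additive_def algebra_simps)
  ultimately show ?thesis by blast
qed

text \<open>Leading terms multiply without cancellation: as the weight is injective on the keys,
  only the pair \<open>(u, v)\<close> contributes to the exponent \<open>u + v\<close>.\<close>

lemma lookup_mult_extreme:
  fixes f g :: "'k::field laurent"
  assumes w: "additive w" "inj_on w (keys f \<union> keys g)"
    and u: "u \<in> keys f" "\<And>u'. u' \<in> keys f \<Longrightarrow> w u' \<le> w u"
    and v: "v \<in> keys g" "\<And>v'. v' \<in> keys g \<Longrightarrow> w v' \<le> w v"
  shows "lk (f * g) (u + v) = lk f u * lk g v"
proof -
  have *: "u' + v' = u + v \<longleftrightarrow> u' = u \<and> v' = v" if "u' \<in> keys f" "v' \<in> keys g" for u' v'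
  proof
    assume eq: "u' + v' = u + v"
    then have "w u' + w v' = w u + w v" using w(1) by (metis additive_add)
    with u(2)[OF that(1)] v(2)[OF that(2)] have "w u' = w u" "w v' = w v" by auto
    then show "u' = u \<and> v' = v" using w(2) that u(1) v(1) by (auto dest: inj_onD)
  qed auto
  have "lk (f * g) (u + v) = lin (\<lambda>u'. if u' = u then lk g v else 0) f"
    unfolding lookup_eq_lin[of "f * g"] lin_mult
  proof (intro lin_cong)
    fix u' assume "u' \<in> keys f"
    then have "lin (\<lambda>v'. if u' + v' = u + v then 1 else 0) g
        = lin (\<lambda>v'. if u' = u \<and> v' = v then 1 else 0) g"
      by (intro lin_cong) (simp add: *)
    then show "lin (\<lambda>v'. if u' + v' = u + v then 1 else 0) g = (if u' = u then lk g v else 0)"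
      by (cases "u' = u") (simp_all add: lin_delta, simp add: lin_def)
  qed
  also have "\<dots> = lk f u * lk g v"
    by (simp add: lin_delta)
  finally show ?thesis .
qed

lemma ex_key_max:
  assumes "(f :: 'k::field laurent) \<noteq> 0"
  shows "\<exists>u\<in>keys f. \<forall>u'\<in>keys f. (w u' :: int) \<le> w u"
proof -
  have "keys f \<noteq> {}" "finite (keys f)" using assms by auto
  then have "Max (w ` keys f) \<in> w ` keys f" by simp
  then show ?thesis using Max_ge[of "w ` keys f"] by (metis (no_types, lifting) \<open>finite (keys f)\<close> finite_imageI imageE imageI)
qed

lemma laurent_no_zero_divisors:
  assumes "(f :: 'k::field laurent) * g = 0"
  shows "f = 0 \<or> g = 0"
proof (rule ccontr)
  assume nz: "\<not> (f = 0 \<or> g = 0)"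
  obtain w where w: "additive w" "inj_on w (keys f \<union> keys g)"
    using ex_additive_inj[of "keys f \<union> keys g"] by auto
  from nz obtain u v where "u \<in> keys f" "\<forall>u'\<in>keys f. w u' \<le> w u" "v \<in> keys g" "\<forall>v'\<in>keys g. w v' \<le> w v"
    using ex_key_max by metis
  then have "lk (f * g) (u + v) = lk f u * lk g v" using w by (intro lookup_mult_extreme) auto
  with \<open>u \<in> keys f\<close> \<open>v \<in> keys g\<close> assms show False by (simp add: in_keys_iff)
qed

lemma laurent_mult_cancel:
  assumes "(f :: 'k::field laurent) * g = f * h" "f \<noteq> 0"
  shows "g = h"
  using laurent_no_zero_divisors[of f "g - h"] assms by (simp add: ring_distribs)

text \<open>In \<open>f * g = 1\<close> both the highest and the lowest terms survive, and both must
  sit at exponent 0. Hence the weight is constant on \<open>keys f\<close>, and an injective weight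
  leaves only one key.\<close>

lemma laurent_unit_single:
  assumes "(f :: 'k::field laurent) dvd 1"
  shows "\<exists>u a. a \<noteq> 0 \<and> f = mterm u a"
proof -
  from assms obtain g where g: "f * g = 1" by (metis dvdE)
  then have nz: "f \<noteq> 0" "g \<noteq> 0" by auto
  obtain w where w: "additive w" "inj_on w (keys f \<union> keys g)"
    using ex_additive_inj[of "keys f \<union> keys g"] by auto
  define w' where "w' = (\<lambda>u. - w u)"
  have w': "additive w'" "inj_on w' (keys f \<union> keys g)"
    using w by (auto simp: w'_def additive_def inj_on_def)
  obtain u v where uv: "u \<in> keys f" "\<forall>u'\<in>keys f. w u' \<le> w u" "v \<in> keys g" "\<forall>v'\<in>keys g. w v' \<le> w v"
    using ex_key_max nz by metis
  obtain u2 v2 where uv2: "u2 \<in> keys f" "\<forall>u'\<in>keys f. w' u' \<le> w' u2" "v2 \<in> keys g" "\<forall>v'\<in>keys g. w' v' \<le> w' v2"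
    using ex_key_max nz by metis
  have "lk (f * g) (u + v) = lk f u * lk g v" using uv w by (intro lookup_mult_extreme) auto
  then have "u + v = 0" using g uv by (auto simp: in_keys_iff lookup_one when_def split: if_splits)
  moreover have "lk (f * g) (u2 + v2) = lk f u2 * lk g v2" using uv2 w' by (intro lookup_mult_extreme) auto
  then have "u2 + v2 = 0" using g uv2 by (auto simp: in_keys_iff lookup_one when_def split: if_splits)
  ultimately have "w u + w v = 0" "w u2 + w v2 = 0" using w(1) by (metis additive_add additive_0)+
  moreover have "w v2 \<le> w v" "w u2 \<le> w u" using uv uv2 by auto
  ultimately have "w u = w u2" by simp
  have "u' = u" if "u' \<in> keys f" for u'
  proof -
    have "w u' \<le> w u" "w u \<le> w u'" using that uv uv2 \<open>w u = w u2\<close> by (auto simp: w'_def)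
    then show ?thesis using w(2) that uv(1) by (auto dest: inj_onD)
  qed
  then have "keys f = {u}" using uv(1) by blast
  have "f = (\<Sum>u\<in>{u}. mterm u (lk f u))"
    using laurent_decomp[of f] unfolding \<open>keys f = {u}\<close> .
  then have "f = mterm u (lk f u)" by simp
  moreover have "lk f u \<noteq> 0" using uv(1) by (simp add: in_keys_iff)
  ultimately show ?thesis by blast
qed

subsection \<open>Moments\<close>

definition affine_fun :: "(int \<times> int \<Rightarrow> 'k::field) \<Rightarrow> bool" where
  "affine_fun p \<longleftrightarrow> (\<exists>a b c. p = (\<lambda>u. a * of_int (fst u) + b * of_int (snd u) + c))"

text \<open>In terms of the Euler operators \<open>x\<partial>\<^sub>x\<close> and \<open>y\<partial>\<^sub>y\<close>: vanishing to order \<open>m\<close> at \<open>(1, 1)\<close> means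
  that the exponent moments of all polynomial functions of degree less than \<open>m\<close> vanish.
  This form is visibly invariant under affine maps of the exponents.\<close>

definition moments_vanish :: "nat \<Rightarrow> 'k::field laurent \<Rightarrow> bool" where
  "moments_vanish m f \<longleftrightarrow> (\<forall>ps. length ps < m \<and> (\<forall>p\<in>set ps. affine_fun p) \<longrightarrow>
     lin (\<lambda>u. \<Prod>p\<leftarrow>ps. p u) f = 0)"

lemma moments_vanishD:
  "moments_vanish m f \<Longrightarrow> length ps < m \<Longrightarrow> (\<And>p. p \<in> set ps \<Longrightarrow> affine_fun p) \<Longrightarrow>
    lin (\<lambda>u. \<Prod>p\<leftarrow>ps. p u) f = 0"
  by (auto simp: moments_vanish_def)

lemma moments_vanish_0 [simp]: "moments_vanish 0 f"
  by (simp add: moments_vanish_def)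

lemma moments_vanish_mono: "moments_vanish m f \<Longrightarrow> n \<le> m \<Longrightarrow> moments_vanish n f"
  by (auto simp: moments_vanish_def)

lemma moments_vanish_add: "moments_vanish m f \<Longrightarrow> moments_vanish m g \<Longrightarrow> moments_vanish m (f + g)"
  by (auto simp: moments_vanish_def)

lemma moments_vanish_zero [simp]: "moments_vanish m 0"
  by (auto simp: moments_vanish_def)

lemma moments_vanish_sum:
  "(\<And>i. i \<in> I \<Longrightarrow> moments_vanish m (F i)) \<Longrightarrow> moments_vanish m (\<Sum>i\<in>I. F i)"
  by (induction I rule: infinite_finite_induct) (auto intro: moments_vanish_add)

text \<open>For affine \<open>p\<close> this is a combination of the Euler operators and a scalar,
  that is, a differential operator of order at most one.\<close>

definition weight :: "(int \<times> int \<Rightarrow> 'k::field) \<Rightarrow> 'k laurent \<Rightarrow> 'k laurent" where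
  "weight p f = (\<Sum>u\<in>keys f. mterm u (lk f u * p u))"

lemma lin_weight: "lin c (weight p f) = lin (\<lambda>u. p u * c u) f"
  unfolding weight_def lin_sum lin_single by (simp add: lin_def mult.assoc)

lemma moments_vanish_weight:
  assumes "moments_vanish m f" "affine_fun p"
  shows "moments_vanish (m - 1) (weight p f)"
  unfolding moments_vanish_def
proof safe
  fix ps :: "(int \<times> int \<Rightarrow> 'a) list" assume "length ps < m - 1" "\<forall>p\<in>set ps. affine_fun p"
  then have "lin (\<lambda>u. \<Prod>p\<leftarrow>p # ps. p u) f = 0"
    using assms(2) by (intro moments_vanishD[OF assms(1)]) auto
  then show "lin (\<lambda>u. \<Prod>p\<leftarrow>ps. p u) (weight p f) = 0"
    by (simp add: lin_weight)
qed

text \<open>Leibniz rule: on a sum of exponents \<open>p (u + v) = p u + p0 v\<close>, where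
  \<open>p0\<close> is the linear part of \<open>p\<close>. Each affine factor is thus spent on one
  of the two Laurent polynomials and lowers the order of that one by one.\<close>

lemma moments_mult_aux:
  assumes "moments_vanish m f" "moments_vanish n g" "length ps < m + n"
    "\<And>p. p \<in> set ps \<Longrightarrow> affine_fun p"
  shows "lin (\<lambda>u. \<Prod>p\<leftarrow>ps. p u) (f * g) = 0"
  using assms
proof (induction ps arbitrary: m n f g)
  case Nil
  have "lin (\<lambda>u. 1) f = 0 \<or> lin (\<lambda>u. 1) g = 0"
    using moments_vanishD[OF Nil(1), of "[]"] moments_vanishD[OF Nil(2), of "[]"] Nil(3) by auto
  moreover have "lin (\<lambda>u. 1) (f * g) = lin (\<lambda>u. 1) g * lin (\<lambda>u. 1) f"
    using lin_cmult[of "lin (\<lambda>u. 1) g" "\<lambda>u. 1" f] by (simp add: lin_mult)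
  ultimately show ?case by auto
next
  case (Cons p ps)
  from Cons.prems(4)[of p] obtain a b c where
    p: "p = (\<lambda>u. a * of_int (fst u) + b * of_int (snd u) + c)" by (auto simp: affine_fun_def)
  define p0 where "p0 = (\<lambda>u::int\<times>int. a * of_int (fst u) + b * of_int (snd u))"
  have p0: "affine_fun p0" unfolding affine_fun_def p0_def
    by (rule exI[of _ a], rule exI[of _ b], rule exI[of _ 0]) simp
  have split: "p (u + v) = p u + p0 v" for u v by (simp add: p p0_def algebra_simps)
  let ?Q = "\<lambda>u. \<Prod>p\<leftarrow>ps. p u"
  have "lin (\<lambda>u. \<Prod>p\<leftarrow>p # ps. p u) (f * g)
      = lin (\<lambda>u. lin (\<lambda>v. p u * ?Q (u + v) + p0 v * ?Q (u + v)) g) f"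
    unfolding lin_mult by (simp add: split ring_distribs)
  also have "\<dots> = lin ?Q (weight p f * g) + lin ?Q (f * weight p0 g)"
    unfolding lin_mult lin_weight lin_add_fun lin_cmult ..
  also have "lin ?Q (weight p f * g) = 0"
    using Cons.prems by (intro Cons.IH[OF moments_vanish_weight[OF Cons.prems(1)] Cons.prems(2)]) auto
  also have "lin ?Q (f * weight p0 g) = 0"
    using Cons.prems by (intro Cons.IH[OF Cons.prems(1) moments_vanish_weight[OF Cons.prems(2) p0]]) auto
  finally show ?case by simp
qed

lemma moments_vanish_mult:
  assumes "moments_vanish m f" "moments_vanish n g"
  shows "moments_vanish (m + n) (f * g)"
  unfolding moments_vanish_def using moments_mult_aux[OF assms] by blast

lemma moments_vanish_mult_left: "moments_vanish m f \<Longrightarrow> moments_vanish m (h * f)"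
  using moments_vanish_mult[of 0 h m f] by simp

lemma moments_vanish_1_iff: "moments_vanish 1 f \<longleftrightarrow> eval f (1, 1) = 0"
  by (auto simp: moments_vanish_def eval_eq_lin)

lemma moments_vanish_prod:
  assumes "finite I" "\<And>i. i \<in> I \<Longrightarrow> moments_vanish 1 (F i)"
  shows "moments_vanish (card I) (\<Prod>i\<in>I. F i)"
  using assms
proof (induction I)
  case (insert i I)
  then have "moments_vanish (1 + card I) (F i * prod F I)" by (intro moments_vanish_mult) auto
  then show ?case using insert by simp
qed simp

section \<open>Iterated partial derivatives and falling factorials\<close>

lemma lin_partial_x: "lin c (partial_x f) = lin (\<lambda>u. of_int (fst u) * c (u - (1, 0))) f"
  unfolding partial_x_def case_prod_unfold lin_sum lin_single
  by (simp add: lin_def minus_prod_def mult_ac)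

lemma lin_partial_y: "lin c (partial_y f) = lin (\<lambda>u. of_int (snd u) * c (u - (0, 1))) f"
  unfolding partial_y_def case_prod_unfold lin_sum lin_single
  by (simp add: lin_def minus_prod_def mult_ac)

definition falling :: "int \<Rightarrow> nat \<Rightarrow> 'k::field" where
  "falling i a = (\<Prod>s<a. of_int (i - int s))"

lemma falling_0 [simp]: "falling i 0 = 1"
  by (simp add: falling_def)

lemma falling_Suc: "of_int i * falling i a = falling i (Suc a) + of_nat a * falling i a"
  by (simp add: falling_def algebra_simps)

lemma lin_partial_x_iter:
  "lin c ((partial_x ^^ a) f) = lin (\<lambda>u. falling (fst u) a * c (u - (int a, 0))) f"
proof (induction a arbitrary: c)
  case (Suc a)
  show ?case
    by (simp add: lin_partial_x Suc)
      (intro lin_cong, simp add: falling_def algebra_simps)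
qed (simp flip: zero_prod_def)

lemma lin_partial_y_iter:
  "lin c ((partial_y ^^ a) f) = lin (\<lambda>u. falling (snd u) a * c (u - (0, int a))) f"
proof (induction a arbitrary: c)
  case (Suc a)
  show ?case
    by (simp add: lin_partial_y Suc)
      (intro lin_cong, simp add: falling_def algebra_simps)
qed (simp flip: zero_prod_def)

lemma vanishes_to_order_iff:
  "vanishes_to_order m f \<longleftrightarrow>
    (\<forall>a b. a + b < m \<longrightarrow> lin (\<lambda>u. falling (fst u) a * falling (snd u) b) f = 0)"
  unfolding vanishes_to_order_def eval_eq_lin
  by (simp add: lin_partial_x_iter lin_partial_y_iter mult.commute)

text \<open>By \<open>falling_Suc\<close>, multiplication by an affine function raises the degree in
  the basis of falling factorials by at most one. This triangular change of basis leads from partial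
  derivatives to arbitrary products of affine functions.\<close>

lemma vanishes_to_order_weight:
  assumes "vanishes_to_order m f" "affine_fun p"
  shows "vanishes_to_order (m - 1) (weight p f)"
  unfolding vanishes_to_order_iff
proof safe
  fix a b assume ab: "a + b < m - 1"
  from assms(2) obtain \<alpha> \<beta> \<gamma> where
    p: "p = (\<lambda>u. \<alpha> * of_int (fst u) + \<beta> * of_int (snd u) + \<gamma>)" by (auto simp: affine_fun_def)
  have V: "lin (\<lambda>u. falling (fst u) a * falling (snd u) b) f = 0" if "a + b < m" for a b
    using assms(1) that by (simp add: vanishes_to_order_iff)
  have eq: "p u * (falling (fst u) a * falling (snd u) b) =
      \<alpha> * (falling (fst u) (Suc a) * falling (snd u) b) + (\<beta> * (falling (fst u) a * falling (snd u) (Suc b))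
      + (\<alpha> * of_nat a + \<beta> * of_nat b + \<gamma>) * (falling (fst u) a * falling (snd u) b))" for u
  proof -
    have "p u * (falling (fst u) a * falling (snd u) b) =
      \<alpha> * (of_int (fst u) * falling (fst u) a) * falling (snd u) b +
      \<beta> * falling (fst u) a * (of_int (snd u) * falling (snd u) b) + \<gamma> * (falling (fst u) a * falling (snd u) b)"
      by (simp add: p algebra_simps)
    then show ?thesis unfolding falling_Suc by (simp add: algebra_simps)
  qed
  show "lin (\<lambda>u. falling (fst u) a * falling (snd u) b) (weight p f) = 0"
    unfolding lin_weight eq lin_add_fun lin_cmult using V ab by simp
qed

lemma vanishes_imp_moments: "vanishes_to_order m f \<Longrightarrow> moments_vanish m f"
  unfolding moments_vanish_def
proof safe
  fix ps :: "(int \<times> int \<Rightarrow> 'a) list"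
  assume "vanishes_to_order m f" "length ps < m" "\<forall>p\<in>set ps. affine_fun p"
  then show "lin (\<lambda>u. \<Prod>p\<leftarrow>ps. p u) f = 0"
  proof (induction ps arbitrary: m f)
    case Nil
    then have "lin (\<lambda>u. falling (fst u) 0 * falling (snd u) 0) f = 0"
      unfolding vanishes_to_order_iff by (metis add.right_neutral list.size(3))
    then show ?case by simp
  next
    case (Cons p ps)
    have "lin (\<lambda>u. \<Prod>p\<leftarrow>ps. p u) (weight p f) = 0"
      using Cons.prems by (intro Cons.IH[OF vanishes_to_order_weight[OF Cons.prems(1)]]) auto
    then show ?case by (simp add: lin_weight)
  qed
qed

lemma affine_fun_coord: "affine_fun (\<lambda>u. of_int (fst u - s))" "affine_fun (\<lambda>u. of_int (snd u - s))"
  unfolding affine_fun_def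
  by (rule exI[of _ 1], rule exI[of _ 0], rule exI[of _ "- of_int s"], simp)
    (rule exI[of _ 0], rule exI[of _ 1], rule exI[of _ "- of_int s"], simp)

lemma falling_eq_prod_list: "falling i a = (\<Prod>s\<leftarrow>[0..<a]. of_int (i - int s))"
  unfolding falling_def by (subst prod.distinct_set_conv_list[symmetric]) (auto simp: atLeast0LessThan)

text \<open>A falling factorial is itself a product of affine functions of the exponent, one for
  each shift \<open>s\<close>.\<close>

lemma moments_imp_vanishes:
  assumes "moments_vanish m f"
  shows "vanishes_to_order m f"
  unfolding vanishes_to_order_iff
proof safe
  fix a b assume ab: "a + b < m"
  have "lin (\<lambda>u. \<Prod>p\<leftarrow>map (\<lambda>s u. of_int (fst u - int s)) [0..<a] @ map (\<lambda>s u. of_int (snd u - int s)) [0..<b]. p u) f = 0"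
    using ab by (intro moments_vanishD[OF assms]) (auto simp del: of_int_diff intro: affine_fun_coord)
  then show "lin (\<lambda>u. falling (fst u) a * falling (snd u) b) f = 0"
    by (simp add: falling_eq_prod_list o_def del: of_int_diff)
qed

lemma vanishes_iff_moments: "vanishes_to_order m f \<longleftrightarrow> moments_vanish m f"
  using vanishes_imp_moments moments_imp_vanishes by blast

subsection \<open>Polynomials in \<open>t\<close> as a free module over polynomials in \<open>Y(t)\<close>\<close>

lemma distinct_degrees_sum:
  fixes P :: "'i \<Rightarrow> 'k::field poly"
  assumes "finite I" "\<And>i. i \<in> I \<Longrightarrow> P i \<noteq> 0" "inj_on (\<lambda>i. degree (P i)) I" "i \<in> I"
  shows "degree (P i) \<le> degree (\<Sum>i\<in>I. P i)" "(\<Sum>i\<in>I. P i) \<noteq> 0"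
proof -
  define D where "D = Max ((\<lambda>i. degree (P i)) ` I)"
  have le: "degree (P j) \<le> D" if "j \<in> I" for j
    using that assms(1) by (auto simp: D_def)
  have "D \<in> (\<lambda>i. degree (P i)) ` I"
    unfolding D_def using assms(1,4) by (intro Max_in) auto
  then obtain i0 where i0: "i0 \<in> I" "D = degree (P i0)" by auto
  have "coeff (P j) D = 0" if "j \<in> I" "j \<noteq> i0" for j
  proof -
    have "degree (P j) \<noteq> D" using i0 that assms(3) by (metis inj_onD)
    with le[OF that(1)] show ?thesis by (intro coeff_eq_0) auto
  qed
  then have "(\<Sum>j\<in>I. coeff (P j) D) = coeff (P i0) D"
    using sum.remove[OF assms(1) i0(1), of "\<lambda>j. coeff (P j) D"] by simp
  then have "coeff (\<Sum>i\<in>I. P i) D \<noteq> 0"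
    using assms(2)[OF i0(1)] i0(2) by (simp add: coeff_sum)
  then show "(\<Sum>i\<in>I. P i) \<noteq> 0" "degree (P i) \<le> degree (\<Sum>i\<in>I. P i)"
    using le_degree[of "\<Sum>i\<in>I. P i" D] le[OF assms(4)] by auto
qed

locale free_basis =
  fixes Y :: "'k::field poly"
  assumes degY: "degree Y > 0"
begin

abbreviation m :: nat where "m \<equiv> degree Y"

lemma pcompose_Y_eq_0_iff [simp]: "pcompose g Y = 0 \<longleftrightarrow> g = 0"
  using pcompose_eq_0[of g Y] degY by auto

lemma degree_term: "g \<noteq> 0 \<Longrightarrow> degree (monom 1 i * pcompose g Y) = i + m * degree g"
  by (subst degree_mult_eq) (auto simp: degree_monom_eq monom_eq_0_iff degree_pcompose)

text \<open>The degree of the term is \<open>i\<close> modulo \<open>m\<close>. So the summands of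
  an expansion never cancel, which yields uniqueness and the degree bounds at once.\<close>

lemma inj_on_degree_term:
  "inj_on (\<lambda>i. degree (monom 1 i * pcompose (g i) Y)) {i. i < m \<and> g i \<noteq> 0}"
proof (rule inj_onI)
  fix i j assume ij: "i \<in> {i. i < m \<and> g i \<noteq> 0}" "j \<in> {i. i < m \<and> g i \<noteq> 0}"
    and eq: "degree (monom 1 i * pcompose (g i) Y) = degree (monom 1 j * pcompose (g j) Y)"
  from eq ij have "i + m * degree (g i) = j + m * degree (g j)" by (simp add: degree_term)
  then have "(i + m * degree (g i)) mod m = (j + m * degree (g j)) mod m" by simp
  then show "i = j" using ij by simp
qed

lemma sum_nonzero:
  "(\<Sum>i<m. monom 1 i * pcompose (g i) Y) = (\<Sum>i | i < m \<and> g i \<noteq> 0. monom 1 i * pcompose (g i) Y)"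
  by (intro sum.mono_neutral_right) auto

lemma expansion_degree:
  assumes "h = (\<Sum>i<m. monom 1 i * pcompose (g i) Y)" "i < m" "g i \<noteq> 0"
  shows "i + m * degree (g i) \<le> degree h" "h \<noteq> 0"
proof -
  have *: "monom 1 i * pcompose (g i) Y \<noteq> 0" if "g i \<noteq> 0" for i
    using that by (simp add: monom_eq_0_iff)
  show "h \<noteq> 0"
    unfolding assms(1) sum_nonzero
    by (rule distinct_degrees_sum(2)[OF _ _ inj_on_degree_term]) (use assms * in auto)
  have "degree (monom 1 i * pcompose (g i) Y) \<le> degree h"
    unfolding assms(1) sum_nonzero
    by (rule distinct_degrees_sum(1)[OF _ _ inj_on_degree_term]) (use assms * in auto)
  then show "i + m * degree (g i) \<le> degree h" using assms(3) by (simp add: degree_term)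
qed

lemma expansion_unique:
  assumes "(\<Sum>i<m. monom 1 i * pcompose (g i) Y) = (\<Sum>i<m. monom 1 i * pcompose (g' i) Y)" "i < m"
  shows "g i = g' i"
proof (rule ccontr)
  assume ne: "g i \<noteq> g' i"
  have "(\<Sum>i<m. monom 1 i * pcompose (g i - g' i) Y) = 0"
    using assms(1) by (simp add: pcompose_diff right_diff_distrib sum_subtractf)
  then show False using expansion_degree(2)[OF refl assms(2), of "\<lambda>i. g i - g' i"] ne by simp
qed

text \<open>Expansion in base \<open>Y\<close>: the remainder modulo \<open>Y\<close> provides the
  constant coefficients, the quotient all the others.\<close>

lemma expansion_exists: "\<exists>g. h = (\<Sum>i<m. monom 1 i * pcompose (g i) Y)"
proof (induction "degree h" arbitrary: h rule: less_induct)
  case less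
  have "\<exists>g. h div Y = (\<Sum>i<m. monom 1 i * pcompose (g i) Y)"
  proof (cases "h div Y = 0")
    case True
    then show ?thesis by (intro exI[of _ "\<lambda>i. 0"]) simp
  next
    case False
    then have "degree h \<ge> m" using div_poly_less[of h Y] by (meson not_less)
    moreover have "Y \<noteq> 0" using degY by auto
    then have "degree (h mod Y) \<le> degree h"
      using degree_mod_less[of Y h] \<open>degree h \<ge> m\<close> by (cases "h mod Y = 0") auto
    ultimately have "degree (h - h mod Y) \<le> degree h" by (intro degree_diff_le) auto
    moreover have "degree (Y * (h div Y)) = m + degree (h div Y)"
      using False degY by (intro degree_mult_eq) auto
    ultimately have "degree (h div Y) < degree h"
      using degY by (simp add: minus_mod_eq_mult_div)
    then show ?thesis by (rule less)
  qed
  then obtain g where g: "h div Y = (\<Sum>i<m. monom 1 i * pcompose (g i) Y)" by blast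
  let ?r = "h mod Y"
  have "Y \<noteq> 0" using degY by auto
  then have r: "degree ?r < m" using degree_mod_less[of Y h] degY by auto
  have "h = ?r + Y * (h div Y)" by simp
  also have "?r = (\<Sum>i<m. monom (coeff ?r i) i)"
  proof -
    have "?r = (\<Sum>i\<le>m - 1. monom (coeff ?r i) i)"
      using poly_as_sum_of_monoms'[of ?r "m - 1"] r by simp
    also have "{..m - 1} = {..<m}" using degY by auto
    finally show ?thesis .
  qed
  also have "Y * (h div Y) = (\<Sum>i<m. monom 1 i * (Y * pcompose (g i) Y))"
    unfolding g sum_distrib_left by (simp add: mult_ac)
  also have "(\<Sum>i<m. monom (coeff ?r i) i) + \<dots>
      = (\<Sum>i<m. monom 1 i * pcompose (pCons (coeff ?r i) (g i)) Y)"
    by (simp add: pcompose_pCons ring_distribs sum.distrib smult_monom)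
  finally show ?case by (rule exI[where x="\<lambda>i. pCons (coeff ?r i) (g i)"])
qed

text \<open>The coordinate of \<open>h\<close> at the basis vector \<open>t^i\<close>. It is
  determined by \<open>h\<close> for \<open>i < m\<close> and arbitrary beyond, whence the bound on
  \<open>i\<close> in most of what follows.\<close>

definition xi :: "nat \<Rightarrow> 'k poly \<Rightarrow> 'k poly" where
  "xi i h = (SOME g. h = (\<Sum>i<m. monom 1 i * pcompose (g i) Y)) i"

lemma xi_expansion: "h = (\<Sum>i<m. monom 1 i * pcompose (xi i h) Y)"
  using someI_ex[OF expansion_exists[of h]] unfolding xi_def .

lemma xi_unique: "h = (\<Sum>i<m. monom 1 i * pcompose (g i) Y) \<Longrightarrow> i < m \<Longrightarrow> xi i h = g i"
  using expansion_unique[of "\<lambda>i. xi i h" g i] xi_expansion[of h] by simp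

lemma xi_add: "i < m \<Longrightarrow> xi i (g + h) = xi i g + xi i h"
  by (rule xi_unique)
    (subst xi_expansion[of g], subst xi_expansion[of h], simp_all add: pcompose_add ring_distribs sum.distrib)

lemma xi_mult: "i < m \<Longrightarrow> xi i (h * pcompose g Y) = xi i h * g"
  by (rule xi_unique)
    (subst xi_expansion[of h], simp_all add: pcompose_mult sum_distrib_right mult.assoc)

lemma xi_0: "i < m \<Longrightarrow> xi i 0 = 0"
  by (rule xi_unique) auto

lemma xi_sum: "i < m \<Longrightarrow> xi i (\<Sum>l\<in>L. F l) = (\<Sum>l\<in>L. xi i (F l))"
  by (induction L rule: infinite_finite_induct) (auto simp: xi_add xi_0)

lemma xi_monom: "i < m \<Longrightarrow> j < m \<Longrightarrow> xi i (monom 1 j) = (if i = j then 1 else 0)"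
  by (rule xi_unique) (auto simp: if_distrib[of "\<lambda>g. pcompose g Y"] if_distrib[of "\<lambda>g. _ * g"] pcompose_1 cong: if_cong)

lemma xi_degree: "i < m \<Longrightarrow> xi i h \<noteq> 0 \<Longrightarrow> i + m * degree (xi i h) \<le> degree h"
  using expansion_degree(1)[OF xi_expansion] by blast

lemma xi_poly: "(\<Sum>i<m. poly (xi i h) (poly Y t) * t ^ i) = poly h t"
  by (subst (2) xi_expansion[of h]) (simp add: poly_sum poly_monom poly_pcompose mult.commute)

text \<open>The matrix over \<open>k[y]\<close> of multiplication by \<open>p\<close> on
  \<open>k[t]\<close>, in the basis \<open>1, t, ..., t^(m-1)\<close>, where \<open>y\<close> acts
  as \<open>Y(t)\<close>.\<close>

definition Mt :: "'k poly \<Rightarrow> 'k poly mat" where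
  "Mt p = mat m m (\<lambda>(i, j). xi i (p * monom 1 j))"

lemma Mt_carrier [simp]: "Mt p \<in> carrier_mat m m"
  and dim_Mt [simp]: "dim_row (Mt p) = m" "dim_col (Mt p) = m"
  and Mt_index [simp]: "i < m \<Longrightarrow> j < m \<Longrightarrow> Mt p $$ (i, j) = xi i (p * monom 1 j)"
  by (simp_all add: Mt_def)

lemma Mt_mult: "Mt (p * q) = Mt p * Mt q"
proof (rule eq_matI)
  fix i j assume "i < dim_row (Mt p * Mt q)" "j < dim_col (Mt p * Mt q)"
  then have ij: "i < m" "j < m" by auto
  have "p * q * monom 1 j = (\<Sum>l<m. p * monom 1 l * pcompose (xi l (q * monom 1 j)) Y)"
    by (subst mult.assoc, subst xi_expansion[of "q * monom 1 j"]) (simp add: sum_distrib_left mult.assoc)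
  then have "xi i (p * q * monom 1 j) = (\<Sum>l<m. xi i (p * monom 1 l) * xi l (q * monom 1 j))"
    by (simp only: xi_sum[OF ij(1)] xi_mult[OF ij(1)])
  also have "\<dots> = (\<Sum>l = 0..<m. Mt p $$ (i, l) * Mt q $$ (l, j))"
    using ij by (simp add: atLeast0LessThan)
  finally show "Mt (p * q) $$ (i, j) = (Mt p * Mt q) $$ (i, j)"
    using ij by (simp add: scalar_prod_def)
qed auto

lemma Mt_add: "Mt (p + q) = Mt p + Mt q"
  by (rule eq_matI) (auto simp: ring_distribs xi_add)

lemma Mt_pcompose: "Mt (pcompose g Y) = g \<cdot>\<^sub>m 1\<^sub>m m"
proof (rule eq_matI)
  fix i j assume "i < dim_row (g \<cdot>\<^sub>m 1\<^sub>m m)" "j < dim_col (g \<cdot>\<^sub>m 1\<^sub>m m)"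
  then show "Mt (pcompose g Y) $$ (i, j) = (g \<cdot>\<^sub>m 1\<^sub>m m) $$ (i, j)"
    using xi_mult[of i "monom 1 j" g] by (simp add: xi_monom mult.commute)
qed auto

text \<open>Multiplication respects the degree in \<open>t\<close> if \<open>y\<close> has weight
  \<open>m\<close> and the \<open>i\<close>-th basis vector has weight \<open>i\<close>.\<close>

lemma Mt_degree:
  assumes "i < m" "j < m" "Mt p $$ (i, j) \<noteq> 0"
  shows "i + m * degree (Mt p $$ (i, j)) \<le> degree p + j"
proof -
  have "i + m * degree (Mt p $$ (i, j)) \<le> degree (p * monom 1 j)"
    using xi_degree[of i "p * monom 1 j"] assms by simp
  also have "\<dots> \<le> degree p + j"
    using degree_mult_le[of p "monom 1 j"] degree_monom_le[of "1::'k" j] by linarith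
  finally show ?thesis .
qed

end

subsection \<open>Supports of determinants\<close>

lemma prod_keys_bound:
  assumes "finite I" "additive w" "\<And>i u. i \<in> I \<Longrightarrow> u \<in> keys (F i) \<Longrightarrow> w u \<le> b i"
    "u \<in> keys (\<Prod>i\<in>I. F i)"
  shows "w u \<le> (\<Sum>i\<in>I. b i)"
  using assms(1,3,4)
proof (induction I arbitrary: u)
  case empty
  then show ?case using additive_0[OF assms(2)] by (simp flip: single_one add: zero_prod_def)
next
  case (insert i I)
  have "u \<in> keys (F i * prod F I)" using insert by simp
  then obtain v v' where v: "u = v + v'" "v \<in> keys (F i)" "v' \<in> keys (prod F I)"
    using keys_mult by blast
  have "w v \<le> b i" "w v' \<le> sum b I" using insert v by auto
  then show ?case using v(1) insert.hyps additive_add[OF assms(2)] by simp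
qed

lemma keys_uminus: "keys (- f) = keys (f :: 'k::field laurent)"
  by (auto simp: in_keys_iff)

lemma keys_signof: "keys (signof p * f) = keys (f :: 'k::field laurent)"
  by (auto simp: sign_def keys_uminus)

text \<open>The shifts \<open>d j - d i\<close> cancel along every permutation. They let the basis
  vectors carry weights of their own, as the degree in \<open>t\<close> demands.\<close>

lemma det_keys_bound:
  fixes A :: "'k::field laurent mat"
  assumes A: "A \<in> carrier_mat n n" and w: "additive w"
    and bound: "\<And>i j u. i < n \<Longrightarrow> j < n \<Longrightarrow> u \<in> keys (A $$ (i, j)) \<Longrightarrow> w u \<le> c + d j - d i"
    and u: "u \<in> keys (det A)"
  shows "w u \<le> int n * c"
proof -
  have "u \<in> (\<Union>p\<in>{p. p permutes {0..<n}}. keys (signof p * (\<Prod>i = 0..<n. A $$ (i, p i))))"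
    using u unfolding det_def'[OF A] by (rule set_mp[OF keys_sum])
  then obtain p where p: "p permutes {0..<n}"
    and up: "u \<in> keys (signof p * (\<Prod>i = 0..<n. A $$ (i, p i)))"
    by blast
  have "w u \<le> (\<Sum>i = 0..<n. c + d (p i) - d i)"
  proof (rule prod_keys_bound[OF _ w])
    show "u \<in> keys (\<Prod>i = 0..<n. A $$ (i, p i))" using up by (simp only: keys_signof)
  next
    fix i u assume iu: "i \<in> {0..<n}" "u \<in> keys (A $$ (i, p i))"
    then have "p i \<in> {0..<n}" using permutes_in_image[OF p] by blast
    with iu show "w u \<le> c + d (p i) - d i" by (intro bound) simp_all
  qed simp
  also have "\<dots> = int n * c + (\<Sum>i = 0..<n. d (p i)) - (\<Sum>i = 0..<n. d i)"
    by (simp add: sum.distrib sum_subtractf)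
  also have "(\<Sum>i = 0..<n. d (p i)) = (\<Sum>i = 0..<n. d i)"
    using sum.permute[OF p, of d] by (simp add: o_def)
  finally show ?thesis by simp
qed

section \<open>Parts of weight zero\<close>

definition low :: "(int \<times> int \<Rightarrow> int) \<Rightarrow> 'k::field laurent \<Rightarrow> 'k laurent" where
  "low w f = (\<Sum>u\<in>keys f. mterm u (if w u = 0 then lk f u else 0))"

lemma lookup_low: "lk (low w f) u = (if w u = 0 then lk f u else 0)"
  unfolding low_def lookup_sum lookup_single when_def
  by (auto simp: in_keys_iff)

lemma low_add: "low w (f + g) = low w f + low w g"
  and low_uminus: "low w (- f) = - low w f"
  and low_0: "low w 0 = 0"
  by (rule poly_mapping_eqI, simp add: lookup_low lookup_add)+

lemma low_diff: "low w (f - g) = low w f - low w g"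
  using low_add[of w f "- g"] by (simp add: low_uminus)

lemma low_sum: "low w (\<Sum>i\<in>I. F i) = (\<Sum>i\<in>I. low w (F i))"
  by (induction I rule: infinite_finite_induct) (auto simp: low_add low_0)

lemma low_eq_self: "(\<And>u. u \<in> keys f \<Longrightarrow> w u = 0) \<Longrightarrow> low w f = f"
  by (rule poly_mapping_eqI) (auto simp: lookup_low in_keys_iff)

lemma low_eq_0: "(\<And>u. u \<in> keys f \<Longrightarrow> w u \<noteq> 0) \<Longrightarrow> low w f = 0"
  by (rule poly_mapping_eqI) (auto simp: lookup_low in_keys_iff)

lemma keys_multE:
  assumes "u \<in> keys (f * g)" "additive w"
  obtains v v' where "v \<in> keys f" "v' \<in> keys g" "w u = w v + w v'"
  using keys_mult[of f g] assms additive_add by blast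

text \<open>If no weight is negative, the part of weight 0 is the lowest part, and lowest parts
  multiply. Applied to determinants with suitable weights, this reads off extreme
  coefficients.\<close>

lemma low_mult:
  assumes w: "additive w" and f: "\<And>u. u \<in> keys f \<Longrightarrow> w u \<ge> 0" and g: "\<And>u. u \<in> keys g \<Longrightarrow> w u \<ge> 0"
  shows "low w (f * g) = low w f * low w g"
proof -
  define f' where "f' = f - low w f"
  define g' where "g' = g - low w g"
  have l: "w u = 0" if "u \<in> keys (low w h)" for u and h :: "'a laurent"
    using that by (auto simp: in_keys_iff lookup_low split: if_splits)
  have h: "w u > 0" if "u \<in> keys f' \<or> u \<in> keys g'" for u
  proof -
    have "w u \<noteq> 0" "u \<in> keys f \<or> u \<in> keys g"
      using that by (auto simp: in_keys_iff lookup_low f'_def g'_def lookup_minus split: if_splits)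
    then show ?thesis using f[of u] g[of u] by auto
  qed
  have "f * g = low w f * low w g + (low w f * g' + f' * low w g + f' * g')"
    by (simp add: f'_def g'_def algebra_simps)
  also have "low w \<dots> = low w (low w f * low w g) + (low w (low w f * g') + low w (f' * low w g) + low w (f' * g'))"
    by (simp only: low_add)
  also have "low w (low w f * low w g) = low w f * low w g"
    by (rule low_eq_self, erule keys_multE[OF _ w]) (simp add: l)
  also have "low w (low w f * g') = 0"
    by (rule low_eq_0, erule keys_multE[OF _ w]) (metis add.left_neutral h l less_irrefl)
  also have "low w (f' * low w g) = 0"
    by (rule low_eq_0, erule keys_multE[OF _ w]) (metis add.right_neutral h l less_irrefl)
  also have "low w (f' * g') = 0"
    by (rule low_eq_0, erule keys_multE[OF _ w]) (metis add_pos_pos h less_irrefl)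
  finally show ?thesis by simp
qed

lemma low_1: "additive w \<Longrightarrow> low w 1 = 1"
  by (rule low_eq_self) (simp add: additive_0 flip: single_one zero_prod_def)

lemma low_prod:
  assumes w: "additive w" and "finite I" "\<And>i u. i \<in> I \<Longrightarrow> u \<in> keys (F i) \<Longrightarrow> w u \<ge> 0"
  shows "low w (\<Prod>i\<in>I. F i) = (\<Prod>i\<in>I. low w (F i)) \<and> (\<forall>u\<in>keys (\<Prod>i\<in>I. F i). w u \<ge> 0)"
  using assms(2,3)
proof (induction I)
  case empty
  then show ?case using additive_0[OF w] low_1[OF w] by (simp flip: single_one add: zero_prod_def)
next
  case (insert i I)
  have IH: "low w (prod F I) = (\<Prod>i\<in>I. low w (F i))" "\<And>u. u \<in> keys (prod F I) \<Longrightarrow> w u \<ge> 0"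
    using insert.IH insert.prems by blast+
  have i: "\<And>u. u \<in> keys (F i) \<Longrightarrow> w u \<ge> 0" using insert.prems by blast
  have "w u \<ge> 0" if "u \<in> keys (F i * prod F I)" for u
  proof -
    from that obtain v v' where "u = v + v'" "v \<in> keys (F i)" "v' \<in> keys (prod F I)"
      using keys_mult by blast
    then show ?thesis using IH(2)[of v'] i[of v] additive_add[OF w] by simp
  qed
  moreover have "low w (F i * prod F I) = low w (F i) * low w (prod F I)"
    using w i IH(2) by (rule low_mult)
  ultimately show ?case using insert.hyps IH(1) by simp
qed

lemma low_det:
  assumes w: "additive w" and A: "A \<in> carrier_mat n n"
    and nn: "\<And>i j u. i < n \<Longrightarrow> j < n \<Longrightarrow> u \<in> keys (A $$ (i, j)) \<Longrightarrow> w u \<ge> 0"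
  shows "low w (det A) = det (map_mat (low w) A)"
proof -
  have s: "low w (signof p * f) = signof p * low w f" for p and f :: "'a laurent"
    by (auto simp: sign_def low_uminus)
  have A': "map_mat (low w) A \<in> carrier_mat n n" using A by simp
  show ?thesis
    unfolding det_def'[OF A] det_def'[OF A'] low_sum s
  proof (intro sum.cong refl arg_cong2[where f="(*)"])
    fix p assume "p \<in> {p. p permutes {0..<n}}"
    then have p: "p i < n" if "i < n" for i using permutes_in_image[of p "{0..<n}" i] that by auto
    have "low w (\<Prod>i = 0..<n. A $$ (i, p i)) = (\<Prod>i = 0..<n. low w (A $$ (i, p i)))"
      by (rule conjunct1[OF low_prod[OF w]]) (simp, metis nn p atLeastLessThan_iff)
    also have "\<dots> = (\<Prod>i = 0..<n. map_mat (low w) A $$ (i, p i))"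
      using A p by (intro prod.cong) auto
    finally show "low w (\<Prod>i = 0..<n. A $$ (i, p i)) = (\<Prod>i = 0..<n. map_mat (low w) A $$ (i, p i))" .
  qed
qed

subsection \<open>Polynomials in \<open>y\<close> as Laurent polynomials\<close>

definition yL :: "'k::field poly \<Rightarrow> 'k laurent" where
  "yL p = (\<Sum>j\<le>degree p. mterm (0, int j) (coeff p j))"

lemma lookup_yL: "lk (yL p) u = (if fst u = 0 \<and> snd u \<ge> 0 then coeff p (nat (snd u)) else 0)"
proof -
  obtain a b where u: "u = (a, b)" by (cases u)
  have *: "(0, int j) = (a, b) \<longleftrightarrow> a = 0 \<and> b \<ge> 0 \<and> j = nat b" for j by auto
  show ?thesis
    unfolding yL_def lookup_sum lookup_single when_def u *
    by (cases "a = 0 \<and> b \<ge> 0") (auto simp: coeff_eq_0)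
qed

lemma keys_yL: "u \<in> keys (yL p) \<longleftrightarrow> fst u = 0 \<and> snd u \<ge> 0 \<and> coeff p (nat (snd u)) \<noteq> 0"
  by (auto simp: in_keys_iff lookup_yL)

lemma keys_yL_D:
  assumes "u \<in> keys (yL p)"
  shows "fst u = 0" "snd u \<ge> 0" "snd u \<le> int (degree p)" "p \<noteq> 0"
  using assms le_degree[of p "nat (snd u)"] by (auto simp: keys_yL)

lemma yL_0 [simp]: "yL 0 = 0"
  and yL_add: "yL (p + q) = yL p + yL q"
  by (rule poly_mapping_eqI, simp add: lookup_yL lookup_add)+

lemma yL_monom: "yL (monom c n) = mterm (0, int n) c"
  by (rule poly_mapping_eqI) (auto simp: lookup_yL lookup_single when_def)

lemma yL_1 [simp]: "yL 1 = 1"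
  using yL_monom[of 1 0] by (simp add: monom_0 one_pCons[symmetric] flip: zero_prod_def)

lemma yL_smult: "yL (Polynomial.smult c p) = mterm (0, 0) c * yL p"
  by (rule poly_mapping_eqI) (simp add: lookup_yL lookup_mterm_mult minus_prod_def)

lemma yL_pCons_0: "yL (pCons 0 p) = mterm (0, 1) 1 * yL p"
proof (rule poly_mapping_eqI)
  fix u :: "int \<times> int"
  have "nat (snd u) = Suc (nat (snd u - 1))" if "snd u > 0" using that by simp
  then show "lk (yL (pCons 0 p)) u = lk (mterm (0, 1) 1 * yL p) u"
    by (cases "snd u \<le> 0") (auto simp: lookup_yL lookup_mterm_mult minus_prod_def coeff_pCons split: nat.splits)
qed

lemma yL_mult: "yL (p * q) = yL p * yL q"
proof (induction p)
  case (pCons c p)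
  have "pCons c p = Polynomial.smult c 1 + pCons 0 p" by simp
  then have "yL (pCons c p) = mterm (0, 0) c + mterm (0, 1) 1 * yL p"
    by (simp only: yL_add yL_smult yL_pCons_0 yL_1 mult_1_right)
  then show ?case
    by (simp add: yL_add yL_smult yL_pCons_0 pCons.IH algebra_simps)
qed simp

interpretation yL: comm_ring_hom "yL :: 'k::field poly \<Rightarrow> 'k laurent"
  by unfold_locales (simp_all add: yL_add yL_mult)

lemma eval_yL:
  assumes "fst P \<noteq> 0" "snd P \<noteq> 0"
  shows "eval (yL p) P = poly p (snd P)"
proof (induction p)
  case (pCons c p)
  have "pCons c p = Polynomial.smult c 1 + pCons 0 p" by simp
  then have "yL (pCons c p) = mterm (0, 0) c + mterm (0, 1) 1 * yL p"
    by (simp only: yL_add yL_smult yL_pCons_0 yL_1 mult_1_right)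
  then show ?case using assms pCons by (simp add: eval_mult eval_mterm)
qed simp

lemma comm_ring_hom_eval:
  assumes "fst P \<noteq> 0" "snd P \<noteq> 0"
  shows "comm_ring_hom (\<lambda>f. eval f P)"
  by unfold_locales (simp_all add: eval_mult assms)

subsection \<open>The equation of a parametrized curve\<close>

text \<open>The orders of the factors at 0 add up to \<open>n\<close>, and so do their degrees; as
  an order never exceeds the degree, the two agree for each factor.\<close>

lemma factor_of_monom:
  fixes f g :: "'k::field poly"
  assumes "f * g = monom c n" "c \<noteq> 0"
  shows "f = monom (lead_coeff f) (degree f)"
proof -
  have "f * g \<noteq> 0" using assms by (simp add: monom_eq_0_iff)
  then have nz: "f \<noteq> 0" "g \<noteq> 0" by auto
  have "order 0 f + order 0 g = order 0 (monom c n)"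
    using order_mult[OF \<open>f * g \<noteq> 0\<close>, of 0] assms(1) by simp
  also have "\<dots> = n" using assms(2) by (simp add: order_0_monom)
  also have "n = degree f + degree g"
    using degree_mult_eq[OF nz] assms by (simp add: degree_monom_eq)
  finally have "order 0 f = degree f" using order_degree[OF nz(1), of 0] order_degree[OF nz(2), of 0] by linarith
  then have "monom 1 (degree f) dvd f"
    using order_1[of 0 f] by (simp add: monom_altdef)
  then obtain h where h: "f = monom 1 (degree f) * h" by (elim dvdE)
  then have "h \<noteq> 0" using nz by auto
  then have "degree f = degree f + degree h"
    using h by (metis degree_monom_eq degree_mult_eq monom_eq_0_iff zero_neq_one)
  then obtain a where "h = [:a:]" by (metis add_cancel_left_right degree_eq_zeroE)
  then have "f = monom a (degree f)" using h by (simp add: smult_monom mult.commute)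
  then show ?thesis by (metis lead_coeff_monom)
qed

lemma pcompose_monom: "pcompose (monom 1 n) q = (q :: 'k::field poly) ^ n"
  by (induction n) (simp_all add: monom_Suc pcompose_pCons monom_0)

abbreviation xL :: "'k::field laurent" where "xL \<equiv> mterm (1, 0) 1"

lemma additive_linear: "additive (\<lambda>u. a * fst u + b * snd u)"
  by (simp add: additive_def algebra_simps)

context free_basis
begin

text \<open>The norm of \<open>x p(t) - 1\<close> from \<open>k[x, t]\<close> down to \<open>k[x, y]\<close>, where \<open>y = Y(t)\<close>: the equation
  of the curve with parametrization \<open>t \<mapsto> (1/p(t), Y(t))\<close>.\<close>

definition Gm :: "'k poly \<Rightarrow> 'k laurent mat" where
  "Gm p = mat m m (\<lambda>(i, j). xL * yL (Mt p $$ (i, j)) - (if i = j then 1 else 0))"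

definition G :: "'k poly \<Rightarrow> 'k laurent" where
  "G p = det (Gm p)"

lemma Gm_carrier [simp]: "Gm p \<in> carrier_mat m m"
  and dim_Gm [simp]: "dim_row (Gm p) = m" "dim_col (Gm p) = m"
  by (simp_all add: Gm_def)

lemma Gm_index: "i < m \<Longrightarrow> j < m \<Longrightarrow> Gm p $$ (i, j) = xL * yL (Mt p $$ (i, j)) - (if i = j then 1 else 0)"
  by (simp add: Gm_def)

lemma keys_Mt_bound:
  assumes "i < m" "j < m" "u \<in> keys (yL (Mt p $$ (i, j)))"
  shows "fst u = 0" "snd u \<ge> 0" "int m * snd u \<le> int (degree p) + int j - int i"
proof -
  note u = keys_yL_D[OF assms(3)]
  show "fst u = 0" "snd u \<ge> 0" using u by auto
  have "i + m * degree (Mt p $$ (i, j)) \<le> degree p + j"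
    using Mt_degree[OF assms(1,2)] u by blast
  then have "int i + int m * int (degree (Mt p $$ (i, j))) \<le> int (degree p) + int j"
    by (metis of_nat_add of_nat_le_iff of_nat_mult)
  moreover have "int m * snd u \<le> int m * int (degree (Mt p $$ (i, j)))"
    using u(3) by (intro mult_left_mono) auto
  ultimately show "int m * snd u \<le> int (degree p) + int j - int i" by linarith
qed

lemma keys_Gm:
  assumes "i < m" "j < m" "u \<in> keys (Gm p $$ (i, j))"
  shows "fst u = 1 \<and> snd u \<ge> 0 \<and> int m * snd u \<le> int (degree p) + int j - int i \<or> u = 0 \<and> i = j"
proof -
  have "u \<in> keys (xL * yL (Mt p $$ (i, j))) \<or> u = 0 \<and> i = j"
    using assms keys_diff[of "xL * yL (Mt p $$ (i, j))" "if i = j then 1 else 0"]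
    by (auto simp: Gm_index split: if_splits)
  moreover have "fst u = 1 \<and> snd u \<ge> 0 \<and> int m * snd u \<le> int (degree p) + int j - int i"
    if "u \<in> keys (xL * yL (Mt p $$ (i, j)))"
  proof -
    from that obtain v where "v \<in> keys (yL (Mt p $$ (i, j)))" "u = (1, 0) + v"
      by (auto simp: keys_mterm_mult simp del: Mt_index)
    then show ?thesis using keys_Mt_bound[OF assms(1,2), of v p] by simp
  qed
  ultimately show ?thesis by blast
qed

text \<open>Four half-planes, one weight for each. Only the last, the edge from 0 to
  \<open>(m, degree p)\<close>, uses the weights \<open>d i = int i\<close> of the basis
  vectors.\<close>

lemma keys_G:
  assumes "u \<in> keys (G p)"
  shows "fst u \<ge> 0" "fst u \<le> int m" "snd u \<ge> 0" "int m * snd u \<le> int (degree p) * fst u"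
proof -
  have "(\<lambda>u. (-1) * fst u + 0 * snd u) u \<le> int m * 0"
    using assms unfolding G_def
    by (rule det_keys_bound[OF Gm_carrier additive_linear, where d="\<lambda>_. 0", rotated])
      (use keys_Gm in fastforce)
  then show "fst u \<ge> 0" by simp
  have "(\<lambda>u. 1 * fst u + 0 * snd u) u \<le> int m * 1"
    using assms unfolding G_def
    by (rule det_keys_bound[OF Gm_carrier additive_linear, where d="\<lambda>_. 0", rotated])
      (use keys_Gm in fastforce)
  then show "fst u \<le> int m" by simp
  have "(\<lambda>u. 0 * fst u + (-1) * snd u) u \<le> int m * 0"
    using assms unfolding G_def
    by (rule det_keys_bound[OF Gm_carrier additive_linear, where d="\<lambda>_. 0", rotated])
      (use keys_Gm in fastforce)
  then show "snd u \<ge> 0" by simp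
  have "(\<lambda>u. (- int (degree p)) * fst u + int m * snd u) u \<le> int m * 0"
    using assms unfolding G_def
    by (rule det_keys_bound[OF Gm_carrier additive_linear, where d="\<lambda>i. int i", rotated])
      (use keys_Gm in fastforce)
  then show "int m * snd u \<le> int (degree p) * fst u" by simp
qed

text \<open>The norm of \<open>Y ^ K\<close> is \<open>y^(m K)\<close>, so its factor, the norm of
  \<open>p\<close>, is a monomial. A norm has at most the degree of its argument; for
  \<open>p\<close> and \<open>Z\<close> these bounds add up to the exact total, so both are
  attained.\<close>

lemma det_Mt_eq_monom:
  assumes "p * Z = Y ^ K"
  shows "\<exists>c. c \<noteq> 0 \<and> det (Mt p) = monom c (degree p)"
proof -
  have "Y \<noteq> 0" using degY by auto
  then have nz: "p \<noteq> 0" "Z \<noteq> 0" using assms by auto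
  have deg: "degree p + degree Z = m * K"
    using degree_mult_eq[OF nz] assms by (simp add: degree_power_eq[OF \<open>Y \<noteq> 0\<close>] mult.commute)
  have "Mt (Y ^ K) = monom 1 K \<cdot>\<^sub>m 1\<^sub>m m"
    using Mt_pcompose[of "monom 1 K"] by (simp add: pcompose_monom)
  moreover have "det (Mt (Y ^ K)) = det (Mt p) * det (Mt Z)"
    unfolding assms[symmetric] Mt_mult by (rule det_mult) auto
  ultimately have "det (Mt p) * det (Mt Z) = monom 1 K ^ m" by simp
  also have "\<dots> = monom 1 (m * K)" by (simp add: monom_power mult.commute)
  finally have prod: "det (Mt p) * det (Mt Z) = monom 1 (m * K)" .
  have bound: "degree (det (Mt r)) \<le> degree r" for r :: "'k poly"
  proof (cases "det (Mt r) = 0")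
    case False
    have "(0, int (degree (det (Mt r)))) \<in> keys (det (map_mat yL (Mt r)))"
      using False by (simp add: keys_yL)
    then have "(\<lambda>u. 0 * fst u + int m * snd u) (0, int (degree (det (Mt r)))) \<le> int m * int (degree r)"
      by (rule det_keys_bound[OF _ additive_linear, where d="\<lambda>i. int i", rotated 2])
        (use keys_Mt_bound in \<open>force simp del: Mt_index\<close>)+
    then show ?thesis using degY by (simp flip: of_nat_mult)
  qed simp
  have nz': "det (Mt p) \<noteq> 0" "det (Mt Z) \<noteq> 0"
    using prod by (auto simp: monom_eq_0_iff)
  then have "degree (det (Mt p)) + degree (det (Mt Z)) = m * K"
    using degree_mult_eq[OF nz'] prod by (simp add: degree_monom_eq)
  then have "degree (det (Mt p)) = degree p" using bound[of p] bound[of Z] deg by linarith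
  moreover have "lead_coeff (det (Mt p)) \<noteq> 0" using nz' by (simp only: leading_coeff_0_iff not_False_eq_True)
  ultimately show ?thesis
    using factor_of_monom[OF prod] by (intro exI[of _ "lead_coeff (det (Mt p))"] conjI) simp_all
qed

text \<open>Multiplying \<open>x p - 1\<close> by \<open>Z\<close> gives \<open>x y\<^sup>K - Z\<close>, whose norm is supported in \<open>{(i, j). K i \<le> j}\<close>,
  and the norm of \<open>Z\<close> is a monomial.\<close>

lemma keys_G_lower:
  assumes "p * Z = Y ^ K" "u \<in> keys (G p)"
  shows "int (degree p) - int K * (int m - fst u) \<le> snd u"
proof -
  have "Y \<noteq> 0" using degY by auto
  then have nz: "p \<noteq> 0" "Z \<noteq> 0" using assms by auto
  have deg: "degree p + degree Z = m * K"
    using degree_mult_eq[OF nz] assms by (simp add: degree_power_eq[OF \<open>Y \<noteq> 0\<close>] mult.commute)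
  obtain c where c: "c \<noteq> 0" "det (Mt Z) = monom c (degree Z)"
    using det_Mt_eq_monom[of Z p K] assms(1) by (auto simp: mult.commute)
  let ?B = "map_mat yL (Mt Z)"
  have "Mt (Y ^ K) = monom 1 K \<cdot>\<^sub>m 1\<^sub>m m"
    using Mt_pcompose[of "monom 1 K"] by (simp add: pcompose_monom)
  then have MM: "map_mat yL (Mt p) * ?B = map_mat yL (monom 1 K \<cdot>\<^sub>m 1\<^sub>m m)"
    using Mt_mult[of p Z] yL.mat_hom_mult[of "Mt p" m m "Mt Z" m] assms(1) by simp
  have Gm_eq: "Gm p = xL \<cdot>\<^sub>m map_mat yL (Mt p) - 1\<^sub>m m"
    by (rule eq_matI) (auto simp: Gm_def)
  have "Gm p * ?B = xL \<cdot>\<^sub>m (map_mat yL (Mt p) * ?B) - ?B"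
    unfolding Gm_eq
    by (simp add: minus_mult_distrib_mat[where nr=m and n=m and nc=m]
        mult_smult_assoc_mat[where nr=m and n=m and nc=m])
  then have prod: "Gm p * ?B = xL \<cdot>\<^sub>m map_mat yL (monom 1 K \<cdot>\<^sub>m 1\<^sub>m m) - ?B" unfolding MM .
  have entry: "(Gm p * ?B) $$ (i, j) = (if i = j then mterm (1, int K) 1 else 0) - yL (Mt Z $$ (i, j))"
    if "i < m" "j < m" for i j
    unfolding prod using that by (simp add: yL_monom mterm_mult)
  have Gk: "G p * mterm (0, int (degree Z)) c = det (Gm p * ?B)"
    unfolding G_def using c det_mult[of "Gm p" m ?B] by (simp add: yL_monom)
  have "u + (0, int (degree Z)) \<in> keys (mterm (0, int (degree Z)) c * G p)"
    using assms(2) c(1) by (auto simp: keys_mterm_mult add.commute)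
  then have "u + (0, int (degree Z)) \<in> keys (det (Gm p * ?B))"
    using Gk by (simp add: mult.commute)
  then have "(\<lambda>u. int K * fst u + (-1) * snd u) (u + (0, int (degree Z))) \<le> int m * 0"
  proof (rule det_keys_bound[OF _ additive_linear, where d="\<lambda>_. 0", rotated 2])
    fix i j v assume ij: "i < m" "j < m" and v: "v \<in> keys ((Gm p * ?B) $$ (i, j))"
    from v have "v = (1, int K) \<or> v \<in> keys (yL (Mt Z $$ (i, j)))"
      unfolding entry[OF ij] using keys_diff by (fastforce split: if_splits)
    then show "int K * fst v + -1 * snd v \<le> 0 + 0 - 0"
      using keys_Mt_bound(1,2)[OF ij, of v Z] by auto
  qed auto
  moreover have "int (degree Z) = int m * int K - int (degree p)"
    using deg by (simp flip: of_nat_mult)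
  ultimately show ?thesis by (simp add: algebra_simps)
qed

text \<open>At \<open>x = 0\<close> the matrix is minus the identity.\<close>

lemma lookup_G_0: "lk (G p) 0 = (-1) ^ m"
proof -
  let ?w = "\<lambda>u::int\<times>int. 1 * fst u + 0 * snd u"
  have "low ?w (G p) = det (map_mat (low ?w) (Gm p))"
    unfolding G_def by (rule low_det[OF additive_linear Gm_carrier]) (use keys_Gm in fastforce)
  also have "map_mat (low ?w) (Gm p) = (-1) \<cdot>\<^sub>m 1\<^sub>m m"
  proof (rule eq_matI)
    fix i j assume "i < dim_row ((-1) \<cdot>\<^sub>m 1\<^sub>m m :: 'k laurent mat)" "j < dim_col ((-1) \<cdot>\<^sub>m 1\<^sub>m m :: 'k laurent mat)"
    then have ij: "i < m" "j < m" by auto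
    have "low ?w (xL * yL (Mt p $$ (i, j))) = 0"
      by (intro low_eq_0) (auto simp: keys_mterm_mult keys_yL simp del: Mt_index)
    moreover have "low ?w (if i = j then 1 else 0 :: 'k laurent) = (if i = j then 1 else 0)"
      by (simp only: low_1[OF additive_linear] low_0 split: if_splits) simp
    ultimately show "map_mat (low ?w) (Gm p) $$ (i, j) = ((-1) \<cdot>\<^sub>m 1\<^sub>m m) $$ (i, j)"
      using ij by (simp add: Gm_index low_diff del: Mt_index)
  qed (auto simp: Gm_def)
  also have "det \<dots> = (-1) ^ m" by simp
  finally have "lk (low ?w (G p)) 0 = lk ((-1) ^ m :: 'k laurent) 0" by simp
  moreover have "lk ((-1) ^ n :: 'k laurent) 0 = (-1) ^ n" for n
    by (induction n) auto
  ultimately show ?thesis by (simp add: lookup_low)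
qed

text \<open>Once \<open>x\<close> is divided out of every row, the top coefficient in
  \<open>x\<close> becomes the part of weight 0. It is the norm of \<open>p\<close>, a monomial by
  \<open>det_Mt_eq_monom\<close>.\<close>

lemma lookup_G_top:
  assumes "p * Z = Y ^ K"
  shows "\<exists>c. c \<noteq> 0 \<and> (\<forall>b. lk (G p) (int m, b) = (if b = int (degree p) then c else 0))"
proof -
  let ?w = "\<lambda>u::int\<times>int. (-1) * fst u + 0 * snd u"
  let ?xi = "mterm (-1, 0) 1 :: 'k laurent"
  obtain c where c: "c \<noteq> 0" "det (Mt p) = monom c (degree p)"
    using det_Mt_eq_monom[OF assms] by blast
  let ?A = "?xi \<cdot>\<^sub>m Gm p"
  have A: "?A \<in> carrier_mat m m" by simp
  have entry: "?A $$ (i, j) = yL (Mt p $$ (i, j)) - (if i = j then ?xi else 0)" if "i < m" "j < m" for i j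
  proof -
    have "?A $$ (i, j) = ?xi * xL * yL (Mt p $$ (i, j)) - ?xi * (if i = j then 1 else 0)"
      using that by (simp add: Gm_def algebra_simps del: Mt_index)
    also have "?xi * xL = 1" by (simp add: mterm_mult flip: zero_prod_def)
    finally show ?thesis by simp
  qed
  have "low ?w (det ?A) = det (map_mat (low ?w) ?A)"
  proof (rule low_det[OF additive_linear A])
    fix i j u assume ij: "i < m" "j < m" and "u \<in> keys (?A $$ (i, j))"
    then have "u \<in> keys (yL (Mt p $$ (i, j))) \<or> u = (-1, 0)"
      unfolding entry[OF ij] using keys_diff by (fastforce split: if_splits)
    then show "-1 * fst u + 0 * snd u \<ge> 0" by (auto simp: keys_yL simp del: Mt_index)
  qed
  also have "map_mat (low ?w) ?A = map_mat yL (Mt p)"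
  proof (rule eq_matI)
    fix i j assume "i < dim_row (map_mat yL (Mt p))" "j < dim_col (map_mat yL (Mt p))"
    then have ij: "i < m" "j < m" by auto
    have "low ?w (yL (Mt p $$ (i, j))) = yL (Mt p $$ (i, j))"
      using keys_yL_D(1) by (intro low_eq_self) auto
    moreover have "low ?w (if i = j then ?xi else 0) = 0"
      using low_0 by (auto intro!: low_eq_0)
    ultimately have "low ?w (?A $$ (i, j)) = yL (Mt p $$ (i, j))"
      unfolding entry[OF ij] by (simp add: low_diff del: Mt_index)
    then show "map_mat (low ?w) ?A $$ (i, j) = map_mat yL (Mt p) $$ (i, j)"
      using ij by simp
  qed (auto simp: Gm_def)
  finally have low: "low ?w (det ?A) = mterm (0, int (degree p)) c"
    using c by (simp add: yL_monom)
  have "?xi ^ n = mterm (- int n, 0) 1" for n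
    by (induction n) (auto simp: mterm_mult zero_prod_def[symmetric])
  then have "det ?A = mterm (- int m, 0) 1 * G p" by (simp add: G_def Gm_def)
  then have "lk (G p) (int m, b) = lk (low ?w (det ?A)) (0, b)" for b
    by (simp add: lookup_low lookup_mterm_mult)
  then show ?thesis using c(1) unfolding low by (intro exI[of _ c]) (simp add: lookup_single when_def)
qed

text \<open>Since \<open>p\<close> is 1 modulo \<open>Y - 1\<close>, its multiplication matrix
  becomes the identity at \<open>y = 1\<close>, and every entry of \<open>Gm p\<close> vanishes at
  \<open>(1, 1)\<close>. Each term of the determinant is a product of \<open>m\<close> entries.
  Writing \<open>Y - 1\<close> as a composition with \<open>Y\<close> lets \<open>xi_mult\<close>
  pull it out.\<close>

lemma moments_vanish_G:
  assumes "(Y - 1) dvd (p - 1)"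
  shows "moments_vanish m (G p)"
proof -
  from assms obtain S where S: "p - 1 = (Y - 1) * S" by (elim dvdE)
  have p: "p = 1 + S * pcompose [:-1, 1:] Y" using S by (simp add: pcompose_pCons algebra_simps)
  have entry: "moments_vanish 1 (Gm p $$ (i, j))" if "i < m" "j < m" for i j
  proof -
    have "p * monom 1 j = monom 1 j + (S * monom 1 j) * pcompose [:-1, 1:] Y"
      by (subst p) (simp add: algebra_simps)
    then have "xi i (p * monom 1 j) = (if i = j then 1 else 0) + xi i (S * monom 1 j) * [:-1, 1:]"
      using that by (simp add: xi_add xi_mult xi_monom del: pcompose_pCons mult_pCons_right)
    then have "poly (Mt p $$ (i, j)) 1 = (if i = j then 1 else 0)" using that by simp
    then show ?thesis
      unfolding moments_vanish_1_iff Gm_index[OF that]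
      by (simp add: eval_mult eval_yL eval_mterm del: Mt_index)
  qed
  have "moments_vanish m (signof s * (\<Prod>i = 0..<m. Gm p $$ (i, s i)))" if "s permutes {0..<m}" for s
  proof -
    have "moments_vanish (card {0..<m}) (\<Prod>i = 0..<m. Gm p $$ (i, s i))"
      using permutes_in_image[OF that] by (intro moments_vanish_prod entry) auto
    then show ?thesis by (intro moments_vanish_mult_left) simp
  qed
  then show ?thesis
    unfolding G_def det_def'[OF Gm_carrier] by (intro moments_vanish_sum) auto
qed

text \<open>At \<open>y = Y(t)\<close> the row vector \<open>(1, t, ..., t^(m-1))\<close> is a left
  eigenvector of \<open>Mt p\<close> with eigenvalue \<open>p(t)\<close>, so it lies in the left
  kernel of \<open>Gm p\<close> at \<open>x = 1 / p(t)\<close>.\<close>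

lemma eval_G_param:
  assumes "poly p t \<noteq> 0" "poly Y t \<noteq> 0"
  shows "eval (G p) (1 / poly p t, poly Y t) = 0"
proof -
  let ?P = "(1 / poly p t, poly Y t)"
  interpret ev: comm_ring_hom "\<lambda>f. eval f ?P"
    by (rule comm_ring_hom_eval) (use assms in auto)
  let ?A = "map_mat (\<lambda>f. eval f ?P) (Gm p)"
  have A: "?A \<in> carrier_mat m m" by simp
  have entry: "?A $$ (i, j) = poly (xi i (p * monom 1 j)) (poly Y t) / poly p t - (if i = j then 1 else 0)"
    if "i < m" "j < m" for i j
    using that assms by (simp add: Gm_def eval_mult eval_yL eval_mterm)
  define v where "v = vec m (\<lambda>i. t ^ i)"
  have v: "v \<in> carrier_vec m" "v \<noteq> 0\<^sub>v m"
  proof -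
    have "vec_index v 0 \<noteq> vec_index (0\<^sub>v m) 0" using degY by (simp add: v_def)
    then show "v \<noteq> 0\<^sub>v m" by auto
  qed (simp add: v_def)
  have "transpose_mat ?A *\<^sub>v v = 0\<^sub>v m"
  proof (rule eq_vecI)
    fix j assume "j < dim_vec (0\<^sub>v m :: 'k vec)"
    then have j: "j < m" by simp
    have "vec_index (transpose_mat ?A *\<^sub>v v) j = (\<Sum>i = 0..<m. ?A $$ (i, j) * t ^ i)"
      using j A by (simp add: scalar_prod_def v_def)
    also have "\<dots> = (\<Sum>i<m. poly (xi i (p * monom 1 j)) (poly Y t) * t ^ i / poly p t - (if i = j then t ^ i else 0))"
      unfolding atLeast0LessThan
      by (intro sum.cong refl) (use j in \<open>simp add: entry left_diff_distrib del: index_map_mat\<close>)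
    also have "\<dots> = (\<Sum>i<m. poly (xi i (p * monom 1 j)) (poly Y t) * t ^ i) / poly p t - t ^ j"
      using j by (simp add: sum_subtractf sum_divide_distrib)
    also have "\<dots> = 0" unfolding xi_poly using assms by (simp add: poly_monom)
    finally show "vec_index (transpose_mat ?A *\<^sub>v v) j = vec_index (0\<^sub>v m) j" using j by simp
  qed (use A in simp)
  then have "det (transpose_mat ?A) = 0"
    using v by (subst det_0_iff_vec_prod_zero_field[where n=m]) auto
  then show ?thesis by (simp add: det_transpose[OF A] G_def)
qed

end

subsection \<open>Irreducibility and uniqueness\<close>

text \<open>Being 1 modulo \<open>V\<close>, the factor \<open>X\<close> is invertible modulo every
  power of \<open>V\<close>.\<close>

lemma dvd_mult_unipotent:
  fixes V X P :: "'k::field poly"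
  assumes "V dvd X - 1" "V ^ k dvd X * P"
  shows "V ^ k dvd P"
  using assms(2)
proof (induction k)
  case (Suc k)
  show ?case
  proof (cases "V = 0")
    case True
    then have "X = 1" using assms(1) by simp
    then show ?thesis using Suc by simp
  next
    case False
    have "V ^ k dvd P"
      using Suc.prems by (intro Suc.IH) (metis dvd_trans le_imp_power_dvd lessI less_imp_le)
    then obtain R where R: "P = V ^ k * R" by (elim dvdE)
    have "V ^ k * V dvd V ^ k * (X * R)" using Suc.prems by (simp add: R mult_ac)
    then have "V dvd X * R" using False by simp
    moreover have "V dvd (X - 1) * R" using assms(1) by (rule dvd_mult2)
    ultimately have "V dvd X * R - (X - 1) * R" by (rule dvd_diff)
    then have "V dvd R" by (simp add: algebra_simps)
    then show ?thesis unfolding R by (simp add: mult.commute mult_dvd_mono)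
  qed
qed simp

lemma dvd_mult_unipotent_power:
  fixes V X P :: "'k::field poly"
  assumes "V dvd X - 1" "V ^ k dvd X ^ n * P"
  shows "V ^ k dvd P"
  using assms(2)
proof (induction n)
  case (Suc n)
  then have "V ^ k dvd X * (X ^ n * P)" by (simp add: mult_ac)
  then show ?case using Suc.IH dvd_mult_unipotent[OF assms(1)] by blast
qed simp

lemma smult_sum_right:
  "Polynomial.smult c (\<Sum>i\<in>I. F i) = (\<Sum>i\<in>I. Polynomial.smult c (F i :: 'k::field poly))"
  by (induction I rule: infinite_finite_induct) (auto simp: smult_add_right)

lemma of_nat_choose_eq_falling: "of_nat (n choose a) = falling (int n) a / (fact a :: 'k::field_char_0)"
  by (simp add: falling_def binomial_gbinomial gbinomial_prod_rev atLeast0LessThan)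

lemma ex_box: "\<exists>n::nat. \<forall>u\<in>keys (h :: 'k::field laurent). \<bar>fst u\<bar> \<le> int n \<and> \<bar>snd u\<bar> \<le> int n"
proof -
  have "finite ((\<lambda>u. max \<bar>fst u\<bar> \<bar>snd u\<bar>) ` keys h)" by simp
  then obtain B where "\<forall>x\<in>(\<lambda>u. max \<bar>fst u\<bar> \<bar>snd u\<bar>) ` keys h. x \<le> B"
    using bdd_above_finite unfolding bdd_above_def by blast
  then have "\<forall>u\<in>keys h. \<bar>fst u\<bar> \<le> int (nat B) \<and> \<bar>snd u\<bar> \<le> int (nat B)" by fastforce
  then show ?thesis by blast
qed

text \<open>The lattice points of the triangle with vertices \<open>(0, 0)\<close>, \<open>(m, q)\<close> and \<open>(m - q/K, 0)\<close>.
  The triangle \<open>IT\<close> has \<open>m = M + N\<close>, \<open>q = K N\<close>, and \<open>RT\<close> has \<open>m = M\<close>, \<open>q = M + N\<close>.\<close>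

definition tri :: "nat \<Rightarrow> nat \<Rightarrow> nat \<Rightarrow> (int \<times> int) set" where
  "tri K m q = {u. 0 \<le> fst u \<and> fst u \<le> int m \<and> 0 \<le> snd u \<and> int m * snd u \<le> int q * fst u \<and>
     int q - int K * (int m - fst u) \<le> snd u}"

text \<open>\<open>XZ\<close> makes the norm of \<open>X\<close> a monomial and provides the edge of
  slope \<open>K\<close>; \<open>unipotent\<close> gives the multiplicity at \<open>(1, 1)\<close>;
  \<open>coprime\<close> makes the monomials \<open>x^i y^j\<close> with \<open>0 <= i < m\<close>
  have distinct degrees along the curve.\<close>

locale curve = free_basis Y for Y :: "'k::field_char_0 poly" +
  fixes X Z :: "'k poly" and K :: nat
  assumes XZ: "X * Z = Y ^ K"
    and unipotent: "(Y - 1) dvd (X - 1)"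
    and coprime: "coprime m (degree X)"
begin

abbreviation q :: nat where "q \<equiv> degree X"

lemma nz: "X \<noteq> 0" "Y \<noteq> 0"
proof -
  show "Y \<noteq> 0" using degY by auto
  then show "X \<noteq> 0" using XZ by auto
qed

section \<open>The vanishing ideal of the parametrized curve\<close>

definition vanishes :: "'k laurent \<Rightarrow> bool" where
  "vanishes h \<longleftrightarrow> (\<forall>t. poly X t \<noteq> 0 \<longrightarrow> poly Y t \<noteq> 0 \<longrightarrow> eval h (1 / poly X t, poly Y t) = 0)"

lemma vanishes_diff: "vanishes g \<Longrightarrow> vanishes h \<Longrightarrow> vanishes (g - h)"
  by (simp add: vanishes_def)

lemma vanishes_mult: "vanishes h \<Longrightarrow> vanishes (g * h)"
  by (simp add: vanishes_def eval_mult)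

lemma vanishes_G: "vanishes (G X)"
  using eval_G_param by (auto simp: vanishes_def)

text \<open>\<open>X^n Y^n\<close> times the pullback of \<open>h\<close> along
  \<open>t |-> (1/X, Y)\<close>, provided that \<open>n\<close> bounds all exponents of
  \<open>h\<close>; only then do the truncations by \<open>nat\<close> change nothing.\<close>

definition cleared :: "nat \<Rightarrow> 'k laurent \<Rightarrow> 'k poly" where
  "cleared n h = (\<Sum>u\<in>keys h. Polynomial.smult (lk h u) (X ^ nat (int n - fst u) * Y ^ nat (int n + snd u)))"

lemma poly_cleared:
  assumes "\<forall>u\<in>keys h. \<bar>fst u\<bar> \<le> int n \<and> \<bar>snd u\<bar> \<le> int n" "poly X t \<noteq> 0" "poly Y t \<noteq> 0"
  shows "poly (cleared n h) t = poly X t ^ n * poly Y t ^ n * eval h (1 / poly X t, poly Y t)"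
  unfolding cleared_def eval_eq_lin lin_def poly_sum sum_distrib_left
proof (intro sum.cong refl)
  fix u assume "u \<in> keys h"
  then have u: "fst u \<le> int n" "- int n \<le> snd u" using assms(1) by fastforce+
  have "poly X t ^ nat (int n - fst u) = poly X t powi (int n - fst u)"
    using u by (subst power_int_of_nat[symmetric]) simp
  also have "\<dots> = poly X t ^ n * (1 / poly X t) powi fst u"
    using assms(2) by (simp add: power_int_diff power_int_divide_distrib)
  finally have 1: "poly X t ^ nat (int n - fst u) = poly X t ^ n * (1 / poly X t) powi fst u" .
  have "poly Y t ^ nat (int n + snd u) = poly Y t powi (int n + snd u)"
    using u by (subst power_int_of_nat[symmetric]) simp
  also have "\<dots> = poly Y t ^ n * poly Y t powi snd u"
    using assms(3) by (simp add: power_int_add)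
  finally show "poly (Polynomial.smult (lk h u) (X ^ nat (int n - fst u) * Y ^ nat (int n + snd u))) t =
      poly X t ^ n * poly Y t ^ n *
      (lk h u * (fst (1 / poly X t, poly Y t) powi fst u * snd (1 / poly X t, poly Y t) powi snd u))"
    using 1 by simp
qed

lemma vanishes_iff_cleared:
  assumes "\<forall>u\<in>keys h. \<bar>fst u\<bar> \<le> int n \<and> \<bar>snd u\<bar> \<le> int n"
  shows "vanishes h \<longleftrightarrow> cleared n h = 0"
proof
  assume v: "vanishes h"
  \<comment> \<open>The factors \<open>X * Y\<close> cover the parameters whose point is not in the
    torus; a polynomial vanishing at every element of an infinite field is 0.\<close>
  have "poly (cleared n h * X * Y) t = 0" for t
    using poly_cleared[OF assms, of t] v by (auto simp: vanishes_def)
  then have "cleared n h * X * Y = 0" using poly_all_0_iff_0 by blast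
  then show "cleared n h = 0" using nz by simp
next
  assume "cleared n h = 0"
  then show "vanishes h" using poly_cleared[OF assms] by (auto simp: vanishes_def)
qed

text \<open>The vanishing ideal is the kernel of a homomorphism to the field \<open>k(t)\<close>,
  hence prime.\<close>

lemma vanishes_prime:
  assumes "vanishes (g * h)"
  shows "vanishes g \<or> vanishes h"
proof -
  obtain n1 n2 :: nat where n1: "\<forall>u\<in>keys g. \<bar>fst u\<bar> \<le> int n1 \<and> \<bar>snd u\<bar> \<le> int n1"
    and n2: "\<forall>u\<in>keys h. \<bar>fst u\<bar> \<le> int n2 \<and> \<bar>snd u\<bar> \<le> int n2"
    using ex_box by metis
  have "poly (cleared n1 g * cleared n2 h * X * Y) t = 0" for t
  proof (cases "poly X t = 0 \<or> poly Y t = 0")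
    case False
    then have "eval g (1 / poly X t, poly Y t) * eval h (1 / poly X t, poly Y t) = 0"
      using assms by (simp add: vanishes_def eval_mult)
    then have "poly (cleared n1 g) t = 0 \<or> poly (cleared n2 h) t = 0"
      using poly_cleared[OF n1, of t] poly_cleared[OF n2, of t] False by auto
    then show ?thesis by auto
  qed auto
  then have "cleared n1 g * cleared n2 h * X * Y = 0" using poly_all_0_iff_0 by blast
  then show ?thesis using vanishes_iff_cleared[OF n1] vanishes_iff_cleared[OF n2] nz by auto
qed

text \<open>Along the curve \<open>x^i y^j\<close> has degree \<open>m j - q i\<close>. As
  \<open>m\<close> and \<open>q\<close> are coprime, these degrees are distinct for
  \<open>0 <= i < m\<close>, so nothing can cancel.\<close>

lemma vanishes_narrow:
  assumes v: "vanishes h" and narrow: "\<And>u. u \<in> keys h \<Longrightarrow> 0 \<le> fst u \<and> fst u < int m"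
  shows "h = 0"
proof (rule ccontr)
  assume "h \<noteq> 0"
  then have "keys h \<noteq> {}" by simp
  then obtain u0 where u0: "u0 \<in> keys h" by blast
  obtain n :: nat where n: "\<forall>u\<in>keys h. \<bar>fst u\<bar> \<le> int n \<and> \<bar>snd u\<bar> \<le> int n"
    using ex_box by metis
  let ?P = "\<lambda>u. Polynomial.smult (lk h u) (X ^ nat (int n - fst u) * Y ^ nat (int n + snd u))"
  have deg: "int (degree (?P u)) = int q * (int n - fst u) + int m * (int n + snd u)" if "u \<in> keys h" for u
  proof -
    have "degree (?P u) = nat (int n - fst u) * q + nat (int n + snd u) * m"
      using that nz by (simp add: in_keys_iff degree_mult_eq degree_power_eq)
    moreover have "fst u \<le> int n" "- int n \<le> snd u" using n that by fastforce+
    ultimately show ?thesis by (simp add: mult.commute)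
  qed
  have "(\<Sum>u\<in>keys h. ?P u) \<noteq> 0"
  proof (rule distinct_degrees_sum(2)[OF _ _ _ u0])
    show "?P u \<noteq> 0" if "u \<in> keys h" for u using that nz by (simp add: in_keys_iff)
    show "inj_on (\<lambda>u. degree (?P u)) (keys h)"
    proof (rule inj_onI)
      fix u v assume uv: "u \<in> keys h" "v \<in> keys h" and "degree (?P u) = degree (?P v)"
      then have "int q * (int n - fst u) + int m * (int n + snd u) =
          int q * (int n - fst v) + int m * (int n + snd v)"
        using deg[OF uv(1)] deg[OF uv(2)] by simp
      then have eq: "int q * (fst u - fst v) = int m * (snd u - snd v)" by (simp add: algebra_simps)
      then have "int m dvd int q * (fst u - fst v)" by simp
      moreover have "Rings.coprime (int m) (int q)" using coprime by simp
      ultimately have "int m dvd fst u - fst v" using coprime_dvd_mult_right_iff by blast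
      moreover have "\<bar>fst u - fst v\<bar> < int m" using narrow[OF uv(1)] narrow[OF uv(2)] by auto
      ultimately have "fst u - fst v = 0"
        using dvd_imp_le_int[of "fst u - fst v" "int m"] by (cases "fst u - fst v = 0") auto
      then have "fst u = fst v" by simp
      with eq degY show "u = v" by (simp add: prod_eq_iff)
    qed
  qed simp
  then show False using v vanishes_iff_cleared[OF n] by (simp add: cleared_def)
qed

text \<open>Division with remainder in \<open>x\<close>: the coefficient of \<open>G X\<close> at
  \<open>x^m\<close> is a unit \<open>c y^q\<close>, so a multiple of \<open>G X\<close> clears the
  last column \<open>m + d\<close>. The final remainder is narrower than \<open>m\<close> and
  vanishes by \<open>vanishes_narrow\<close>.\<close>

lemma G_dvd_of_vanishes_aux:
  assumes "vanishes h" "\<And>u. u \<in> keys h \<Longrightarrow> 0 \<le> fst u \<and> fst u < int m + int d"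
  shows "G X dvd h"
  using assms
proof (induction d arbitrary: h)
  case 0
  then have "h = 0" by (intro vanishes_narrow) auto
  then show ?case by simp
next
  case (Suc d)
  obtain c where c: "c \<noteq> 0" "\<And>b. lk (G X) (int m, b) = (if b = int q then c else 0)"
    using lookup_G_top[OF XZ] by blast
  define A where "A = {u \<in> keys h. fst u = int m + int d}"
  have A: "finite A" by (simp add: A_def)
  define s where "s = (\<Sum>u\<in>A. mterm (int d, snd u - int q) (lk h u / c))"
  have sG: "s * G X = (\<Sum>u\<in>A. mterm (int d, snd u - int q) (lk h u / c) * G X)"
    by (simp add: s_def sum_distrib_right)
  have top: "lk (s * G X) (int m + int d, b) = lk h (int m + int d, b)" for b
  proof -
    have "lk (s * G X) (int m + int d, b) = (\<Sum>u\<in>A. if u = (int m + int d, b) then lk h u else 0)"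
      unfolding sG lookup_sum lookup_mterm_mult
    proof (intro sum.cong refl)
      fix u assume "u \<in> A"
      then have u: "u = (int m + int d, b) \<longleftrightarrow> snd u = b" by (cases u) (simp add: A_def)
      have "(int m + int d, b) - (int d, snd u - int q) = (int m, b - snd u + int q)" by simp
      moreover have "lk (G X) (int m, b - snd u + int q) = (if snd u = b then c else 0)"
        unfolding c(2) by (rule if_cong) auto
      ultimately have g: "lk (G X) ((int m + int d, b) - (int d, snd u - int q)) = (if snd u = b then c else 0)"
        by (rule ssubst)
      show "lk h u / c * lk (G X) ((int m + int d, b) - (int d, snd u - int q))
          = (if u = (int m + int d, b) then lk h u else 0)"
        unfolding u g using c(1) by (rule_tac P="snd u = b" in case_split) simp_all
    qed
    also have "\<dots> = lk h (int m + int d, b)"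
      using A by (subst sum.delta) (simp_all add: A_def in_keys_iff)
    finally show ?thesis .
  qed
  have keys_s: "int d \<le> fst u \<and> fst u \<le> int m + int d" if "u \<in> keys (s * G X)" for u
  proof -
    have "u \<in> (\<Union>v\<in>A. keys (mterm (int d, snd v - int q) (lk h v / c) * G X))"
      using that unfolding sG by (rule set_mp[OF keys_sum])
    then obtain v where v: "v \<in> A" "u \<in> keys (mterm (int d, snd v - int q) (lk h v / c) * G X)" by blast
    have nz: "lk h v / c \<noteq> 0" using c(1) v(1) by (simp add: A_def in_keys_iff)
    have "u \<in> (\<lambda>w. (int d, snd v - int q) + w) ` keys (G X)"
      using v(2) unfolding keys_mterm_mult[OF nz] .
    then obtain w where "w \<in> keys (G X)" "u = (int d, snd v - int q) + w" by (rule imageE)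
    then show ?thesis using keys_G(1,2)[of w X] by simp
  qed
  have "G X dvd h - s * G X"
  proof (rule Suc.IH)
    show "vanishes (h - s * G X)"
      by (intro vanishes_diff vanishes_mult vanishes_G Suc.prems)
  next
    fix u assume u: "u \<in> keys (h - s * G X)"
    then have "u \<in> keys h \<union> keys (s * G X)" by (rule set_mp[OF keys_diff])
    then have u': "0 \<le> fst u" "fst u \<le> int m + int d"
      using Suc.prems(2)[of u] keys_s[of u] by (elim UnE; simp)+
    moreover have "fst u \<noteq> int m + int d"
    proof
      assume "fst u = int m + int d"
      then have "u = (int m + int d, snd u)" by (metis prod.collapse)
      then have "lk (s * G X) u = lk h u" using top by metis
      then show False using u by (simp add: in_keys_iff lookup_minus)
    qed
    ultimately show "0 \<le> fst u \<and> fst u < int m + int d" by linarith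
  qed
  then have "G X dvd (h - s * G X) + s * G X" by (intro dvd_add dvd_triv_right)
  then show ?case by simp
qed

lemma G_dvd_of_vanishes:
  assumes "vanishes h"
  shows "G X dvd h"
proof -
  obtain n :: nat where n: "\<forall>u\<in>keys h. \<bar>fst u\<bar> \<le> int n \<and> \<bar>snd u\<bar> \<le> int n"
    using ex_box by metis
  have "G X dvd mterm (int n, 0) 1 * h"
  proof (rule G_dvd_of_vanishes_aux[where d="2 * n + 1"])
    show "vanishes (mterm (int n, 0) 1 * h)" using assms by (rule vanishes_mult)
    fix u assume "u \<in> keys (mterm (int n, 0) 1 * h)"
    then obtain v where "v \<in> keys h" "u = (int n, 0) + v" by (auto simp: keys_mterm_mult)
    then show "0 \<le> fst u \<and> fst u < int m + int (2 * n + 1)" using n by fastforce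
  qed
  then have "G X dvd mterm (- int n, 0) 1 * (mterm (int n, 0) 1 * h)" by (rule dvd_mult)
  also have "mterm (- int n, 0) 1 * (mterm (int n, 0) 1 * h) = h"
    by (simp add: mterm_mult flip: mult.assoc zero_prod_def)
  finally show ?thesis .
qed

text \<open>Column \<open>m\<close> contains no key of \<open>f\<close> other than
  \<open>(m, q)\<close>, so a scalar multiple of \<open>G X\<close> clears it, and the difference is
  narrow.\<close>

lemma eq_G_of_vanishes:
  assumes v: "vanishes f" and f: "\<And>u. u \<in> keys f \<Longrightarrow> 0 \<le> fst u \<and> fst u \<le> int m"
    "\<And>u. u \<in> keys f \<Longrightarrow> fst u = int m \<Longrightarrow> snd u = int q"
  shows "\<exists>a. f = mterm 0 a * G X"
proof -
  obtain c where c: "c \<noteq> 0" "\<And>b. lk (G X) (int m, b) = (if b = int q then c else 0)"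
    using lookup_G_top[OF XZ] by blast
  define a where "a = lk f (int m, int q) / c"
  have "f - mterm 0 a * G X = 0"
  proof (rule vanishes_narrow)
    show "vanishes (f - mterm 0 a * G X)"
      by (intro vanishes_diff vanishes_mult vanishes_G v)
  next
    fix u assume u: "u \<in> keys (f - mterm 0 a * G X)"
    then have "lk f u \<noteq> 0 \<or> lk (G X) u \<noteq> 0"
      by (auto simp: in_keys_iff lookup_minus lookup_mterm_mult)
    then have "u \<in> keys f \<or> u \<in> keys (G X)" by (simp add: in_keys_iff)
    then have "0 \<le> fst u" "fst u \<le> int m" using f(1)[of u] keys_G(1,2)[of u X] by auto
    moreover have "fst u \<noteq> int m"
    proof
      assume m: "fst u = int m"
      then have "u = (int m, int q) \<or> lk f u = 0" using f(2)[of u] by (auto simp: in_keys_iff prod_eq_iff)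
      then have "lk f u = a * lk (G X) u" using c m
        by (cases u) (auto simp: a_def)
      then show False using u by (simp add: in_keys_iff lookup_minus lookup_mterm_mult)
    qed
    ultimately show "0 \<le> fst u \<and> fst u < int m" by simp
  qed
  then show ?thesis by auto
qed

lemma key_0: "0 \<in> keys (G X)"
  by (simp add: in_keys_iff lookup_G_0)

lemma key_top: "(int m, int q) \<in> keys (G X)"
  using lookup_G_top[OF XZ] by (auto simp: in_keys_iff)

lemma keys_G_tri: "keys (G X) \<subseteq> tri K m q"
  using keys_G[of _ X] keys_G_lower[OF XZ] by (auto simp: tri_def)

lemma G_not_unit: "\<not> G X dvd 1"
proof
  assume "G X dvd 1"
  then obtain u a where "a \<noteq> 0" "G X = mterm u a" using laurent_unit_single by blast
  then have "keys (G X) = {u}" by simp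
  then have "(int m, int q) = 0" using key_0 key_top by (metis singletonD)
  then show False using degY by (simp add: zero_prod_def)
qed

text \<open>One of the two factors vanishes on the curve, hence is a multiple of \<open>G X\<close>;
  cancelling \<open>G X\<close> shows that the other is a unit.\<close>

lemma irreducible_G: "irreducible (G X)"
proof (rule irreducibleI)
  show nz: "G X \<noteq> 0" using key_0 by auto
  show "\<not> G X dvd 1" by (rule G_not_unit)
  fix a b assume ab: "G X = a * b"
  have *: "h dvd 1" if "G X dvd g" "G X = g * h" for g h
  proof -
    from that(1) obtain s where "g = G X * s" by (elim dvdE)
    then have "G X * (s * h) = G X * 1" using that(2) by (simp add: mult_ac)
    then have "s * h = 1" using nz by (rule laurent_mult_cancel)
    then show "h dvd 1" by (metis dvd_triv_right)
  qed
  have "vanishes a \<or> vanishes b" using vanishes_G unfolding ab by (rule vanishes_prime)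
  then show "a dvd 1 \<or> b dvd 1"
    using *[OF G_dvd_of_vanishes[of a], of b] *[OF G_dvd_of_vanishes[of b], of a] ab
    by (auto simp: mult.commute)
qed

text \<open>With \<open>V = Y - 1\<close> and \<open>X = 1 + S V\<close>, binomial expansion gives
  \<open>S^a V^(a+b)\<close> the coefficient \<open>\<mu> a b\<close>. Up to factorials this is the
  moment of a product of \<open>a + b\<close> affine functions, which is 0 for
  \<open>a + b < m\<close>.\<close>

lemma power_dvd_of_moments:
  assumes f: "moments_vanish m f" "\<And>u. u \<in> keys f \<Longrightarrow> 0 \<le> fst u \<and> fst u \<le> int m \<and> 0 \<le> snd u"
  shows "(Y - 1) ^ m dvd
    (\<Sum>u\<in>keys f. Polynomial.smult (lk f u) (X ^ nat (int m - fst u) * Y ^ nat (snd u)))"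
proof -
  let ?V = "Y - 1"
  obtain S where S: "X - 1 = ?V * S" using unipotent by (elim dvdE)
  have X: "X = S * ?V + 1" and Y: "Y = ?V + 1" using S by (simp_all add: algebra_simps)
  obtain n :: nat where n: "\<forall>u\<in>keys f. \<bar>fst u\<bar> \<le> int n \<and> \<bar>snd u\<bar> \<le> int n"
    using ex_box by metis
  \<comment> \<open>A common bound for all exponents makes the binomial sums range over the same
    indices for every key, so that the sums can be exchanged.\<close>
  define N where "N = n + m"
  have binom: "(B + 1) ^ e = (\<Sum>a\<le>N. of_nat (e choose a) * B ^ a)" if "e \<le> N" for B :: "'k poly" and e
  proof -
    have "(B + 1) ^ e = (\<Sum>a\<le>e. of_nat (e choose a) * B ^ a)"
      by (simp add: binomial_ring)
    also have "\<dots> = (\<Sum>a\<le>N. of_nat (e choose a) * B ^ a)"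
      using that by (intro sum.mono_neutral_left) (auto simp: binomial_eq_0)
    finally show ?thesis .
  qed
  define \<mu> where "\<mu> a b = lin (\<lambda>u. of_nat (nat (int m - fst u) choose a) * of_nat (nat (snd u) choose b)) f" for a b
  have \<mu>: "\<mu> a b = 0" if "a + b < m" for a b
  proof -
    let ?ps = "map (\<lambda>s u. of_int (int m - fst u - int s) :: 'k) [0..<a] @ map (\<lambda>s u. of_int (snd u - int s)) [0..<b]"
    have aff: "affine_fun (\<lambda>u. of_int (int m - fst u - s) :: 'k)" for s
      unfolding affine_fun_def
      by (rule exI[of _ "-1"], rule exI[of _ 0], rule exI[of _ "of_int (int m - s)"]) (simp add: algebra_simps)
    have 0: "lin (\<lambda>u. \<Prod>p\<leftarrow>?ps. p u) f = 0"
      using that aff affine_fun_coord(2) by (intro moments_vanishD[OF f(1)]) (auto simp del: of_int_diff)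
    have "\<mu> a b = lin (\<lambda>u. (1 / (fact a * fact b)) * (\<Prod>p\<leftarrow>?ps. p u)) f"
      unfolding \<mu>_def
    proof (rule lin_cong)
      fix u assume "u \<in> keys f"
      then have "int (nat (int m - fst u)) = int m - fst u" "int (nat (snd u)) = snd u"
        using f(2) by fastforce+
      then show "of_nat (nat (int m - fst u) choose a) * of_nat (nat (snd u) choose b)
          = (1 / (fact a * fact b)) * (\<Prod>p\<leftarrow>?ps. p u)"
        by (simp add: of_nat_choose_eq_falling falling_eq_prod_list o_def del: of_int_diff)
    qed
    also have "\<dots> = 0" unfolding lin_cmult 0 by simp
    finally show ?thesis .
  qed
  have "(\<Sum>u\<in>keys f. Polynomial.smult (lk f u) (X ^ nat (int m - fst u) * Y ^ nat (snd u)))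
      = (\<Sum>u\<in>keys f. \<Sum>a\<le>N. \<Sum>b\<le>N.
          Polynomial.smult (lk f u * (of_nat (nat (int m - fst u) choose a) * of_nat (nat (snd u) choose b)))
            (S ^ a * ?V ^ (a + b)))"
  proof (rule sum.cong[OF refl])
    fix u assume u: "u \<in> keys f"
    then have e: "nat (int m - fst u) \<le> N" "nat (snd u) \<le> N" using n f(2) by (fastforce simp: N_def)+
    have "X ^ nat (int m - fst u) * Y ^ nat (snd u)
      = (\<Sum>a\<le>N. of_nat (nat (int m - fst u) choose a) * (S * ?V) ^ a) * (\<Sum>b\<le>N. of_nat (nat (snd u) choose b) * ?V ^ b)"
      using binom[OF e(1), of "S * ?V"] binom[OF e(2), of ?V] X Y by simp
    also have "\<dots> = (\<Sum>a\<le>N. \<Sum>b\<le>N.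
          Polynomial.smult (of_nat (nat (int m - fst u) choose a) * of_nat (nat (snd u) choose b))
            (S ^ a * ?V ^ (a + b)))"
      unfolding sum_product
      by (intro sum.cong refl) (simp add: power_mult_distrib power_add of_nat_poly mult_ac)
    finally show "Polynomial.smult (lk f u) (X ^ nat (int m - fst u) * Y ^ nat (snd u)) = (\<Sum>a\<le>N. \<Sum>b\<le>N.
          Polynomial.smult (lk f u * (of_nat (nat (int m - fst u) choose a) * of_nat (nat (snd u) choose b)))
            (S ^ a * ?V ^ (a + b)))"
      by (simp add: smult_sum_right)
  qed
  also have "\<dots> = (\<Sum>a\<le>N. \<Sum>b\<le>N. Polynomial.smult (\<mu> a b) (S ^ a * ?V ^ (a + b)))"
    unfolding \<mu>_def lin_def
    by (subst sum.swap, intro sum.cong refl, subst sum.swap) (simp add: smult_sum)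
  also have "?V ^ m dvd \<dots>"
  proof (intro dvd_sum)
    fix a b
    show "?V ^ m dvd Polynomial.smult (\<mu> a b) (S ^ a * ?V ^ (a + b))"
      using \<mu>[of a b] by (cases "a + b < m") (simp_all add: dvd_smult dvd_mult le_imp_power_dvd)
  qed
  finally show ?thesis .
qed

text \<open>The denominator \<open>W\<close> clears all \<open>X\<^sup>-\<^sup>iY\<^sup>j\<close> with \<open>(i, j)\<close> in the triangle, and its degree is
  twice the area: this is less than \<open>m\<^sup>2\<close>, the degree of \<open>(Y - 1)\<^sup>m\<close>.\<close>

lemma vanishes_of_moments:
  assumes f: "moments_vanish m f" "keys f \<subseteq> tri K m q"
    and W: "W \<noteq> 0" "degree W < m * m" "\<And>i j. (int i, int j) \<in> tri K m q \<Longrightarrow> X ^ i dvd W * Y ^ j"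
  shows "vanishes f"
proof -
  define F where "F = (\<Sum>u\<in>keys f. Polynomial.smult (lk f u) (X ^ nat (int m - fst u) * Y ^ nat (snd u)))"
  have u: "0 \<le> fst u" "fst u \<le> int m" "0 \<le> snd u" "int m * snd u \<le> int q * fst u" "u \<in> tri K m q"
    if "u \<in> keys f" for u
    using that f(2) by (auto simp: tri_def)
  \<comment> \<open>The quotient is \<open>W Y^j / X^i\<close>. Its degree does not exceed that of
    \<open>W\<close>, since \<open>m j <= q i\<close> below the line from 0 to
    \<open>(m, q)\<close>.\<close>
  have "\<exists>P. W * Y ^ nat (snd u) = X ^ nat (fst u) * P \<and> degree P \<le> degree W" if "u \<in> keys f" for u
  proof -
    note uk = u[OF that]
    have uu: "(int (nat (fst u)), int (nat (snd u))) = u" using uk by (simp add: prod_eq_iff)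
    have "X ^ nat (fst u) dvd W * Y ^ nat (snd u)"
      by (rule W(3)) (simp only: uu uk(5))
    then obtain P where P: "W * Y ^ nat (snd u) = X ^ nat (fst u) * P" by (rule dvdE)
    have "P \<noteq> 0" using P W nz by auto
    then have "degree W + nat (snd u) * m = nat (fst u) * q + degree P"
      using arg_cong[OF P, of degree] W nz by (simp add: degree_mult_eq degree_power_eq)
    moreover have "nat (snd u) * m \<le> nat (fst u) * q"
    proof -
      have "int (nat (snd u) * m) \<le> int (nat (fst u) * q)" using uk by (simp add: mult.commute)
      then show ?thesis by linarith
    qed
    ultimately have "degree P \<le> degree W" by linarith
    with P show ?thesis by blast
  qed
  then obtain P where P: "\<And>u. u \<in> keys f \<Longrightarrow> W * Y ^ nat (snd u) = X ^ nat (fst u) * P u"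
    "\<And>u. u \<in> keys f \<Longrightarrow> degree (P u) \<le> degree W" by metis
  define Q where "Q = (\<Sum>u\<in>keys f. Polynomial.smult (lk f u) (P u))"
  have "W * (X ^ nat (int m - fst u) * Y ^ nat (snd u)) = X ^ m * P u" if "u \<in> keys f" for u
  proof -
    have "nat (int m - fst u) + nat (fst u) = m" using u[OF that] by simp
    then have "X ^ m = X ^ nat (int m - fst u) * X ^ nat (fst u)" by (metis power_add)
    then show ?thesis using P(1)[OF that] by (simp add: mult_ac)
  qed
  then have WF: "W * F = X ^ m * Q"
    unfolding F_def Q_def sum_distrib_left by (intro sum.cong refl) simp
  have "(Y - 1) ^ m dvd F"
    unfolding F_def by (rule power_dvd_of_moments[OF f(1)]) (simp add: u)
  then have "(Y - 1) ^ m dvd X ^ m * Q" unfolding WF[symmetric] by (rule dvd_mult)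
  then have dvd: "(Y - 1) ^ m dvd Q" by (rule dvd_mult_unipotent_power[OF unipotent])
  have degV: "degree (Y - 1) = m"
    using degY degree_add_eq_left[of "-1" Y] by simp
  have "Q = 0"
  proof (rule ccontr)
    assume "Q \<noteq> 0"
    then have "degree ((Y - 1) ^ m) \<le> degree Q" by (rule dvd_imp_degree_le[OF dvd])
    also have "\<dots> \<le> degree W"
      unfolding Q_def by (intro degree_sum_le) (auto intro: order.trans[OF degree_smult_le] P(2))
    finally have "degree ((Y - 1) ^ m) \<le> degree W" .
    moreover have "Y - 1 \<noteq> 0" using degV degY by auto
    ultimately show False using W(2) degV by (simp add: degree_power_eq)
  qed
  then have "F = 0" using WF W(1) by simp
  show ?thesis
    unfolding vanishes_def
  proof safe
    fix t assume t: "poly X t \<noteq> 0" "poly Y t \<noteq> 0"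
    have "poly F t = poly X t ^ m * eval f (1 / poly X t, poly Y t)"
      unfolding F_def eval_eq_lin lin_def poly_sum sum_distrib_left
    proof (intro sum.cong refl)
      fix v assume v: "v \<in> keys f"
      have "poly X t ^ nat (int m - fst v) = poly X t powi (int m - fst v)"
        using u[OF v] by (subst power_int_of_nat[symmetric]) simp
      also have "\<dots> = poly X t ^ m * (1 / poly X t) powi fst v"
        using t by (simp add: power_int_diff power_int_divide_distrib)
      finally have 1: "poly X t ^ nat (int m - fst v) = poly X t ^ m * (1 / poly X t) powi fst v" .
      have "poly Y t ^ nat (snd v) = poly Y t powi snd v"
        using u[OF v] by (subst power_int_of_nat[symmetric]) simp
      with 1 show "poly (Polynomial.smult (lk f v) (X ^ nat (int m - fst v) * Y ^ nat (snd v))) t =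
          poly X t ^ m * (lk f v * (fst (1 / poly X t, poly Y t) powi fst v * snd (1 / poly X t, poly Y t) powi snd v))"
        by simp
    qed
    then show "eval f (1 / poly X t, poly Y t) = 0" using t \<open>F = 0\<close> by simp
  qed
qed

end

subsection \<open>The edge of the Newton polygon on the \<open>x\<close>-axis\<close>

text \<open>The identity itself is what gets applied: it inverts \<open>X + A\<close> modulo
  \<open>Y\<close>, and thereby the multiplication matrix of \<open>X + A\<close> at
  \<open>y = 0\<close>.\<close>

definition bezout :: "'k::field poly \<Rightarrow> 'k poly \<Rightarrow> bool" where
  "bezout p q \<longleftrightarrow> (\<exists>u v. u * p + v * q = 1)"

lemma bezout_commute: "bezout p q \<longleftrightarrow> bezout q p"
  unfolding bezout_def by (metis add.commute)

lemma bezout_mult: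
  assumes "bezout p q" "bezout p r"
  shows "bezout p (q * r)"
proof -
  from assms obtain u v u' v' where "u * p + v * q = 1" "u' * p + v' * r = 1"
    by (auto simp: bezout_def)
  then have "(u * p + v * q) * (u' * p + v' * r) = 1" by simp
  then have "(u * u' * p + u * v' * r + u' * v * q) * p + (v * v') * (q * r) = 1"
    by (simp add: algebra_simps)
  then show ?thesis unfolding bezout_def by blast
qed

lemma bezout_1: "bezout p 1"
  unfolding bezout_def by (rule exI[of _ 0], rule exI[of _ 1]) simp

lemma bezout_power: "bezout p q \<Longrightarrow> bezout p (q ^ n)"
  by (induction n) (auto intro: bezout_mult bezout_1)

lemma bezout_add_mult: "bezout p q \<Longrightarrow> bezout (q * s + p) q"
proof -
  assume "bezout p q"
  then obtain u v where "u * p + v * q = 1" by (auto simp: bezout_def)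
  then have "u * (q * s + p) + (v - u * s) * q = 1" by (simp add: algebra_simps)
  then show ?thesis unfolding bezout_def by blast
qed

lemma bezout_X: "poly p 0 \<noteq> 0 \<Longrightarrow> bezout p [:0, 1:]"
proof -
  assume nz: "poly p 0 \<noteq> 0"
  obtain c s where p: "p = pCons c s" by (cases p)
  then have "[:1 / c:] * p + (- [:1 / c:] * s) * [:0, 1:] = 1"
    using nz by (simp add: one_pCons algebra_simps)
  then show ?thesis unfolding bezout_def by blast
qed

context free_basis
begin

text \<open>At \<open>y = 0\<close> one has \<open>(x X - 1)(x A - 1) = 1 - x (X + A)\<close>, and the norm of the right-hand side
  has \<open>x\<close>-degree exactly \<open>m\<close>.  So the bounds \<open>a\<close> and \<open>m - a\<close> for the degrees of the two norms on
  the left are attained.\<close>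

lemma key_x_axis:
  assumes XA: "X * A = Y * S" and bez: "bezout (X + A) Y"
    and bounds: "\<And>u. u \<in> keys (G X) \<Longrightarrow> snd u = 0 \<Longrightarrow> fst u \<le> int a"
      "\<And>u. u \<in> keys (G A) \<Longrightarrow> snd u = 0 \<Longrightarrow> fst u \<le> int m - int a"
  shows "(int a, 0) \<in> keys (G X)"
proof -
  let ?xi = "mterm (-1, 0) 1 :: 'k laurent"
  \<comment> \<open>For this weight \<open>x y\<close> and \<open>1/x\<close> are positive, and
    among the powers of \<open>y\<close> only the constant one has weight 0. Of \<open>B\<close>
    below only the entries of \<open>-(X + A)\<close> at \<open>y = 0\<close> survive.\<close>
  let ?w = "\<lambda>u::int\<times>int. (-1) * fst u + 2 * snd u"
  let ?E = "\<lambda>p i j. yL (Mt p $$ (i, j))"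
  \<comment> \<open>As \<open>X A = y S\<close>, this is the matrix of
    \<open>x y S - (X + A) + 1/x\<close>.\<close>
  define B where "B = ?xi \<cdot>\<^sub>m (Gm X * Gm A)"
  have B: "B \<in> carrier_mat m m" using mult_carrier_mat[OF Gm_carrier Gm_carrier] by (simp add: B_def)
  have hom: "(\<Sum>l = 0..<m. ?E X i l * ?E A l j) = mterm (0, 1) 1 * ?E S i j" if ij: "i < m" "j < m" for i j
  proof -
    have "(\<Sum>l = 0..<m. ?E X i l * ?E A l j) = yL ((Mt X * Mt A) $$ (i, j))"
      using ij by (simp add: scalar_prod_def yL.hom_sum yL.hom_mult del: Mt_index)
    also have "Mt X * Mt A = Mt (Y * S)" by (simp only: Mt_mult[symmetric] XA)
    also have "Mt (Y * S) $$ (i, j) = xi i ((S * monom 1 j) * pcompose [:0, 1:] Y)"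
      using ij by (simp add: pcompose_pCons mult_ac)
    also have "\<dots> = Mt S $$ (i, j) * [:0, 1:]"
      using ij by (simp only: xi_mult Mt_index)
    also have "yL \<dots> = mterm (0, 1) 1 * ?E S i j"
      by (simp add: yL.hom_mult yL_pCons_0 mult.commute del: mult_pCons_right Mt_index)
    finally show ?thesis .
  qed
  have entry: "B $$ (i, j) = mterm (1, 1) 1 * ?E S i j - ?E (X + A) i j + (if i = j then ?xi else 0)"
    if ij: "i < m" "j < m" for i j
  proof -
    have "(Gm X * Gm A) $$ (i, j) = (\<Sum>l = 0..<m. (xL * ?E X i l - (if i = l then 1 else 0)) * (xL * ?E A l j - (if l = j then 1 else 0)))"
      using ij by (simp add: scalar_prod_def Gm_index del: Mt_index)
    also have "\<dots> = (\<Sum>l = 0..<m. xL * xL * (?E X i l * ?E A l j) - (if l = j then xL * ?E X i l else 0)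
        - (if l = i then xL * ?E A l j else 0) + (if l = i then if i = j then 1 else 0 else 0))"
      by (intro sum.cong refl) (auto simp: algebra_simps simp del: Mt_index)
    also have "\<dots> = xL * xL * (mterm (0, 1) 1 * ?E S i j) - xL * ?E X i j - xL * ?E A i j + (if i = j then 1 else 0)"
      unfolding sum.distrib sum_subtractf sum_distrib_left[symmetric] hom[OF ij]
      using ij by (simp del: Mt_index)
    finally have "B $$ (i, j) = ?xi * (xL * xL * (mterm (0, 1) 1 * ?E S i j) - xL * ?E X i j - xL * ?E A i j + (if i = j then 1 else 0))"
      using ij by (simp add: B_def)
    also have "\<dots> = (?xi * xL * xL * mterm (0, 1) 1) * ?E S i j - (?xi * xL) * (?E X i j + ?E A i j) + (if i = j then ?xi else 0)"
      by (simp add: algebra_simps del: Mt_index)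
    also have "?xi * xL = 1" by (simp add: mterm_mult flip: zero_prod_def)
    also have "1 * xL * mterm (0, 1) 1 = (mterm (1, 1) 1 :: 'k laurent)" by (simp add: mterm_mult)
    also have "?E X i j + ?E A i j = ?E (X + A) i j"
      using ij by (simp add: Mt_add yL_add del: Mt_index)
    finally show ?thesis by simp
  qed
  define \<kappa> where "\<kappa> p = mterm 0 (poly p 0 :: 'k)" for p
  interpret \<kappa>: comm_ring_hom \<kappa>
    by unfold_locales (simp_all add: \<kappa>_def single_add mterm_mult)
  have low_yL: "low ?w (yL p) = \<kappa> p" for p
    by (rule poly_mapping_eqI)
      (auto simp: \<kappa>_def lookup_low lookup_yL lookup_single when_def poly_0_coeff_0 zero_prod_def prod_eq_iff)
  have "low ?w (det B) = det (map_mat (low ?w) B)"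
  proof (rule low_det[OF additive_linear B])
    fix i j u assume ij: "i < m" "j < m" and "u \<in> keys (B $$ (i, j))"
    then have "u \<in> keys (mterm (1, 1) 1 * ?E S i j - ?E (X + A) i j) \<union> keys (if i = j then ?xi else 0)"
      unfolding entry[OF ij] by (intro set_mp[OF Poly_Mapping.keys_add])
    then consider "u \<in> keys (mterm (1, 1) 1 * ?E S i j)" | "u \<in> keys (?E (X + A) i j)" | "u = (-1, 0)"
      using set_mp[OF keys_diff, of u "mterm (1, 1) 1 * ?E S i j" "?E (X + A) i j"]
      by (auto split: if_splits simp del: Mt_index)
    then show "-1 * fst u + 2 * snd u \<ge> 0"
    proof cases
      case 1
      then have "u \<in> (\<lambda>v. (1, 1) + v) ` keys (?E S i j)"
        using keys_mterm_mult[of "1::'k" "(1, 1)" "?E S i j"] by simp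
      then obtain v where v: "v \<in> keys (?E S i j)" "u = (1, 1) + v" by (rule imageE)
      then show ?thesis using keys_yL_D(1,2)[OF v(1)] by simp
    next
      case 2
      then show ?thesis using keys_yL_D(1,2)[OF 2] by simp
    qed simp
  qed
  also have "map_mat (low ?w) B = (-1) \<cdot>\<^sub>m map_mat \<kappa> (Mt (X + A))"
  proof (rule eq_matI)
    fix i j assume "i < dim_row ((-1) \<cdot>\<^sub>m map_mat \<kappa> (Mt (X + A)))" "j < dim_col ((-1) \<cdot>\<^sub>m map_mat \<kappa> (Mt (X + A)))"
    then have ij: "i < m" "j < m" by auto
    have "low ?w (mterm (1, 1) 1 * ?E S i j) = 0"
    proof (rule low_eq_0)
      fix u assume "u \<in> keys (mterm (1, 1) 1 * ?E S i j)"
      then have "u \<in> (\<lambda>v. (1, 1) + v) ` keys (?E S i j)"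
        using keys_mterm_mult[of "1::'k" "(1, 1)" "?E S i j"] by simp
      then obtain v where v: "v \<in> keys (?E S i j)" "u = (1, 1) + v" by (rule imageE)
      then show "-1 * fst u + 2 * snd u \<noteq> 0" using keys_yL_D(1,2)[OF v(1)] by simp
    qed
    moreover have "low ?w (if i = j then ?xi else 0) = 0"
      by (rule low_eq_0) (simp split: if_splits)
    ultimately have "low ?w (B $$ (i, j)) = - \<kappa> (Mt (X + A) $$ (i, j))"
      unfolding entry[OF ij] low_add low_diff low_yL by simp
    then show "map_mat (low ?w) B $$ (i, j) = ((-1) \<cdot>\<^sub>m map_mat \<kappa> (Mt (X + A))) $$ (i, j)"
      using ij B by (simp del: Mt_index)
  qed (use B in auto)
  also have "det \<dots> = (-1) ^ m * \<kappa> (det (Mt (X + A)))"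
    by (simp add: \<kappa>.hom_det)
  finally have low: "low ?w (det B) = (-1) ^ m * \<kappa> (det (Mt (X + A)))" .
  \<comment> \<open>At \<open>y = 0\<close> the multiplication by \<open>u\<close> is inverse to the
    one by \<open>X + A\<close>.\<close>
  have det0: "poly (det (Mt (X + A))) 0 \<noteq> 0"
  proof -
    from bez obtain u v where uv: "u * (X + A) + v * Y = 1" by (auto simp: bezout_def)
    interpret ev: comm_ring_hom "\<lambda>p. poly p (0::'k)"
      by unfold_locales simp_all
    have "map_mat (\<lambda>p. poly p 0) (Mt (u * (X + A))) = (1\<^sub>m m :: 'k mat)"
    proof (rule eq_matI)
      fix i j assume "i < dim_row (1\<^sub>m m :: 'k mat)" "j < dim_col (1\<^sub>m m :: 'k mat)"
      then have ij: "i < m" "j < m" by auto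
      have "u * (X + A) * monom 1 j + (v * monom 1 j) * pcompose [:0, 1:] Y = (u * (X + A) + v * Y) * monom 1 j"
        by (simp add: pcompose_pCons algebra_simps)
      then have eq: "u * (X + A) * monom 1 j + (v * monom 1 j) * pcompose [:0, 1:] Y = monom 1 j"
        unfolding uv by simp
      have "xi i (u * (X + A) * monom 1 j) + xi i ((v * monom 1 j) * pcompose [:0, 1:] Y) = xi i (monom 1 j)"
        unfolding xi_add[OF ij(1), symmetric] eq ..
      then have "xi i (u * (X + A) * monom 1 j) + xi i (v * monom 1 j) * [:0, 1:] = (if i = j then 1 else 0)"
        by (simp only: xi_mult[OF ij(1)] xi_monom[OF ij])
      from arg_cong[OF this, of "\<lambda>p. poly p 0"]
      show "map_mat (\<lambda>p. poly p 0) (Mt (u * (X + A))) $$ (i, j) = 1\<^sub>m m $$ (i, j)"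
        using ij by (simp split: if_splits)
    qed auto
    then have "poly (det (Mt (u * (X + A)))) 0 = 1" by (metis ev.hom_det det_one)
    moreover have "det (Mt (u * (X + A))) = det (Mt u) * det (Mt (X + A))"
      unfolding Mt_mult by (rule det_mult) auto
    ultimately show ?thesis by auto
  qed
  have sgn: "(-1) ^ n * \<kappa> p = mterm 0 ((-1) ^ n * poly p 0)" for n p
    by (induction n) (simp_all add: \<kappa>_def single_uminus)
  have "?xi ^ n = mterm (- int n, 0) 1" for n
    by (induction n) (auto simp: mterm_mult zero_prod_def[symmetric])
  then have "det B = mterm (- int m, 0) 1 * (G X * G A)"
    using det_mult[of "Gm X" m "Gm A"] by (simp add: B_def G_def)
  then have "lk (G X * G A) (int m, 0) = lk (low ?w (det B)) 0"
    by (simp add: lookup_low lookup_mterm_mult zero_prod_def)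
  also have "\<dots> \<noteq> 0" unfolding low sgn using det0 by simp
  finally have "(int m, 0) \<in> keys (G X * G A)" by (simp add: in_keys_iff)
  then obtain u v where uv: "u \<in> keys (G X)" "v \<in> keys (G A)" "(int m, 0) = u + v"
    using keys_mult[of "G X" "G A"] by blast
  have "fst u + fst v = int m" "snd u + snd v = 0"
    using uv(3) by (metis fst_add fst_conv, metis snd_add snd_conv)
  moreover have "snd u \<ge> 0" "snd v \<ge> 0" using keys_G(3)[OF uv(1)] keys_G(3)[OF uv(2)] by auto
  ultimately have "snd u = 0" "snd v = 0" by auto
  with bounds(1)[OF uv(1)] bounds(2)[OF uv(2)] \<open>fst u + fst v = int m\<close>
  have "u = (int a, 0)" by (simp add: prod_eq_iff)
  then show ?thesis using uv(1) by simp
qed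

end

subsection \<open>Rational parametrizations\<close>

text \<open>With \<open>F = t\<^sup>c B\<close> and \<open>H = t\<^sup>r B\<^sup>K\<close> the condition says that \<open>1 - A F\<close> divides \<open>1 - H\<close>.
  The triangles \<open>IT\<close> have \<open>c = r = 0\<close>, the triangles \<open>RT\<close> have \<open>c = 1\<close> and \<open>r \<in> {1, K - 1}\<close>.\<close>

definition good :: "nat \<Rightarrow> nat \<Rightarrow> nat \<Rightarrow> 'k::field poly \<Rightarrow> 'k poly \<Rightarrow> bool" where
  "good K c r A B \<longleftrightarrow>
     (c = 0 \<and> r = 0 \<or> c = 1 \<and> r = 1 \<and> poly B 0 \<noteq> 0 \<or> c = 1 \<and> r = K - 1 \<and> poly A 0 \<noteq> 0) \<and>
     A \<noteq> 0 \<and> B \<noteq> 0 \<and> bezout A B \<and>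
     (monom 1 c * A * B - 1) dvd (monom 1 r * B ^ K - 1)"

text \<open>This exchanges \<open>X\<close> with its cofactor \<open>Z\<close> in
  \<open>X Z = Y^K\<close>: modulo \<open>Y - 1\<close> both \<open>X\<close> and \<open>Y^K\<close>
  are 1, hence so is \<open>Z\<close>.\<close>

lemma good_swap:
  assumes "good K c r A B" "K \<ge> 3"
  shows "good K c (c * K - r) B A"
proof -
  let ?Y = "monom 1 c * A * B" and ?X = "monom 1 r * B ^ K" and ?Z = "monom 1 (c * K - r) * A ^ K"
  have rc: "r \<le> c * K" using assms by (auto simp: good_def)
  have "monom 1 r * monom 1 (c * K - r) = (monom 1 c ^ K :: 'a poly)"
    using rc by (simp add: mult_monom monom_power)
  then have XZ: "?X * ?Z = ?Y ^ K" by (simp add: power_mult_distrib mult_ac)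
  have "?Y - 1 dvd ?Y ^ K - 1"
    using power_diff_1_eq[of ?Y K] by simp
  then have "?Y - 1 dvd ?X * ?Z - 1" unfolding XZ .
  moreover have "?Y - 1 dvd (?X - 1) * ?Z" using assms(1) by (intro dvd_mult2) (simp add: good_def)
  ultimately have "?Y - 1 dvd (?X * ?Z - 1) - (?X - 1) * ?Z" by (rule dvd_diff)
  then have "?Y - 1 dvd ?Z - 1" by (simp add: algebra_simps)
  moreover have "?Y = monom 1 c * B * A" by (simp add: mult_ac)
  moreover have "(c = 0 \<and> c * K - r = 0 \<or> c = 1 \<and> c * K - r = 1 \<and> poly A 0 \<noteq> 0 \<or>
      c = 1 \<and> c * K - r = K - 1 \<and> poly B 0 \<noteq> 0)"
    using assms unfolding good_def by fastforce
  ultimately show ?thesis using assms(1) unfolding good_def by (simp add: bezout_commute)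
qed

text \<open>The new polynomial is the one in the factorization \<open>1 - H = (1 - A F)(1 - A' F)\<close>.\<close>

lemma good_mutate:
  fixes A B :: "'k::field poly"
  assumes g: "good K c r A B" "K \<ge> 3" and pos: "c + degree B > 0"
    and le: "degree A + 2 * (c + degree B) \<le> r + K * degree B"
  shows "\<exists>A'. good K c r A' B \<and> degree A + degree A' + 2 * (c + degree B) = r + K * degree B"
proof -
  define F where "F = monom 1 c * B"
  define H where "H = monom 1 r * B ^ K"
  define E where "E = monom 1 (r - c) * B ^ (K - 1)"
  have nz: "A \<noteq> 0" "B \<noteq> 0" using g by (auto simp: good_def)
  have cr: "c \<le> r" using g by (auto simp: good_def)
  have "monom 1 c * monom 1 (r - c) = (monom 1 r :: 'k poly)" using cr by (simp add: mult_monom)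
  moreover have "B * B ^ (K - 1) = B ^ K" using g(2) by (cases K) auto
  ultimately have HFE: "H = F * E" unfolding H_def F_def E_def by (metis mult.assoc mult.left_commute)
  have F0: "F \<noteq> 0" using nz by (simp add: F_def monom_eq_0_iff)
  have degF: "degree F = c + degree B"
    using nz by (simp add: F_def degree_mult_eq degree_monom_eq monom_eq_0_iff)
  have degH: "degree H = r + K * degree B"
    using nz by (simp add: H_def degree_mult_eq degree_monom_eq monom_eq_0_iff degree_power_eq)
  have Hpos: "r + K * degree B > 0" by (rule less_le_trans[OF _ le]) (use pos in simp)
  have deg1: "degree (1 - p) = degree p" if "degree p > 0" for p :: "'k poly"
    using degree_add_eq_right[of 1 "- p"] that by simp
  have "A * F - 1 dvd H - 1"
    using g(1) by (simp add: good_def F_def H_def mult_ac)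
  then obtain Q where "H - 1 = (A * F - 1) * Q" by (elim dvdE)
  then have Q: "1 - H = (1 - A * F) * Q" by (simp add: algebra_simps)
  \<comment> \<open>Solving \<open>1 - F E = (1 - A F) Q\<close> for the \<open>Q\<close> without a
    factor \<open>F\<close> gives \<open>Q = 1 - (E - A Q) F\<close>.\<close>
  define A' where "A' = E - A * Q"
  have QA: "Q = 1 - A' * F"
    using Q unfolding A'_def HFE by (simp add: algebra_simps)
  have degAF: "degree (A * F) = degree A + c + degree B"
    using nz F0 by (simp add: degree_mult_eq degF)
  have "degree (1 - A * F) = degree A + c + degree B"
    using degAF pos by (subst deg1) auto
  moreover have degH1: "degree (1 - H) = r + K * degree B"
    using degH deg1[of H] Hpos by simp
  moreover have "1 - H \<noteq> 0"
  proof
    assume "1 - H = 0"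
    then show False using degH1 Hpos by simp
  qed
  then have "1 - A * F \<noteq> 0" "Q \<noteq> 0" unfolding Q by auto
  ultimately have degQ: "degree A + c + degree B + degree Q = r + K * degree B"
    using Q by (metis degree_mult_eq)
  then have "degree Q > 0" using pos le by auto
  have "degree (A' * F) > 0"
  proof (rule ccontr)
    assume "\<not> degree (A' * F) > 0"
    then have "degree (1 - A' * F) \<le> 0" by (intro degree_diff_le) auto
    then show False using \<open>degree Q > 0\<close> unfolding QA by simp
  qed
  then have A'0: "A' \<noteq> 0" by auto
  have "degree Q = degree A' + c + degree B"
    using \<open>degree (A' * F) > 0\<close> deg1[of "A' * F"] F0 A'0 unfolding QA by (simp add: degree_mult_eq degF)
  then have deg: "degree A + degree A' + 2 * (c + degree B) = r + K * degree B"
    using degQ by simp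
  have "F * E = F * (A + A' - A * A' * F)"
    using Q unfolding QA HFE by (simp add: algebra_simps)
  \<comment> \<open>The source of both side conditions: \<open>B\<close> divides \<open>F\<close>
    and \<open>E\<close>, so \<open>A' = -A\<close> modulo \<open>B\<close>, and coprimality is
    inherited; if \<open>c = 1\<close> and \<open>r = K - 1\<close>, then \<open>F\<close> and
    \<open>E\<close> vanish at 0, so \<open>A'\<close> has the value \<open>- A\<close>
    there.\<close>
  then have sum: "A + A' = A * A' * F + E" using F0 by simp
  have dvd: "monom 1 c * A' * B - 1 dvd monom 1 r * B ^ K - 1"
  proof -
    have "1 - A' * F dvd 1 - H" unfolding Q QA by simp
    then have "- (1 - A' * F) dvd - (1 - H)" by (simp only: minus_dvd_iff dvd_minus_iff)
    then have "A' * F - 1 dvd H - 1" by (simp only: minus_diff_eq)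
    then show ?thesis by (simp add: F_def H_def mult_ac)
  qed
  have "\<exists>s. A' = B * s + - A"
  proof -
    have "K - 1 = Suc (K - 2)" using g(2) by simp
    then have "B ^ (K - 1) = B * B ^ (K - 2)" by simp
    then have "A' = B * (A * A' * monom 1 c + monom 1 (r - c) * B ^ (K - 2)) + - A"
      using sum by (simp add: F_def E_def algebra_simps)
    then show ?thesis by blast
  qed
  then obtain s where s: "A' = B * s + - A" by blast
  have bez: "bezout A' B"
  proof -
    from g(1) obtain u v where "u * A + v * B = 1" by (auto simp: good_def bezout_def)
    then have "(- u) * (- A) + v * B = 1" by simp
    then have "bezout (- A) B" unfolding bezout_def by blast
    then show ?thesis unfolding s by (rule bezout_add_mult)
  qed
  have A'_at_0: "poly A' 0 \<noteq> 0" if "c = 1" "r = K - 1" "poly A 0 \<noteq> 0"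
  proof -
    have "r - c > 0" using that g(2) by simp
    then have "poly A 0 + poly A' 0 = 0"
      using arg_cong[OF sum, of "\<lambda>p. poly p 0"] that(1) by (simp add: F_def E_def poly_monom)
    then show ?thesis using that(3) by auto
  qed
  have "good K c r A' B"
    using g(1) dvd bez A'0 A'_at_0 unfolding good_def by blast
  then show ?thesis using deg by blast
qed

section \<open>Vieta jumping on the solutions\<close>

lemma solution_int:
  assumes "solution K M N"
  shows "int M * int M + int N * int N - (int K - 2) * int M * int N = 1"
proof -
  have "int ((M + N)\<^sup>2) = int (K * M * N + 1)" using assms by (simp add: solution_def)
  then show ?thesis by (simp add: power2_eq_square algebra_simps)
qed

lemma solution_sym: "solution K M N \<Longrightarrow> solution K N M"
  by (simp add: solution_def add.commute mult_ac)

text \<open>\<open>M'\<close> is the other root of the equation, read as a quadratic in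
  \<open>M\<close>. The roots have sum \<open>(K - 2) N\<close> and product \<open>N^2 - 1\<close>,
  whence \<open>0 <= M' < M\<close>.\<close>

lemma solution_descent:
  assumes s: "solution K M N" and "M \<ge> N" "N > 0"
  obtains M' where "M' < M" "M + M' = (K - 2) * N" "solution K M' N"
proof -
  have K: "K \<ge> 3" using s by (simp add: solution_def)
  define x where "x = (int K - 2) * int N - int M"
  have prod: "int M * x = int N * int N - 1"
    using solution_int[OF s] by (simp add: x_def algebra_simps)
  have "int N * int N \<ge> 1" using assms(3) by (metis One_nat_def Suc_leI mult_le_mono nat_mult_1 of_nat_1 of_nat_le_iff of_nat_mult)
  then have "int M * x \<ge> 0" using prod by simp
  then have x0: "x \<ge> 0" using assms by (simp add: zero_le_mult_iff)
  have "int N * int N \<le> int M * int M" using assms(2) by (intro mult_mono) auto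
  then have "int M * x < int M * int M" using prod by linarith
  then have xM: "x < int M" using assms by (simp add: mult_less_cancel_left)
  have nx: "int (nat x) = x" using x0 by simp
  have "int (M + nat x) = int ((K - 2) * N)" using K nx by (simp add: x_def of_nat_diff)
  then have sum: "M + nat x = (K - 2) * N" by (simp only: of_nat_eq_iff)
  have "int ((nat x + N)\<^sup>2) = int (K * nat x * N + 1)"
  proof -
    have "x * x + int N * int N - (int K - 2) * x * int N = 1"
      using solution_int[OF s] by (simp add: x_def algebra_simps)
    then show ?thesis using nx by (simp add: power2_eq_square algebra_simps)
  qed
  then have "solution K (nat x) N" using K unfolding solution_def by (simp only: of_nat_eq_iff)
  then show ?thesis using that[of "nat x"] xM sum nx by auto
qed

lemma split_off_2: "K \<ge> 2 \<Longrightarrow> (K - 2) * n + 2 * n = K * (n :: nat)"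
  by (metis add_mult_distrib le_add_diff_inverse2)

lemma solution_N_0: "solution K M 0 \<Longrightarrow> M = 1"
  by (simp add: solution_def power2_eq_square)

text \<open>For \<open>c = r = 0\<close> the degree identity of \<open>good_mutate\<close> is the
  Vieta relation \<open>M + M' = (K - 2) N\<close>, so mutation undoes the descent. It starts at
  \<open>(1, 0)\<close> with \<open>Y = t\<close> and \<open>X = 1\<close>.\<close>

lemma ex_good_IT:
  assumes "solution K M N"
  shows "\<exists>A B :: 'k::field poly. good K 0 0 A B \<and> degree A = M \<and> degree B = N"
  using assms
proof (induction "M + N" arbitrary: M N rule: less_induct)
  case less
  have K: "K \<ge> 3" using less.prems by (simp add: solution_def)
  have X: "degree [:0, 1 :: 'k:] = 1" "[:0, 1 :: 'k:] \<noteq> 0" by auto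
  have swap: "\<exists>A B :: 'k poly. good K 0 0 A B \<and> degree A = N \<and> degree B = M"
    if "\<exists>A B :: 'k poly. good K 0 0 A B \<and> degree A = M \<and> degree B = N" for M N
    using that good_swap[OF _ K, of 0 0] by fastforce
  have base: "\<exists>A B :: 'k poly. good K 0 0 A B \<and> degree A = 1 \<and> degree B = 0"
    by (rule exI[of _ "[:0, 1:]"], rule exI[of _ 1]) (simp add: good_def bezout_1)
  have step: "\<exists>A B :: 'k poly. good K 0 0 A B \<and> degree A = a \<and> degree B = b"
    if ab: "solution K a b" "a \<ge> b" "b > 0" "a + b = M + N" for a b
  proof -
    obtain a' where a': "a' < a" "a + a' = (K - 2) * b" "solution K a' b"
      using solution_descent[OF ab(1-3)] .
    have "a' + b < M + N" using a'(1) ab(4) by simp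
    from less.hyps[OF this a'(3)] obtain A B :: "'k poly" where
      AB: "good K 0 0 A B" "degree A = a'" "degree B = b" by blast
    have "(K - 2) * b + 2 * b = K * b" using K split_off_2 by simp
    then have sum: "a' + a + 2 * b = K * b" using a'(2) by simp
    obtain A' where "good K 0 0 A' B" "degree A + degree A' + 2 * (0 + degree B) = 0 + K * degree B"
      using good_mutate[OF AB(1) K] AB sum ab(3) by auto
    then have "good K 0 0 A' B" "degree A' = a" "degree B = b" using AB sum by auto
    then show ?thesis by blast
  qed
  consider "N = 0" | "M = 0" | "M \<ge> N" "N > 0" | "N \<ge> M" "M > 0" by linarith
  then show ?case
  proof cases
    case 1
    then show ?thesis using base solution_N_0 less.prems by blast
  next
    case 2
    then have "N = 1" using solution_N_0[of K N] solution_sym[OF less.prems] by simp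
    then show ?thesis using swap[OF base] 2 by simp
  next
    case 3
    then show ?thesis using step less.prems by simp
  next
    case 4
    then show ?thesis using swap[OF step[of N M]] solution_sym[OF less.prems] by (simp add: add.commute)
  qed
qed

text \<open>Here \<open>M\<close> and \<open>M + N\<close> are the degrees of \<open>Y\<close> and
  \<open>X\<close>. Swapping keeps \<open>Y\<close> and turns \<open>N\<close> into
  \<open>(K - 2) M - N\<close>; mutation keeps \<open>X\<close> and turns a \<open>Y\<close> of
  degree \<open>N\<close> into one of degree \<open>M\<close>. The two moves lead from
  \<open>(1, 0)\<close>, where \<open>X = Y = t\<close>, to every solution with
  \<open>M > 0\<close>.\<close>

lemma ex_good_RT:
  assumes "solution K M N" "M > 0"
  shows "\<exists>(A :: 'k::field poly) B r. good K 1 r A B \<and> degree A + degree B + 1 = M \<and> r + K * degree B = M + N"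
  using assms
proof (induction "M + N" arbitrary: M N rule: less_induct)
  case less
  have K: "K \<ge> 3" using less.prems by (simp add: solution_def)
  let ?P = "\<lambda>M N. \<exists>(A :: 'k poly) B r. good K 1 r A B \<and> degree A + degree B + 1 = M \<and> r + K * degree B = M + N"
  have swap: "?P M N" if P: "?P M N'" and NN: "N + N' = (K - 2) * M" for M N N'
  proof -
    from P obtain A B :: "'k poly" and r where AB: "good K 1 r A B" "degree A + degree B + 1 = M" "r + K * degree B = M + N'"
      by blast
    have rK: "r \<le> K" using AB(1) K by (auto simp: good_def)
    have "K * M = 2 * M + (K - 2) * M" using K split_off_2[of K M] by simp
    then have "(K - r) + K * degree A = M + N"
      using AB NN rK by (simp add: algebra_simps flip: AB(2))
    moreover have "good K 1 (K - r) B A" using good_swap[OF AB(1) K] by simp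
    ultimately show ?thesis using AB(2)
      by (intro exI[of _ B] exI[of _ A] exI[of _ "K - r"]) simp
  qed
  consider "N = 0" | "N \<ge> M" | "M > N" "N > 0" by linarith
  then show ?case
  proof cases
    case 1
    then have "M = 1" using solution_N_0 less.prems by blast
    then show ?thesis using 1
      by (intro exI[of _ 1] exI[of _ "1::nat"]) (simp add: good_def bezout_1)
  next
    case 2
    obtain N' where N': "N' < N" "N + N' = (K - 2) * M" "solution K N' M"
      using solution_descent[OF solution_sym[OF less.prems(1)] 2 less.prems(2)] .
    then have "?P M N'" using less.hyps[of M N'] solution_sym less.prems by auto
    then show ?thesis using swap N'(2) by blast
  next
    case 3
    obtain M' where M': "M' < M" "M + M' = (K - 2) * N" "solution K M' N"
      using solution_descent[OF less.prems(1)] 3 by auto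
    then have "?P N M'" using less.hyps[of N M'] solution_sym 3 by auto
    then have "?P N M" using swap M'(2) by blast
    then obtain A B :: "'k poly" and r where AB: "good K 1 r A B" "degree A + degree B + 1 = N" "r + K * degree B = N + M"
      by blast
    have "degree A + 2 * (1 + degree B) \<le> r + K * degree B"
      unfolding AB(3) using AB(2) 3 by auto
    then obtain A' where A': "good K 1 r A' B" "degree A + degree A' + 2 * (1 + degree B) = r + K * degree B"
      using good_mutate[OF AB(1) K] by auto
    then have "degree A' + degree B + 1 = M" using AB(2,3) by auto
    then show ?thesis using A'(1) AB(3) by (metis add.commute)
  qed
qed

subsection \<open>Existence and uniqueness of the negative curve in a triangle\<close>

text \<open>The last two clauses are uniqueness within the triangle and the Nullstellensatz for
  \<open>f\<close>, which turns equality of point sets into divisibility.\<close>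

definition model :: "nat \<Rightarrow> nat \<Rightarrow> nat \<Rightarrow> 'k::field_char_0 laurent \<Rightarrow> bool" where
  "model K m q f \<longleftrightarrow> irreducible f \<and> keys f \<subseteq> tri K m q \<and> moments_vanish m f \<and>
     0 \<in> keys f \<and> (int m, int q) \<in> keys f \<and>
     (\<forall>g. keys g \<subseteq> tri K m q \<longrightarrow> moments_vanish m g \<longrightarrow> (\<exists>a. g = mterm 0 a * f)) \<and>
     (\<forall>h. (\<forall>p. fst p \<noteq> 0 \<longrightarrow> snd p \<noteq> 0 \<longrightarrow> eval f p = 0 \<longrightarrow> eval h p = 0) \<longrightarrow> f dvd h)"

lemma tri_right:
  assumes "u \<in> tri K m q" "fst u = int m" "m > 0"
  shows "snd u = int q"
proof -
  have "int m * snd u \<le> int q * int m" "int q \<le> snd u" using assms by (auto simp: tri_def)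
  then have "snd u \<le> int q" using assms(3) by (simp add: mult.commute[of "int q"])
  with \<open>int q \<le> snd u\<close> show ?thesis by simp
qed

text \<open>These compare the powers of \<open>B\<close> and of \<open>t\<close> in
  \<open>X^i\<close> and \<open>W Y^j\<close>. The first bound is the edge of slope
  \<open>K\<close>. For \<open>c = 1\<close> the second follows from it only because
  \<open>i\<close> and \<open>j\<close> are integers: \<open>i > a\<close> means
  \<open>i >= a + 1\<close>.\<close>

lemma denominator_bounds:
  fixes i j :: nat
  assumes K: "K \<ge> 3" and ij: "(int i, int j) \<in> tri K (c + a + b) (r + K * b)"
    and cr: "c = 0 \<and> r = 0 \<or> c = 1 \<and> r = 1 \<or> c = 1 \<and> r = K - 1"
  shows "K * i \<le> K * a + c * K - r + j" "r * i \<le> r * a + c * j"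
proof -
  have rc: "r \<le> c * K" using cr K by auto
  have "int (r + K * b) - int K * (int (c + a + b) - int i) \<le> int j"
    using ij by (simp add: tri_def)
  then have le: "int K * int i \<le> int K * int a + int c * int K - int r + int j"
    by (simp add: algebra_simps)
  have "int (K * a + c * K - r + j) = int K * int a + int c * int K - int r + int j"
    using rc by (simp add: of_nat_diff)
  then have "int (K * i) \<le> int (K * a + c * K - r + j)" using le by simp
  then show "K * i \<le> K * a + c * K - r + j" by (simp only: of_nat_le_iff)
  from cr show "r * i \<le> r * a + c * j"
  proof (elim disjE conjE)
    assume cr': "c = 1" "r = 1"
    show ?thesis
    proof (rule ccontr)
      assume "\<not> r * i \<le> r * a + c * j"
      then have "int i \<ge> int a + int j + 1" using cr' by simp
      then have "int K * (int a + int j + 1) \<le> int K * int i" by (intro mult_left_mono) auto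
      then have "int K * int j \<le> int j - 1" using le cr' by (simp add: algebra_simps)
      moreover have "1 * int j \<le> int K * int j" using K by (intro mult_right_mono) auto
      ultimately show False by simp
    qed
  next
    assume cr': "c = 1" "r = K - 1"
    have r: "int r = int K - 1" using cr' K by (simp add: of_nat_diff)
    have le': "int K * (int i - int a) \<le> int j + 1" using le r cr' by (simp add: algebra_simps)
    have "int r * (int i - int a) \<le> int j"
    proof (cases "int i \<le> int a")
      case True
      then have "int r * (int i - int a) \<le> 0" by (simp add: mult_le_0_iff)
      then show ?thesis by simp
    next
      case False
      then show ?thesis using le' by (simp add: r algebra_simps)
    qed
    then have "int (r * i) \<le> int (r * a + c * j)" by (simp add: cr'(1) algebra_simps)
    then show ?thesis by (simp only: of_nat_le_iff)
  qed simp
qed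

lemma model_of_good:
  fixes A B :: "'k::field_char_0 poly"
  assumes g: "good K c r A B" and K: "K \<ge> 3"
    and m: "m = c + degree A + degree B" "m > 0" and q: "q = r + K * degree B"
    and cop: "coprime m q"
    and area: "r * degree A + degree B * (K * degree A + c * K - r) + 1 = m * m"
  shows "\<exists>f :: 'k laurent. model K m q f \<and> (c = 0 \<or> r = K - 1 \<longrightarrow> (int (degree A), 0) \<in> keys f)"
proof -
  let ?a = "degree A" and ?b = "degree B"
  have nzAB: "A \<noteq> 0" "B \<noteq> 0" using g by (auto simp: good_def)
  have cr: "c = 0 \<and> r = 0 \<or> c = 1 \<and> r = 1 \<or> c = 1 \<and> r = K - 1" using g by (auto simp: good_def)
  have rc: "r \<le> c * K" using cr K by auto
  define Y where "Y = monom 1 c * A * B"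
  define X where "X = monom 1 r * B ^ K"
  define Z where "Z = monom 1 (c * K - r) * A ^ K"
  \<comment> \<open>The exponents are upper bounds of \<open>r i - j c\<close> and
    \<open>K i - j\<close> on the lattice points of the triangle; by \<open>area\<close> the degree
    is exactly \<open>m^2 - 1\<close>.\<close>
  define W where "W = monom 1 (r * ?a) * B ^ (K * ?a + c * K - r)"
  have dY: "degree Y = m"
    using nzAB by (simp add: Y_def m degree_mult_eq degree_monom_eq monom_eq_0_iff)
  have dX: "degree X = q"
    using nzAB by (simp add: X_def q degree_mult_eq degree_monom_eq monom_eq_0_iff degree_power_eq)
  have degW: "degree W < m * m"
    using nzAB area by (simp add: W_def degree_mult_eq degree_monom_eq monom_eq_0_iff degree_power_eq mult.commute)
  have "monom 1 r * monom 1 (c * K - r) = (monom 1 c ^ K :: 'k poly)"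
    using rc by (simp add: mult_monom monom_power)
  then have XZ: "X * Z = Y ^ K" by (simp add: X_def Y_def Z_def power_mult_distrib mult_ac)
  have "Y - 1 dvd X - 1" using g by (simp add: good_def X_def Y_def)
  then interpret curve Y X Z K
    by unfold_locales (simp_all add: dY dX XZ m(2) cop)
  have W: "X ^ i dvd W * Y ^ j" if ij: "(int i, int j) \<in> tri K m q" for i j
  proof -
    note b = denominator_bounds[OF K ij[unfolded m q] cr]
    have "X ^ i = monom 1 (r * i) * B ^ (K * i)"
      by (simp add: X_def power_mult_distrib monom_power power_mult)
    moreover have "W * Y ^ j = (monom 1 (r * ?a + c * j) * B ^ (K * ?a + c * K - r + j)) * A ^ j"
      by (simp add: W_def Y_def power_mult_distrib monom_power power_add mult_ac flip: mult_monom[of "1::'k" _ 1, simplified])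
    moreover have "monom 1 (r * i) dvd (monom 1 (r * ?a + c * j) :: 'k poly)"
      using b(2) by (metis dvd_triv_left le_add_diff_inverse mult_1_right mult_monom)
    moreover have "B ^ (K * i) dvd B ^ (K * ?a + c * K - r + j)"
      using b(1) by (rule le_imp_power_dvd)
    ultimately show ?thesis by (metis dvd_mult2 mult_dvd_mono)
  qed
  have W0: "W \<noteq> 0" using nzAB by (simp add: W_def monom_eq_0_iff)
  have uniq: "\<exists>a. f = mterm 0 a * G X" if f: "keys f \<subseteq> tri K m q" "moments_vanish m f" for f
  proof (rule eq_G_of_vanishes)
    show "vanishes f"
      using vanishes_of_moments[of f W] f W0 degW W unfolding dY dX by blast
    fix u assume "u \<in> keys f"
    then have u: "u \<in> tri K m q" using f(1) by blast
    then show "0 \<le> fst u \<and> fst u \<le> int (degree Y)" by (simp add: tri_def dY)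
    assume "fst u = int (degree Y)"
    then show "snd u = int (degree X)" using tri_right[OF u] m(2) by (simp add: dY dX)
  qed
  have dvd: "G X dvd h" if "\<forall>p. fst p \<noteq> 0 \<longrightarrow> snd p \<noteq> 0 \<longrightarrow> eval (G X) p = 0 \<longrightarrow> eval h p = 0" for h
  proof (rule G_dvd_of_vanishes)
    show "vanishes h"
      unfolding vanishes_def
    proof (intro allI impI)
      fix t assume t: "poly X t \<noteq> 0" "poly Y t \<noteq> 0"
      show "eval h (1 / poly X t, poly Y t) = 0"
        using that[rule_format, of "(1 / poly X t, poly Y t)"] t eval_G_param[OF t] by simp
    qed
  qed
  have "model K m q (G X)"
    unfolding model_def
    using irreducible_G keys_G_tri moments_vanish_G[OF unipotent] key_0 key_top uniq dvd
    by (auto simp: dY dX)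
  \<comment> \<open>The case \<open>c = r = 1\<close> is left out: there \<open>A\<close> may be
    divisible by \<open>t\<close>, and then \<open>X + A\<close> has the factor \<open>t\<close> in
    common with \<open>Y\<close>.\<close>
  moreover have "(int ?a, 0) \<in> keys (G X)" if c: "c = 0 \<or> r = K - 1"
  proof (rule key_x_axis)
    have cA: "c = 1 \<Longrightarrow> poly A 0 \<noteq> 0" and r1: "c = 1 \<Longrightarrow> r \<ge> 1"
      using g c K by (auto simp: good_def)
    have cr1: "c \<le> r" using cr K by auto
    have "monom 1 r = monom 1 c * (monom 1 (r - c) :: 'k poly)" using cr1 by (simp add: mult_monom)
    moreover have BK: "B ^ K = B * B ^ (K - 1)" using K by (cases K) auto
    ultimately show "X * A = Y * (monom 1 (r - c) * B ^ (K - 1))"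
      by (simp add: X_def Y_def mult_ac)
    have AB: "bezout A B" using g by (simp add: good_def)
    have "bezout B A" using AB by (simp add: bezout_commute)
    have At: "bezout A (monom 1 c)"
    proof (cases "c = 0")
      case True
      then show ?thesis using bezout_1[of A] by (simp add: monom_0 one_pCons)
    next
      case False
      then have "c = 1" using cr by auto
      then show ?thesis using bezout_X[OF cA] by (simp add: monom_altdef)
    qed
    have At': "bezout A (monom 1 r)"
      using bezout_power[OF At, of r] cr At by (auto simp: monom_power monom_0 one_pCons[symmetric] bezout_1)
    have "bezout (X + A) (monom 1 c)"
    proof -
      have "X = monom 1 c * (monom 1 (r - c) * B ^ K)"
        using cr1 by (simp add: X_def mult_monom flip: mult.assoc)
      then show ?thesis using bezout_add_mult[OF At] by simp
    qed
    moreover have "bezout (X + A) A"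
    proof -
      have "bezout A X" unfolding X_def using At' bezout_power[OF AB] by (rule bezout_mult)
      then have "bezout (A * 1 + X) A" by (intro bezout_add_mult) (simp add: bezout_commute)
      then show ?thesis by (simp add: add.commute)
    qed
    moreover have "bezout (X + A) B"
    proof -
      have "X = B * (monom 1 r * B ^ (K - 1))" by (simp add: X_def BK mult_ac)
      then show ?thesis using bezout_add_mult[OF AB] by simp
    qed
    ultimately show "bezout (X + A) Y"
      unfolding Y_def by (intro bezout_mult)
  next
    fix u assume u: "u \<in> keys (G X)" "snd u = 0"
    have "int q - int K * (int m - fst u) \<le> 0"
      using keys_G_lower[OF XZ u(1)] u(2) by (simp add: dX dY)
    \<comment> \<open>The triangle ends on the axis at \<open>a + (c K - r) / K\<close>. Since
      \<open>c K - r < K\<close>, rounding down gives \<open>a\<close>.\<close>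
    then have le: "int K * (fst u - int ?a) \<le> int c * int K - int r"
      by (simp add: q m algebra_simps)
    also have "\<dots> < int K * 1"
      using c cr K by (auto simp: of_nat_diff)
    finally show "fst u \<le> int ?a" using K by (simp add: mult_less_cancel_left)
  next
    fix u assume u: "u \<in> keys (G A)" "snd u = 0"
    have "A * (monom 1 c * B) = Y ^ 1" by (simp add: Y_def mult_ac)
    from keys_G_lower[OF this u(1)] u(2) show "fst u \<le> int (degree Y) - int ?a" by simp
  qed
  ultimately show ?thesis by blast
qed

lemma coprime_of_square:
  assumes "(x::nat)\<^sup>2 = y * z + 1"
  shows "coprime x y"
proof (rule coprimeI)
  fix d assume "d dvd x" "d dvd y"
  then have "d dvd x * x" "d dvd y * z" by (auto intro: dvd_mult2)
  moreover have "x * x = y * z + 1" using assms by (simp add: power2_eq_square)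
  ultimately show "is_unit d" by (metis dvd_add_right_iff)
qed

lemma ex_model_IT:
  assumes s: "solution K M N"
  shows "\<exists>f :: 'k::field_char_0 laurent. model K (M + N) (K * N) f \<and> (int M, 0) \<in> keys f"
proof -
  have K: "K \<ge> 3" and sq: "(M + N)\<^sup>2 = K * M * N + 1" using s by (auto simp: solution_def)
  obtain A B :: "'k poly" where AB: "good K 0 0 A B" "degree A = M" "degree B = N"
    using ex_good_IT[OF s] by blast
  have "M + N > 0" using sq by (cases "M + N") auto
  moreover have "(M + N)\<^sup>2 = (K * N) * M + 1" using sq by (simp add: mult_ac)
  then have "coprime (M + N) (K * N)" by (rule coprime_of_square)
  moreover have "N * (K * M) + 1 = (M + N) * (M + N)"
    using sq by (simp add: power2_eq_square mult_ac)
  ultimately show ?thesis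
    using model_of_good[OF AB(1) K, of "M + N" "K * N"] AB by auto
qed

lemma ex_model_RT:
  assumes s: "solution K M N" "M > 0"
  shows "\<exists>(f :: 'k::field_char_0 laurent) a b r. model K M (M + N) f \<and> a + b + 1 = M \<and>
    r + K * b = M + N \<and> (r = 1 \<or> r = K - 1) \<and> (r = K - 1 \<longrightarrow> (int a, 0) \<in> keys f)"
proof -
  have K: "K \<ge> 3" and sq: "(M + N)\<^sup>2 = K * M * N + 1" using s by (auto simp: solution_def)
  obtain A B :: "'k poly" and r where AB: "good K 1 r A B" "degree A + degree B + 1 = M"
    "r + K * degree B = M + N"
    using ex_good_RT[OF s] by blast
  let ?a = "degree A" and ?b = "degree B"
  have r: "r = 1 \<or> r = K - 1" using AB(1) by (auto simp: good_def)
  have "(M + N)\<^sup>2 = M * (K * N) + 1" using sq by (simp add: mult_ac)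
  then have "coprime (M + N) M" by (rule coprime_of_square)
  then have cop: "coprime M (M + N)" by (simp add: coprime_commute)
  have eq: "int M = int ?a + int ?b + 1" "int M + int N = int r + int K * int ?b"
    using AB(2,3) by (simp_all flip: of_nat_mult of_nat_add)
  have "(int M + int N) * (int M + int N) = int K * int M * int N + 1"
    using sq by (metis (mono_tags, lifting) of_nat_1 of_nat_add of_nat_mult power2_eq_square)
  moreover have N: "int N = int r + int K * int ?b - int M" using eq by simp
  ultimately have rel: "(int r + int K * int ?b) * (int r + int K * int ?b)
      = int K * int M * (int r + int K * int ?b - int M) + 1"
    using eq(2) by simp
  have "int (r * ?a + ?b * (K * ?a + 1 * K - r) + 1) = int (M * M)"
  proof -
    have i: "int (r * ?a + ?b * (K * ?a + 1 * K - r) + 1)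
        = int r * int ?a + int ?b * (int K * int ?a + int K - int r) + 1"
      using r K by (auto simp: of_nat_diff)
    \<comment> \<open>The relation \<open>rel\<close> controls only \<open>K\<close> times the area
      identity; the error term is treated separately.\<close>
    have "int K * (int r * int ?a + int ?b * (int K * int ?a + int K - int r) + 1) = int K * (int M * int M)
        + (int r * int K - int r * int r - int K + 1) * (-1)"
      using rel unfolding eq(1) by (simp add: algebra_simps)
    \<comment> \<open>The left-hand side is \<open>(r - 1) (K - 1 - r)\<close>, which vanishes for
      the two possible values of \<open>r\<close>.\<close>
    also have "int r * int K - int r * int r - int K + 1 = 0"
    proof -
      have "int r = 1 \<or> int K = int r + 1" using r K by (auto simp: of_nat_diff)
      then show ?thesis by (elim disjE) (simp_all add: algebra_simps)
    qed
    finally show ?thesis using K unfolding i by simp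
  qed
  then have area: "r * ?a + ?b * (K * ?a + 1 * K - r) + 1 = M * M" by (simp only: of_nat_eq_iff)
  have "M = 1 + ?a + ?b" using AB(2) by simp
  then show ?thesis
    using model_of_good[OF AB(1) K, of M "M + N"] s(2) AB(2,3) cop area r by metis
qed

subsection \<open>Lattice points of the triangles\<close>

definition pt :: "int \<times> int \<Rightarrow> real ^ 2" where
  "pt u = vector [of_int (fst u), of_int (snd u)]"

lemma newton_polygon_subset_hull_iff:
  "newton_polygon f \<subseteq> convex hull V \<longleftrightarrow> (\<forall>u\<in>keys f. pt u \<in> convex hull V)"
proof -
  have "newton_polygon f = convex hull (pt ` keys f)"
    unfolding newton_polygon_def pt_def case_prod_unfold ..
  moreover have "convex hull (pt ` keys f) \<subseteq> convex hull V \<longleftrightarrow> pt ` keys f \<subseteq> convex hull V"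
    by (metis convex_convex_hull hull_minimal hull_subset order.trans)
  ultimately show ?thesis by auto
qed

text \<open>Barycentric coordinates: \<open>v\<close> is the height relative to \<open>q\<close>,
  and \<open>w\<close> is what remains of the abscissa, relative to \<open>p\<close>. By
  \<open>K p = K m - q\<close> the edge from \<open>(p, 0)\<close> to \<open>(m, q)\<close> has
  slope \<open>K\<close>, which gives the last inequality of \<open>tri\<close>.\<close>

lemma pt_in_hull_iff:
  fixes p :: real
  assumes m: "m > 0" and K: "K > 0" and p: "real K * p = real K * real m - real q" "p \<ge> 0"
  shows "pt u \<in> convex hull {vector [0, 0], vector [real m, real q], vector [p, 0]} \<longleftrightarrow> u \<in> tri K m q"
    (is "?L \<longleftrightarrow> ?R")
proof -
  define x y where "x = real_of_int (fst u)" and "y = real_of_int (snd u)"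
  have L: "?L \<longleftrightarrow> (\<exists>v w. 0 \<le> v \<and> 0 \<le> w \<and> v + w \<le> 1 \<and> x = v * real m + w * p \<and> y = v * real q)"
  proof
    assume ?L
    then obtain a v w where "0 \<le> a" "0 \<le> v" "0 \<le> w" "a + v + w = 1"
      and eq: "pt u = a *\<^sub>R vector [0, 0] + v *\<^sub>R vector [real m, real q] + w *\<^sub>R vector [p, 0]"
      unfolding convex_hull_3 by blast
    moreover have "x = v * real m + w * p" using arg_cong[OF eq, of "\<lambda>z. vec_nth z 1"] by (simp add: pt_def x_def)
    moreover have "y = v * real q" using arg_cong[OF eq, of "\<lambda>z. vec_nth z 2"] by (simp add: pt_def y_def)
    ultimately show "\<exists>v w. 0 \<le> v \<and> 0 \<le> w \<and> v + w \<le> 1 \<and> x = v * real m + w * p \<and> y = v * real q"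
      by (intro exI[of _ v] exI[of _ w]) auto
  next
    assume "\<exists>v w. 0 \<le> v \<and> 0 \<le> w \<and> v + w \<le> 1 \<and> x = v * real m + w * p \<and> y = v * real q"
    then obtain v w where vw: "0 \<le> v" "0 \<le> w" "v + w \<le> 1" "x = v * real m + w * p" "y = v * real q" by blast
    have "pt u = (1 - v - w) *\<^sub>R vector [0, 0] + v *\<^sub>R vector [real m, real q] + w *\<^sub>R vector [p, 0]"
      using vw(4,5) by (simp add: Finite_Cartesian_Product.vec_eq_iff forall_2 pt_def x_def y_def)
    moreover have "0 \<le> 1 - v - w" "(1 - v - w) + v + w = 1" using vw(3) by auto
    ultimately show ?L unfolding convex_hull_3 using vw(1,2) by blast
  qed
  have R: "?R \<longleftrightarrow> 0 \<le> x \<and> x \<le> real m \<and> 0 \<le> y \<and> real m * y \<le> real q * x \<and>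
      real K * (x - p) \<le> y"
  proof -
    have "int m * snd u \<le> int q * fst u \<longleftrightarrow> real m * y \<le> real q * x"
      unfolding x_def y_def by (metis of_int_le_iff of_int_mult of_int_of_nat_eq)
    moreover have "fst u \<le> int m \<longleftrightarrow> x \<le> real m"
      unfolding x_def by (metis of_int_le_iff of_int_of_nat_eq)
    moreover have "int q - int K * (int m - fst u) \<le> snd u \<longleftrightarrow>
        real_of_int (int q - int K * (int m - fst u)) \<le> real_of_int (snd u)"
      by (simp only: of_int_le_iff)
    moreover have "real_of_int (int q - int K * (int m - fst u)) = real K * (x - p)"
      using p(1) by (simp add: x_def algebra_simps)
    ultimately show ?thesis by (simp add: tri_def x_def y_def)
  qed
  have Kp: "real K * real m = real K * p + real q" using p(1) by simp
  have pm: "p \<le> real m"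
  proof -
    have "real K * p \<le> real K * real m" using p(1) by simp
    then show ?thesis using K by simp
  qed
  show ?thesis
    unfolding L R
  proof
    assume "\<exists>v w. 0 \<le> v \<and> 0 \<le> w \<and> v + w \<le> 1 \<and> x = v * real m + w * p \<and> y = v * real q"
    then obtain v w where vw: "0 \<le> v" "0 \<le> w" "v + w \<le> 1" "x = v * real m + w * p" "y = v * real q" by blast
    have "w * p \<le> w * real m" using vw(2) pm by (intro mult_left_mono)
    moreover have "(v + w) * real m \<le> 1 * real m" using vw(3) by (intro mult_right_mono) auto
    ultimately have "x \<le> real m" using vw(4) by (simp add: algebra_simps)
    moreover have "real K * (x - p) = y - (1 - v - w) * (real K * p)"
    proof -
      have "real K * (x - p) = v * (real K * real m) + w * (real K * p) - real K * p"
        using vw(4) by (simp add: algebra_simps)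
      then show ?thesis unfolding Kp using vw(5) by (simp add: algebra_simps)
    qed
    moreover have "(1 - v - w) * (real K * p) \<ge> 0" using vw(3) p(2) by simp
    moreover have "real m * y \<le> real q * x"
    proof -
      have "real q * x - real m * y = real q * (w * p)" using vw(4,5) by (simp add: algebra_simps)
      moreover have "real q * (w * p) \<ge> 0" using vw(2) p(2) by simp
      ultimately show ?thesis by linarith
    qed
    ultimately show "0 \<le> x \<and> x \<le> real m \<and> 0 \<le> y \<and> real m * y \<le> real q * x \<and> real K * (x - p) \<le> y"
      using vw p(2) by simp
  next
    assume "0 \<le> x \<and> x \<le> real m \<and> 0 \<le> y \<and> real m * y \<le> real q * x \<and> real K * (x - p) \<le> y"
    then have b: "0 \<le> x" "x \<le> real m" "0 \<le> y" "real m * y \<le> real q * x" "real K * (x - p) \<le> y" by auto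
    \<comment> \<open>The triangle is a segment if \<open>q = 0\<close> or \<open>p = 0\<close>, as
      happens for \<open>IT\<close> with \<open>N = 0\<close> or \<open>M = 0\<close>.\<close>
    consider "q = 0" | "q > 0" "p = 0" | "q > 0" "p > 0" using p(2) by fastforce
    then show "\<exists>v w. 0 \<le> v \<and> 0 \<le> w \<and> v + w \<le> 1 \<and> x = v * real m + w * p \<and> y = v * real q"
    proof cases
      case 1
      then have "p = real m" using Kp K by simp
      moreover have "y = 0" using b(3,4) 1 m by (simp add: mult_le_0_iff)
      ultimately show ?thesis using b 1 m by (intro exI[of _ 0] exI[of _ "x / real m"]) simp
    next
      case 2
      have q: "real q = real K * real m" using Kp 2 by simp
      have "real m * y \<le> real m * (real K * x)" using b(4) unfolding q by (simp add: mult_ac)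
      then have "y \<le> real K * x" using m by simp
      moreover have "real K * x \<le> y" using b(5) 2 by simp
      ultimately have "y = real K * x" by simp
      then show ?thesis using b m 2 q by (intro exI[of _ "x / real m"] exI[of _ 0]) simp
    next
      case 3
      define v where "v = y / real q"
      define w where "w = (x - v * real m) / p"
      have y: "y = v * real q" and x: "x = v * real m + w * p" using 3 by (simp_all add: v_def w_def)
      have v: "0 \<le> v" using b(3) by (simp add: v_def)
      have "v * real m \<le> x" using b(4) 3 by (simp add: v_def field_simps)
      then have w: "0 \<le> w" using 3 by (simp add: w_def)
      have "real K * (x - p) = v * (real K * real m) + w * (real K * p) - real K * p"
        using x by (simp add: algebra_simps)
      then have "(v + w) * (real K * p) \<le> 1 * (real K * p)"
        using b(5) y unfolding Kp by (simp add: algebra_simps)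
      then have "v + w \<le> 1" using 3 K by simp
      then show ?thesis using v w x y by blast
    qed
  qed
qed

section \<open>The triangles IT and RT as regions of the plane\<close>

fun hgt :: "triangle \<Rightarrow> nat" where
  "hgt (IT K M N) = K * N"
| "hgt (RT K M N) = M + N"

fun slope :: "triangle \<Rightarrow> nat" where
  "slope (IT K M N) = K"
| "slope (RT K M N) = K"

lemma all_triangles_cases:
  assumes "t \<in> all_triangles"
  obtains K M N where "t = IT K M N" "solution K M N"
    | K M N where "t = RT K M N" "solution K M N" "M > 0"
  using assms by (auto simp: all_triangles_def)

lemma solution_square:
  assumes "solution K M N"
  shows "(real M + real N) * (real M + real N) = real K * real M * real N + 1"
proof -
  have "real ((M + N)\<^sup>2) = real (K * M * N + 1)" using assms by (simp only: solution_def)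
  then show ?thesis by (simp add: power2_eq_square)
qed

lemma region_properties:
  assumes t: "t \<in> all_triangles"
  shows "vanishing_order t > 0"
    "pt u \<in> region t \<longleftrightarrow> u \<in> tri (slope t) (vanishing_order t) (hgt t)"
    "measure lborel (region t) \<le> (real (vanishing_order t))\<^sup>2 / 2"
    "\<exists>V. region t = convex hull V"
proof -
  define m q K where "m = vanishing_order t" and "q = hgt t" and "K = slope t"
  have "m > 0 \<and> K > 0 \<and> (\<exists>p::real. region t = convex hull {vector [0, 0], vector [real m, real q], vector [p, 0]} \<and>
     real K * p = real K * real m - real q \<and> p \<ge> 0 \<and> p * real q \<le> real m * real m)"
    using t
  proof (cases rule: all_triangles_cases)
    case (1 K' M N)
    note sq = solution_square[OF 1(2)]
    have "m = M + N" "q = K' * N" "K = K'" using 1 by (auto simp: m_def q_def K_def)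
    moreover have "K' \<ge> 3" using 1 by (simp add: solution_def)
    moreover have "M + N > 0" using sq by (cases "M + N") auto
    ultimately show ?thesis using 1(1) sq
      by (intro conjI exI[of _ "real M"]) (simp_all add: algebra_simps)
  next
    case (2 K' M N)
    note sq = solution_square[OF 2(2)]
    have K: "K' \<ge> 3" using 2 by (simp add: solution_def)
    have mq: "m = M" "q = M + N" "K = K'" using 2 by (auto simp: m_def q_def K_def)
    let ?p = "real M - (real M + real N) / real K'"
    have Kp: "real K' * ?p = real K' * real M - (real M + real N)" using K by (simp add: field_simps)
    \<comment> \<open>This places the third vertex at \<open>p >= 0\<close>. Otherwise the equation
      would force \<open>(M + N) M <= 1\<close>, hence the solution \<open>(1, 0)\<close>, which
      satisfies the inequality.\<close>
    have "real M + real N \<le> real K' * real M"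
    proof (rule ccontr)
      assume "\<not> real M + real N \<le> real K' * real M"
      then have "real K' * real M * real N \<le> (real M + real N) * real N" by (intro mult_right_mono) auto
      then have "(real M + real N) * real M \<le> 1" using sq by (simp add: algebra_simps)
      then have "(M + N) * M \<le> 1"
        by (metis of_nat_1 of_nat_add of_nat_le_iff of_nat_mult)
      then have "M = 1 \<and> N = 0" using 2(3) by (cases M) auto
      then show False using \<open>\<not> real M + real N \<le> real K' * real M\<close> K by simp
    qed
    then have "real K' * ?p \<ge> 0" unfolding Kp by simp
    then have p0: "?p \<ge> 0" using K by (simp add: zero_le_mult_iff)
    have "real K' * (?p * (real M + real N)) \<le> real K' * (real M * real M)"
    proof -
      have "real K' * (?p * (real M + real N)) = (real K' * ?p) * (real M + real N)" by (simp only: mult.assoc)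
      also have "\<dots> = real K' * real M * (real M + real N) - (real M + real N) * (real M + real N)"
        unfolding Kp by (simp add: left_diff_distrib)
      also have "\<dots> \<le> real K' * (real M * real M)" unfolding sq by (simp add: algebra_simps)
      finally show ?thesis .
    qed
    then have "?p * (real M + real N) \<le> real M * real M" using K by simp
    then show ?thesis using 2 K Kp p0 mq by (intro conjI exI[of _ ?p]) simp_all
  qed
  then obtain p where m: "m > 0" "K > 0" and reg: "region t = convex hull {vector [0, 0], vector [real m, real q], vector [p, 0]}"
    and p: "real K * p = real K * real m - real q" "p \<ge> 0" and area: "p * real q \<le> real m * real m" by blast
  show "vanishing_order t > 0" using m m_def by simp
  show "pt u \<in> region t \<longleftrightarrow> u \<in> tri (slope t) (vanishing_order t) (hgt t)"
    unfolding reg using pt_in_hull_iff[OF m p] by (simp only: m_def q_def K_def)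
  have "measure lborel (region t) = p * real q / 2"
    unfolding reg content_triangle using p by simp
  also have "\<dots> \<le> (real m)\<^sup>2 / 2" using area by (simp add: power2_eq_square)
  finally show "measure lborel (region t) \<le> (real (vanishing_order t))\<^sup>2 / 2" by (simp only: m_def)
  show "\<exists>V. region t = convex hull V" using reg by blast
qed

lemma supports_iff:
  assumes t: "t \<in> all_triangles"
  shows "supports_negative_curve (region t) (vanishing_order t) f \<longleftrightarrow>
    irreducible f \<and> keys f \<subseteq> tri (slope t) (vanishing_order t) (hgt t) \<and> moments_vanish (vanishing_order t) f"
proof -
  obtain V where V: "region t = convex hull V" using region_properties(4)[OF t] by blast
  have "newton_polygon f \<subseteq> region t \<longleftrightarrow> (\<forall>u\<in>keys f. pt u \<in> region t)"
    unfolding V by (rule newton_polygon_subset_hull_iff)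
  also have "\<dots> \<longleftrightarrow> keys f \<subseteq> tri (slope t) (vanishing_order t) (hgt t)"
    unfolding region_properties(2)[OF t] by blast
  finally show ?thesis
    using region_properties(1,3)[OF t]
    by (simp add: supports_negative_curve_def vanishes_iff_moments)
qed

lemma ex_model:
  assumes "t \<in> all_triangles"
  shows "\<exists>f :: 'k::field_char_0 laurent. model (slope t) (vanishing_order t) (hgt t) f"
  using assms
proof (cases rule: all_triangles_cases)
  case (1 K M N)
  then show ?thesis using ex_model_IT[OF 1(2)] by (metis hgt.simps(1) slope.simps(1) vanishing_order.simps(1))
next
  case (2 K M N)
  then show ?thesis using ex_model_RT[OF 2(2,3)] by (metis hgt.simps(2) slope.simps(2) vanishing_order.simps(2))
qed

lemma supports_imp_model:
  assumes "t \<in> all_triangles" "supports_negative_curve (region t) (vanishing_order t) f"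
    "model (slope t) (vanishing_order t) (hgt t) g"
  shows "\<exists>a. a \<noteq> 0 \<and> f = mterm 0 a * g"
proof -
  have f: "irreducible f" "keys f \<subseteq> tri (slope t) (vanishing_order t) (hgt t)" "moments_vanish (vanishing_order t) f"
    using assms(2) unfolding supports_iff[OF assms(1)] by blast+
  then obtain a where a: "f = mterm 0 a * g" using assms(3) unfolding model_def by blast
  moreover have "a \<noteq> 0" using a f(1) by auto
  ultimately show ?thesis by blast
qed

subsection \<open>Affine automorphisms of the exponent lattice\<close>

lemma additive_int_formula:
  assumes "additive w"
  shows "w u = fst u * w (1, 0) + snd u * w (0, 1)"
proof -
  have neg: "w (- u) = - w u" for u
    using additive_add[OF assms, of u "- u"] additive_0[OF assms] by simp
  have nat: "w (int n * a, int n * b) = int n * w (a, b)" for n a b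
  proof (induction n)
    case 0
    then show ?case using additive_0[OF assms] by (simp add: zero_prod_def)
  next
    case (Suc n)
    have step: "(int (Suc n) * a, int (Suc n) * b) = (a, b) + (int n * a, int n * b)" by (simp add: algebra_simps)
    show ?case unfolding step additive_add[OF assms] Suc by (simp add: algebra_simps)
  qed
  have scale: "w (k * a, k * b) = k * w (a, b)" for k a b
  proof (cases "k \<ge> 0")
    case True
    then show ?thesis using nat[of "nat k"] by simp
  next
    case False
    then show ?thesis using nat[of "nat (- k)" a b] neg[of "(- k * a, - k * b)"] by simp
  qed
  have "u = (fst u * 1, fst u * 0) + (snd u * 0, snd u * 1)" by simp
  then have "w u = w (fst u * 1, fst u * 0) + w (snd u * 0, snd u * 1)"
    using additive_add[OF assms] by metis
  then show ?thesis unfolding scale .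
qed

lemma affine_lattice_aut_bij: "affine_lattice_aut \<phi> \<Longrightarrow> bij \<phi>"
proof -
  assume "affine_lattice_aut \<phi>"
  then obtain L t where L: "bij L" "\<phi> = (\<lambda>u. L u + t)" by (auto simp: affine_lattice_aut_def)
  have "bij (\<lambda>u. u + t)" by (rule bij_betw_byWitness[where f'="\<lambda>u. u - t"]) auto
  then have "bij ((\<lambda>u. u + t) \<circ> L)" using L(1) by (rule bij_comp[rotated])
  then show ?thesis unfolding L(2) by (simp add: o_def)
qed

lemma inv_additive:
  fixes L :: "int \<times> int \<Rightarrow> int \<times> int"
  assumes "bij L" "\<forall>u v. L (u + v) = L u + L v"
  shows "inv_into UNIV L (u + v) = inv_into UNIV L u + inv_into UNIV L v"
proof -
  have "L (inv_into UNIV L u + inv_into UNIV L v) = L (inv_into UNIV L u) + L (inv_into UNIV L v)"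
    using assms(2) by blast
  also have "\<dots> = u + v"
    using assms(1) by (simp add: bij_is_surj surj_f_inv_f)
  finally have "L (inv_into UNIV L u + inv_into UNIV L v) = u + v" .
  then show ?thesis using assms(1) by (metis bij_inv_eq_iff)
qed

lemma affine_lattice_aut_inv:
  assumes "affine_lattice_aut \<phi>"
  shows "affine_lattice_aut (inv_into UNIV \<phi>)"
proof -
  from assms obtain L t where L: "bij L" "\<forall>u v. L (u + v) = L u + L v" "\<phi> = (\<lambda>u. L u + t)"
    by (auto simp: affine_lattice_aut_def)
  have "inv_into UNIV \<phi> u = inv_into UNIV L u + inv_into UNIV L (- t)" for u
  proof -
    have "L (inv_into UNIV L u + inv_into UNIV L (- t)) = L (inv_into UNIV L u) + L (inv_into UNIV L (- t))"
      using L(2) by blast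
    also have "\<dots> = u - t" using L(1) by (simp add: bij_is_surj surj_f_inv_f)
    finally have "\<phi> (inv_into UNIV L u + inv_into UNIV L (- t)) = u" by (simp add: L(3))
    then show ?thesis using affine_lattice_aut_bij[OF assms] by (metis bij_inv_eq_iff)
  qed
  then have "inv_into UNIV \<phi> = (\<lambda>u. inv_into UNIV L u + inv_into UNIV L (- t))" by blast
  then show ?thesis
    unfolding affine_lattice_aut_def using inv_additive[OF L(1,2)] bij_imp_bij_inv[OF L(1)] by blast
qed

lemma affine_lattice_aut_comp:
  assumes "affine_lattice_aut \<phi>" "affine_lattice_aut \<psi>"
  shows "affine_lattice_aut (\<phi> \<circ> \<psi>)"
proof -
  from assms obtain L t L' t' where L: "bij L" "\<forall>u v. L (u + v) = L u + L v" "\<phi> = (\<lambda>u. L u + t)"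
    and L': "bij L'" "\<forall>u v. L' (u + v) = L' u + L' v" "\<psi> = (\<lambda>u. L' u + t')"
    unfolding affine_lattice_aut_def by blast
  have "L (L' u + t') = L (L' u) + L t'" for u using L(2) by blast
  then have "\<phi> \<circ> \<psi> = (\<lambda>u. (L \<circ> L') u + (L t' + t))"
    by (intro ext) (simp only: o_apply L(3) L'(3) add.assoc)
  moreover have "bij (L \<circ> L')" using L'(1) L(1) by (rule bij_comp)
  moreover have "\<forall>u v. (L \<circ> L') (u + v) = (L \<circ> L') u + (L \<circ> L') v"
    unfolding o_apply using L(2) L'(2) by metis
  ultimately show ?thesis unfolding affine_lattice_aut_def by blast
qed

lemma affine_lattice_aut_translate: "affine_lattice_aut (\<lambda>u. u + t)"
  unfolding affine_lattice_aut_def by (intro exI[of _ "\<lambda>u. u"] exI[of _ t]) (auto simp: bij_def)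

section \<open>Action of affine automorphisms on Laurent polynomials\<close>

lemma lookup_act:
  assumes "bij \<phi>"
  shows "lk (act_exponents \<phi> f) v = lk f (inv_into UNIV \<phi> v)"
proof -
  have *: "\<phi> u = v \<longleftrightarrow> u = inv_into UNIV \<phi> v" for u using assms by (metis bij_inv_eq_iff)
  show ?thesis
    unfolding act_exponents_def lookup_sum lookup_single when_def *
    by (simp add: in_keys_iff)
qed

lemma keys_act:
  assumes "bij \<phi>"
  shows "keys (act_exponents \<phi> f) = \<phi> ` keys f"
proof -
  have "v \<in> \<phi> ` keys f \<longleftrightarrow> inv_into UNIV \<phi> v \<in> keys f" for v
  proof
    assume "v \<in> \<phi> ` keys f"
    then obtain u where "u \<in> keys f" "v = \<phi> u" by blast
    then show "inv_into UNIV \<phi> v \<in> keys f" by (simp add: bij_is_inj[OF assms])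
  next
    assume "inv_into UNIV \<phi> v \<in> keys f"
    moreover have "v = \<phi> (inv_into UNIV \<phi> v)" by (simp add: surj_f_inv_f[OF bij_is_surj[OF assms]])
    ultimately show "v \<in> \<phi> ` keys f" by (rule rev_image_eqI)
  qed
  moreover have "v \<in> keys (act_exponents \<phi> f) \<longleftrightarrow> inv_into UNIV \<phi> v \<in> keys f" for v
    by (simp only: in_keys_iff lookup_act[OF assms])
  ultimately show ?thesis by blast
qed

lemma lin_act: "lin c (act_exponents \<phi> f) = lin (\<lambda>u. c (\<phi> u)) f"
  unfolding act_exponents_def lin_sum lin_single by (simp add: lin_def)

lemma act_add: "bij \<phi> \<Longrightarrow> act_exponents \<phi> (f + g) = act_exponents \<phi> f + act_exponents \<phi> g"
  by (rule poly_mapping_eqI) (simp add: lookup_act lookup_add)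

lemma act_mterm: "bij \<phi> \<Longrightarrow> act_exponents \<phi> (mterm u a) = mterm (\<phi> u) a"
  by (simp add: act_exponents_def)

lemma act_mult:
  assumes L: "bij L" "\<forall>u v. L (u + v) = L u + L v"
  shows "act_exponents L (f * g) = act_exponents L f * act_exponents L g"
proof (induction f rule: laurent_induct)
  case (single u a)
  show ?case
  proof (induction g rule: laurent_induct)
    case (add g h)
    then show ?case by (simp add: ring_distribs act_add[OF L(1)])
  next
    case (single v b)
    have "L (u + v) = L u + L v" using L(2) by blast
    then show ?case by (simp only: mterm_mult act_mterm[OF L(1)])
  qed
qed (simp add: ring_distribs act_add[OF L(1)])

lemma act_inv:
  assumes "bij \<phi>"
  shows "act_exponents (inv_into UNIV \<phi>) (act_exponents \<phi> f) = f"
proof (rule poly_mapping_eqI)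
  fix v
  show "lk (act_exponents (inv_into UNIV \<phi>) (act_exponents \<phi> f)) v = lk f v"
    unfolding lookup_act[OF bij_imp_bij_inv[OF assms]] lookup_act[OF assms]
      inv_inv_eq[OF assms] inv_f_f[OF bij_is_inj[OF assms]] ..
qed

lemma act_scale: "bij \<phi> \<Longrightarrow> act_exponents \<phi> (mterm 0 a * f) = mterm 0 a * act_exponents \<phi> f"
  by (rule poly_mapping_eqI) (simp add: lookup_act lookup_mterm_mult)

lemma act_affine:
  assumes "bij L" "bij (\<lambda>u. L u + t)"
  shows "act_exponents (\<lambda>u. L u + t) f = mterm t 1 * act_exponents L f"
proof (rule poly_mapping_eqI)
  fix v
  have inv: "inv_into UNIV (\<lambda>u. L u + t) v = inv_into UNIV L (v - t)"
    by (rule inv_f_eq[OF bij_is_inj[OF assms(2)]])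
      (simp add: surj_f_inv_f[OF bij_is_surj[OF assms(1)]])
  show "lk (act_exponents (\<lambda>u. L u + t) f) v = lk (mterm t 1 * act_exponents L f) v"
    unfolding lookup_act[OF assms(2)] inv lookup_mterm_mult lookup_act[OF assms(1)] by simp
qed

lemma affine_fun_comp:
  fixes p :: "int \<times> int \<Rightarrow> 'k::field"
  assumes "affine_fun p" "affine_lattice_aut \<phi>"
  shows "affine_fun (\<lambda>u. p (\<phi> u))"
proof -
  from assms(1) obtain a b c where p: "p = (\<lambda>u. a * of_int (fst u) + b * of_int (snd u) + c)"
    by (auto simp: affine_fun_def)
  from assms(2) obtain L t where L: "\<forall>u v. L (u + v) = L u + L v" "\<phi> = (\<lambda>u. L u + t)"
    by (auto simp: affine_lattice_aut_def)
  have add: "additive (\<lambda>u. fst (L u))" "additive (\<lambda>u. snd (L u))"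
    using L(1) unfolding additive_def by (metis fst_add, metis snd_add)
  have "p (\<phi> u) =
      (a * of_int (fst (L (1, 0))) + b * of_int (snd (L (1, 0)))) * of_int (fst u)
      + (a * of_int (fst (L (0, 1))) + b * of_int (snd (L (0, 1)))) * of_int (snd u)
      + (a * of_int (fst t) + b * of_int (snd t) + c)" for u
  proof -
    have "fst (L u) = fst u * fst (L (1, 0)) + snd u * fst (L (0, 1))"
      "snd (L u) = fst u * snd (L (1, 0)) + snd u * snd (L (0, 1))"
      using additive_int_formula[OF add(1), of u] additive_int_formula[OF add(2), of u] by auto
    then show ?thesis by (simp add: p L(2) algebra_simps)
  qed
  then have "(\<lambda>u. p (\<phi> u)) = (\<lambda>u.
      (a * of_int (fst (L (1, 0))) + b * of_int (snd (L (1, 0)))) * of_int (fst u)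
      + (a * of_int (fst (L (0, 1))) + b * of_int (snd (L (0, 1)))) * of_int (snd u)
      + (a * of_int (fst t) + b * of_int (snd t) + c))" by (rule ext)
  then show ?thesis unfolding affine_fun_def by blast
qed

lemma moments_vanish_act:
  assumes "moments_vanish m f" "affine_lattice_aut \<phi>"
  shows "moments_vanish m (act_exponents \<phi> f)"
  unfolding moments_vanish_def
proof (intro allI impI)
  fix ps :: "(int \<times> int \<Rightarrow> 'a) list" assume ps: "length ps < m \<and> (\<forall>p\<in>set ps. affine_fun p)"
  have "lin (\<lambda>u. \<Prod>p\<leftarrow>map (\<lambda>p u. p (\<phi> u)) ps. p u) f = 0"
  proof (rule moments_vanishD[OF assms(1)])
    fix p assume "p \<in> set (map (\<lambda>p u. p (\<phi> u)) ps)"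
    then obtain p' where "p' \<in> set ps" "p = (\<lambda>u. p' (\<phi> u))" by auto
    then show "affine_fun p" using ps affine_fun_comp[OF _ assms(2)] by blast
  qed (use ps in simp)
  then show "lin (\<lambda>u. \<Prod>p\<leftarrow>ps. p u) (act_exponents \<phi> f) = 0"
    by (simp add: lin_act o_def)
qed

text \<open>The falling factorial of length \<open>m\<close> in the first exponent kills the columns
  \<open>0, ..., m - 1\<close> and leaves \<open>m!\<close> times the coefficient at the vertex
  \<open>(m, q)\<close>. Exactness of the order makes \<open>m\<close> an invariant of the
  curve.\<close>

lemma model_order_exact:
  assumes f: "model K m q f" and m: "m > 0"
  shows "\<not> moments_vanish (m + 1) f"
proof
  assume v: "moments_vanish (m + 1) f"
  have "lin (\<lambda>u. \<Prod>p\<leftarrow>map (\<lambda>s u. of_int (fst u - int s)) [0..<m]. p u) f = 0"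
    by (rule moments_vanishD[OF v]) (auto simp del: of_int_diff intro: affine_fun_coord)
  then have "lin (\<lambda>u. falling (fst u) m) f = 0"
    by (simp add: falling_eq_prod_list o_def del: of_int_diff)
  moreover have "lin (\<lambda>u. falling (fst u) m) f = lin (\<lambda>u. if u = (int m, int q) then falling (int m) m else 0) f"
  proof (rule lin_cong)
    fix u assume "u \<in> keys f"
    then have u: "u \<in> tri K m q" using f by (auto simp: model_def)
    show "falling (fst u) m = (if u = (int m, int q) then falling (int m) m else (0 :: 'a))"
    proof (cases "fst u = int m")
      case True
      then have "u = (int m, int q)" using tri_right[OF u True m] by (simp add: prod_eq_iff)
      then show ?thesis by simp
    next
      case False
      then have "nat (fst u) < m" "fst u - int (nat (fst u)) = 0" using u by (auto simp: tri_def)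
      then have "falling (fst u) m = (0 :: 'a)"
        unfolding falling_def by (intro prod_zero) (auto simp del: of_int_diff intro!: bexI[of _ "nat (fst u)"])
      then show ?thesis using False by auto
    qed
  qed
  moreover have "falling (int m) m \<noteq> (0 :: 'a)"
    unfolding falling_def by (subst prod_zero_iff) (auto simp del: of_int_diff)
  moreover have "lk f (int m, int q) \<noteq> 0" using f by (simp add: model_def flip: in_keys_iff)
  ultimately show False by (simp add: lin_delta)
qed

lemma model_not_single:
  assumes "model K m q f" "m > 0"
  shows "f \<noteq> mterm u a"
proof
  assume "f = mterm u a"
  then have "keys f \<subseteq> {u}" by simp
  then have "(int m, int q) = 0" using assms(1) unfolding model_def by (metis singletonD subsetD)
  then show False using assms(2) by (simp add: zero_prod_def)
qed

text \<open>An isomorphism of the curves divides one equation by the transform of the other; by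
  irreducibility the quotient is a unit, so the supports correspond.\<close>

lemma isomorphic_models:
  fixes f g :: "'k::field_char_0 laurent"
  assumes f: "model K m q f" "m > 0" and g: "model K' m' q' g" "m' > 0"
    and iso: "isomorphic_curves (mterm 0 a * f) (mterm 0 b * g)" and ab: "a \<noteq> 0" "b \<noteq> 0"
  shows "\<exists>\<psi>. affine_lattice_aut \<psi> \<and> keys g = \<psi> ` keys f" "m = m'"
proof -
  from iso obtain \<phi> where \<phi>: "affine_lattice_aut \<phi>"
    and eq: "torus_curve (act_exponents \<phi> (mterm 0 a * f)) = torus_curve (mterm 0 b * g)"
    by (auto simp: isomorphic_curves_def)
  note bij = affine_lattice_aut_bij[OF \<phi>]
  from \<phi> obtain L t where L: "bij L" "\<forall>u v. L (u + v) = L u + L v" "\<phi> = (\<lambda>u. L u + t)"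
    by (auto simp: affine_lattice_aut_def)
  have L': "bij (inv_into UNIV L)" "\<forall>u v. inv_into UNIV L (u + v) = inv_into UNIV L u + inv_into UNIV L v"
    using bij_imp_bij_inv[OF L(1)] inv_additive[OF L(1,2)] by auto
  let ?A = "act_exponents \<phi> f"
  have "g dvd ?A"
  proof -
    have "eval ?A p = 0" if p: "fst p \<noteq> 0" "snd p \<noteq> 0" "eval g p = 0" for p
    proof -
      have "p \<in> torus_curve (mterm 0 b * g)" using p by (simp add: torus_curve_def eval_mult[OF p(1,2)])
      then have "p \<in> torus_curve (mterm 0 a * ?A)" unfolding eq[symmetric] act_scale[OF bij] .
      then have "eval (mterm 0 a * ?A) p = 0" by (simp add: torus_curve_def)
      then show ?thesis using ab(1) by (simp add: eval_mult[OF p(1,2)] eval_mterm)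
    qed
    then show ?thesis using g(1) unfolding model_def by blast
  qed
  then obtain w where w: "?A = g * w" by (elim dvdE)
  \<comment> \<open>Only the linear part acts by a ring automorphism; the translation is split off
    as a monomial unit.\<close>
  have A: "?A = mterm t 1 * act_exponents L f"
    unfolding L(3) by (rule act_affine) (use L(1) bij L(3) in auto)
  have "act_exponents L f = mterm (- t) 1 * ?A"
    unfolding A by (simp add: mterm_mult flip: mult.assoc)
  then have "act_exponents L f = (mterm (- t) 1 * g) * w" by (simp add: w mult.assoc)
  then have "f = act_exponents (inv_into UNIV L) ((mterm (- t) 1 * g) * w)"
    by (metis act_inv L(1))
  then have fac: "f = act_exponents (inv_into UNIV L) (mterm (- t) 1 * g) * act_exponents (inv_into UNIV L) w"
    by (simp only: act_mult[OF L'])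
  have unit_imp: "\<exists>u c. c \<noteq> 0 \<and> h = mterm u c" if unit: "act_exponents (inv_into UNIV L) h dvd 1" for h :: "'k laurent"
  proof -
    obtain u c where uc: "c \<noteq> 0" "act_exponents (inv_into UNIV L) h = mterm u c"
      using laurent_unit_single[OF unit] by blast
    have "h = act_exponents L (act_exponents (inv_into UNIV L) h)"
      using act_inv[OF L'(1), of h] by (simp add: inv_inv_eq L(1))
    then have "h = mterm (L u) c" unfolding uc(2) act_mterm[OF L(1)] .
    then show ?thesis using uc(1) by blast
  qed
  have "irreducible f" using f(1) by (simp add: model_def)
  then have "act_exponents (inv_into UNIV L) (mterm (- t) 1 * g) dvd 1 \<or> act_exponents (inv_into UNIV L) w dvd 1"
    using fac by (rule irreducibleD)
  moreover have "\<not> act_exponents (inv_into UNIV L) (mterm (- t) 1 * g) dvd 1"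
  proof
    assume "act_exponents (inv_into UNIV L) (mterm (- t) 1 * g) dvd 1"
    then obtain u c where "mterm (- t) 1 * g = mterm u c" using unit_imp by blast
    then have "mterm t 1 * (mterm (- t) 1 * g) = mterm (t + u) c" by (simp add: mterm_mult)
    then have "g = mterm (t + u) c" by (simp add: mterm_mult flip: mult.assoc)
    then show False using model_not_single[OF g] by blast
  qed
  ultimately obtain s c where unit_w: "c \<noteq> 0" "w = mterm s c" using unit_imp by blast
  have A': "?A = mterm s c * g" unfolding w unit_w(2) by (rule mult.commute)
  have g': "g = mterm (- s) (1 / c) * ?A"
    unfolding A' using unit_w(1) by (simp add: mterm_mult flip: mult.assoc)
  have "keys g = (\<lambda>v. - s + v) ` keys ?A"
    by (subst g', rule keys_mterm_mult) (use unit_w(1) in simp)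
  also have "\<dots> = (\<lambda>v. v + - s) ` \<phi> ` keys f"
    unfolding keys_act[OF bij] by (simp only: add.commute)
  also have "\<dots> = ((\<lambda>v. v + - s) \<circ> \<phi>) ` keys f" by (simp only: image_comp)
  finally show "\<exists>\<psi>. affine_lattice_aut \<psi> \<and> keys g = \<psi> ` keys f"
    using affine_lattice_aut_comp[OF affine_lattice_aut_translate \<phi>] by blast
  have "moments_vanish m g"
    by (subst g', intro moments_vanish_mult_left moments_vanish_act[OF _ \<phi>]) (use f(1) in \<open>simp add: model_def\<close>)
  then have "m \<le> m'"
    using model_order_exact[OF g] moments_vanish_mono[of m g "m' + 1"] by linarith
  moreover have "moments_vanish m' ?A"
    unfolding A' using g(1) by (intro moments_vanish_mult_left) (simp add: model_def)
  then have "moments_vanish m' (act_exponents (inv_into UNIV \<phi>) ?A)"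
    using affine_lattice_aut_inv[OF \<phi>] by (rule moments_vanish_act)
  then have "moments_vanish m' f" unfolding act_inv[OF bij] .
  then have "m' \<le> m"
    using model_order_exact[OF f] moments_vanish_mono[of m' f "m + 1"] by linarith
  ultimately show "m = m'" by simp
qed

subsection \<open>Edges of finite sets of lattice points\<close>

definition cross :: "int \<times> int \<Rightarrow> int \<times> int \<Rightarrow> int" where
  "cross u v = fst u * snd v - snd u * fst v"

definition scale :: "int \<Rightarrow> int \<times> int \<Rightarrow> int \<times> int" where
  "scale k u = (k * fst u, k * snd u)"

lemma cross_simps:
  "cross u (v + w) = cross u v + cross u w" "cross u (v - w) = cross u v - cross u w"
  "cross (u + v) w = cross u w + cross v w"
  "cross u (scale k v) = k * cross u v" "cross (scale k u) v = k * cross u v"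
  "cross u (- v) = - cross u v" "cross (- u) v = - cross u v"
  "cross u u = 0" "cross u 0 = 0"
  by (simp_all add: cross_def scale_def algebra_simps)

lemma cross_swap: "cross v u = - cross u v"
  by (simp add: cross_def)

definition prim :: "int \<times> int \<Rightarrow> bool" where
  "prim u \<longleftrightarrow> coprime (fst u) (snd u)"

text \<open>Primitive directions of the edges of the convex hull, oriented counterclockwise.\<close>

definition edge :: "(int \<times> int) set \<Rightarrow> int \<times> int \<Rightarrow> bool" where
  "edge S u \<longleftrightarrow> prim u \<and>
     (\<exists>p k. p \<in> S \<and> k > 0 \<and> p + scale k u \<in> S \<and> (\<forall>s\<in>S. 0 \<le> cross u (s - p)))"

lemma edgeI:
  assumes "prim u" "p \<in> S" "k > 0" "p + scale k u \<in> S" "\<And>s. s \<in> S \<Longrightarrow> 0 \<le> cross u (s - p)"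
  shows "edge S u"
  using assms unfolding edge_def by blast

lemma prim_parallel:
  assumes "prim u" "prim v" "cross u v = 0"
  shows "u = v \<or> u = - v"
proof -
  have eq: "fst u * snd v = snd u * fst v" using assms(3) by (simp add: cross_def)
  have "fst u dvd snd u * fst v" "snd u dvd fst u * snd v" "fst v dvd fst u * snd v" "snd v dvd snd u * fst v"
    using eq by (metis dvd_triv_left dvd_triv_right)+
  then have "fst u dvd fst v" "snd u dvd snd v" "fst v dvd fst u" "snd v dvd snd u"
    using assms(1,2) unfolding prim_def
    by (simp_all add: coprime_dvd_mult_right_iff coprime_dvd_mult_left_iff coprime_commute mult.commute)
  then have abs: "\<bar>fst u\<bar> = \<bar>fst v\<bar>" "\<bar>snd u\<bar> = \<bar>snd v\<bar>" by (auto intro: zdvd_antisym_abs)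
  show ?thesis
  proof (cases "fst u = 0 \<or> snd u = 0")
    case True
    then show ?thesis using abs by (cases u, cases v) (auto simp: abs_eq_iff)
  next
    case False
    then consider "fst u = fst v" | "fst u = - fst v" "fst v \<noteq> 0" using abs(1) by (auto simp: abs_eq_iff)
    then show ?thesis
    proof cases
      case 1
      then have "snd v = snd u" using eq False by (simp add: mult.commute)
      then show ?thesis using 1 by (simp add: prod_eq_iff)
    next
      case 2
      then have "snd v = - snd u" using eq by (metis mult_cancel_right mult_minus_left minus_minus mult.commute)
      then show ?thesis using 2 by (simp add: prod_eq_iff)
    qed
  qed
qed

text \<open>Here \<open>n\<close> and \<open>n'\<close> are directions whose supporting lines meet
  at the vertex \<open>v\<close>. A direction strictly between them is a positive combination of
  both, so its supporting line touches \<open>S\<close> at most in \<open>v\<close> and contains no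
  segment of positive length.\<close>

lemma edge_in_cone:
  assumes n: "prim n" "prim n'" "cross n n' > 0"
    and v: "v \<in> S" "\<And>s. s \<in> S \<Longrightarrow> 0 \<le> cross n (s - v)" "\<And>s. s \<in> S \<Longrightarrow> 0 \<le> cross n' (s - v)"
    and u: "edge S u" "cross n u \<ge> 0" "cross u n' \<ge> 0"
  shows "u = n \<or> u = n'"
proof -
  from u(1) obtain p k where p: "prim u" "p \<in> S" "k > 0" "p + scale k u \<in> S" "\<And>s. s \<in> S \<Longrightarrow> 0 \<le> cross u (s - p)"
    unfolding edge_def by blast
  \<comment> \<open>Cramer's rule for \<open>u\<close> in the basis \<open>n\<close>,
    \<open>n'\<close>.\<close>
  have comb: "cross n n' * cross u w = cross u n' * cross n w + cross n u * cross n' w" for w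
    by (simp add: cross_def algebra_simps)
  have zero: "cross u n' * cross n (s - v) = 0 \<and> cross n u * cross n' (s - v) = 0"
    if s: "s \<in> S" "cross u (s - p) = 0" for s
  proof -
    have "cross u (v - p) \<ge> 0" using p(5) v(1) by blast
    then have "cross u (s - v) \<le> 0" using s(2) by (simp add: cross_simps)
    then have "cross n n' * cross u (s - v) \<le> 0" using n(3) by (simp add: mult_le_0_iff)
    moreover have "cross u n' * cross n (s - v) \<ge> 0" "cross n u * cross n' (s - v) \<ge> 0"
      using v(2,3)[OF s(1)] u(2,3) by simp_all
    ultimately show ?thesis unfolding comb by linarith
  qed
  have "cross u n' = 0 \<or> cross n u = 0"
  proof (rule ccontr)
    assume nz: "\<not> (cross u n' = 0 \<or> cross n u = 0)"
    have eq: "s = v" if "cross n (s - v) = 0" "cross n' (s - v) = 0" for s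
    proof -
      have "cross n n' * fst (s - v) = cross n (s - v) * fst n' + cross n' (s - v) * (- fst n)"
        "cross n n' * snd (s - v) = cross n (s - v) * snd n' + cross n' (s - v) * (- snd n)"
        by (simp_all add: cross_def algebra_simps)
      then show ?thesis using that n(3) by (simp add: prod_eq_iff)
    qed
    have "p = v" using zero[OF p(2)] nz by (intro eq) (auto simp: cross_simps)
    moreover have "p + scale k u = v" using zero[OF p(4)] nz by (intro eq) (auto simp: cross_simps)
    ultimately have "scale k u = 0" by simp
    then have "cross (scale k u) n' = 0" by (simp add: cross_def)
    then show False using nz p(3) by (simp add: cross_simps)
  qed
  then show ?thesis
  proof
    assume "cross u n' = 0"
    then consider "u = n'" | "u = - n'" using prim_parallel[OF p(1) n(2)] by blast
    then show ?thesis using u(2) n(3) by cases (simp_all add: cross_simps)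
  next
    assume "cross n u = 0"
    then consider "n = u" | "n = - u" using prim_parallel[OF n(1) p(1)] by blast
    then show ?thesis using u(3) n(3) by cases (simp_all add: cross_simps)
  qed
qed

text \<open>If \<open>u\<close> missed all the cones, going around the cycle would give all
  \<open>cross\<close> values with \<open>u\<close> the same strict sign, against the positive
  linear relation among the directions.\<close>

lemma cone_cover_3:
  assumes "scale c1 n1 + scale c2 n2 + scale c3 n3 = 0" "c1 > 0" "c2 > 0" "c3 > 0"
  shows "cross n1 u \<ge> 0 \<and> cross u n2 \<ge> 0 \<or> cross n2 u \<ge> 0 \<and> cross u n3 \<ge> 0 \<or>
    cross n3 u \<ge> 0 \<and> cross u n1 \<ge> 0"
proof (rule ccontr)
  assume "\<not> ?thesis"
  then have no: "cross n1 u \<ge> 0 \<Longrightarrow> cross n2 u > 0" "cross n2 u \<ge> 0 \<Longrightarrow> cross n3 u > 0" "cross n3 u \<ge> 0 \<Longrightarrow> cross n1 u > 0"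
    using cross_swap[of u] by auto
  have "cross (scale c1 n1 + scale c2 n2 + scale c3 n3) u = 0" unfolding assms(1) by (simp add: cross_def)
  then have sum: "c1 * cross n1 u + c2 * cross n2 u + c3 * cross n3 u = 0" by (simp only: cross_simps)
  consider "cross n1 u > 0" "cross n2 u > 0" "cross n3 u > 0" | "cross n1 u < 0" "cross n2 u < 0" "cross n3 u < 0"
    using no by linarith
  then show False
  proof cases
    case 1
    then have "c1 * cross n1 u > 0" "c2 * cross n2 u > 0" "c3 * cross n3 u > 0" using assms by simp_all
    then show False using sum by linarith
  next
    case 2
    then have "c1 * cross n1 u < 0" "c2 * cross n2 u < 0" "c3 * cross n3 u < 0"
      using assms by (simp_all add: mult_pos_neg)
    then show False using sum by linarith
  qed
qed

lemma cone_cover_4: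
  assumes "scale c1 n1 + scale c2 n2 + scale c3 n3 + scale c4 n4 = 0" "c1 > 0" "c2 > 0" "c3 > 0" "c4 > 0"
  shows "cross n1 u \<ge> 0 \<and> cross u n2 \<ge> 0 \<or> cross n2 u \<ge> 0 \<and> cross u n3 \<ge> 0 \<or>
    cross n3 u \<ge> 0 \<and> cross u n4 \<ge> 0 \<or> cross n4 u \<ge> 0 \<and> cross u n1 \<ge> 0"
proof (rule ccontr)
  assume "\<not> ?thesis"
  then have no: "cross n1 u \<ge> 0 \<Longrightarrow> cross n2 u > 0" "cross n2 u \<ge> 0 \<Longrightarrow> cross n3 u > 0"
    "cross n3 u \<ge> 0 \<Longrightarrow> cross n4 u > 0" "cross n4 u \<ge> 0 \<Longrightarrow> cross n1 u > 0"
    using cross_swap[of u] by auto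
  have "cross (scale c1 n1 + scale c2 n2 + scale c3 n3 + scale c4 n4) u = 0" unfolding assms(1) by (simp add: cross_def)
  then have sum: "c1 * cross n1 u + c2 * cross n2 u + c3 * cross n3 u + c4 * cross n4 u = 0" by (simp only: cross_simps)
  consider "cross n1 u > 0" "cross n2 u > 0" "cross n3 u > 0" "cross n4 u > 0"
    | "cross n1 u < 0" "cross n2 u < 0" "cross n3 u < 0" "cross n4 u < 0"
    using no by linarith
  then show False
  proof cases
    case 1
    then have "c1 * cross n1 u > 0" "c2 * cross n2 u > 0" "c3 * cross n3 u > 0" "c4 * cross n4 u > 0" using assms by simp_all
    then show False using sum by linarith
  next
    case 2
    then have "c1 * cross n1 u < 0" "c2 * cross n2 u < 0" "c3 * cross n3 u < 0" "c4 * cross n4 u < 0"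
      using assms by (simp_all add: mult_pos_neg)
    then show False using sum by linarith
  qed
qed

text \<open>The hypotheses describe a closed walk around the polygon. The cones between consecutive
  directions cover the plane, so \<open>edge_in_cone\<close> at the three vertices excludes every
  further edge.\<close>

lemma edges_triangle:
  assumes n: "prim n1" "prim n2" "prim n3"
    and pos: "cross n1 n2 > 0" "cross n2 n3 > 0" "cross n3 n1 > 0" "c1 > 0" "c2 > 0" "c3 > 0"
    and v: "v \<in> S" "v + scale c1 n1 \<in> S" "v + scale c1 n1 + scale c2 n2 \<in> S"
    and closed: "scale c1 n1 + scale c2 n2 + scale c3 n3 = 0"
    and supp: "\<And>s. s \<in> S \<Longrightarrow> 0 \<le> cross n1 (s - v)"
      "\<And>s. s \<in> S \<Longrightarrow> 0 \<le> cross n2 (s - (v + scale c1 n1))"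
      "\<And>s. s \<in> S \<Longrightarrow> 0 \<le> cross n3 (s - v)"
  shows "Collect (edge S) = {n1, n2, n3}"
proof -
  have s1: "0 \<le> cross n1 (s - (v + scale c1 n1))" if "s \<in> S" for s
    using supp(1)[OF that] by (simp add: cross_simps)
  have s2: "0 \<le> cross n2 (s - (v + scale c1 n1 + scale c2 n2))" if "s \<in> S" for s
    using supp(2)[OF that] by (simp add: cross_simps)
  have vv: "v = v + scale c1 n1 + scale c2 n2 + scale c3 n3" using closed by (simp add: add.assoc)
  have "cross n3 v = cross n3 (v + scale c1 n1 + scale c2 n2)"
    by (subst vv) (simp add: cross_simps)
  then have s3: "0 \<le> cross n3 (s - (v + scale c1 n1 + scale c2 n2))" if "s \<in> S" for s
    using supp(3)[OF that] by (simp add: cross_simps)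
  have "edge S n1" using n(1) v(1) pos(4) v(2) supp(1) by (rule edgeI)
  moreover have "edge S n2" using n(2) v(2) pos(5) v(3) supp(2) by (rule edgeI)
  moreover have "edge S n3"
    by (rule edgeI[OF n(3) v(3) pos(6) _ s3]) (simp only: vv[symmetric] v(1))
  moreover have "u \<in> {n1, n2, n3}" if "edge S u" for u
    using cone_cover_3[OF closed pos(4-6), of u]
      edge_in_cone[OF n(1,2) pos(1) v(2) s1 supp(2) that]
      edge_in_cone[OF n(2,3) pos(2) v(3) s2 s3 that]
      edge_in_cone[OF n(3,1) pos(3) v(1) supp(3,1) that] by blast
  ultimately show ?thesis by blast
qed

lemma edges_quadrilateral:
  assumes n: "prim n1" "prim n2" "prim n3" "prim n4"
    and pos: "cross n1 n2 > 0" "cross n2 n3 > 0" "cross n3 n4 > 0" "cross n4 n1 > 0"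
      "c1 > 0" "c2 > 0" "c3 > 0" "c4 > 0"
    and v: "v \<in> S" "v + scale c1 n1 \<in> S" "v + scale c1 n1 + scale c2 n2 \<in> S" "v + scale c1 n1 + scale c2 n2 + scale c3 n3 \<in> S"
    and closed: "scale c1 n1 + scale c2 n2 + scale c3 n3 + scale c4 n4 = 0"
    and supp: "\<And>s. s \<in> S \<Longrightarrow> 0 \<le> cross n1 (s - v)"
      "\<And>s. s \<in> S \<Longrightarrow> 0 \<le> cross n2 (s - (v + scale c1 n1))"
      "\<And>s. s \<in> S \<Longrightarrow> 0 \<le> cross n3 (s - (v + scale c1 n1 + scale c2 n2))"
      "\<And>s. s \<in> S \<Longrightarrow> 0 \<le> cross n4 (s - v)"
  shows "Collect (edge S) = {n1, n2, n3, n4}"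
proof -
  have s1: "0 \<le> cross n1 (s - (v + scale c1 n1))" if "s \<in> S" for s
    using supp(1)[OF that] by (simp add: cross_simps)
  have s2: "0 \<le> cross n2 (s - (v + scale c1 n1 + scale c2 n2))" if "s \<in> S" for s
    using supp(2)[OF that] by (simp add: cross_simps)
  have s3: "0 \<le> cross n3 (s - (v + scale c1 n1 + scale c2 n2 + scale c3 n3))" if "s \<in> S" for s
    using supp(3)[OF that] by (simp add: cross_simps)
  have vv: "v = v + scale c1 n1 + scale c2 n2 + scale c3 n3 + scale c4 n4" using closed by (simp add: add.assoc)
  have "cross n4 v = cross n4 (v + scale c1 n1 + scale c2 n2 + scale c3 n3)"
    by (subst vv) (simp add: cross_simps)
  then have s4: "0 \<le> cross n4 (s - (v + scale c1 n1 + scale c2 n2 + scale c3 n3))" if "s \<in> S" for s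
    using supp(4)[OF that] by (simp add: cross_simps)
  have "edge S n1" using n(1) v(1) pos(5) v(2) supp(1) by (rule edgeI)
  moreover have "edge S n2" using n(2) v(2) pos(6) v(3) supp(2) by (rule edgeI)
  moreover have "edge S n3" using n(3) v(3) pos(7) v(4) supp(3) by (rule edgeI)
  moreover have "edge S n4"
    by (rule edgeI[OF n(4) v(4) pos(8) _ s4]) (simp only: vv[symmetric] v(1))
  moreover have "u \<in> {n1, n2, n3, n4}" if "edge S u" for u
    using cone_cover_4[OF closed pos(5-8), of u]
      edge_in_cone[OF n(1,2) pos(1) v(2) s1 supp(2) that]
      edge_in_cone[OF n(2,3) pos(2) v(3) s2 supp(3) that]
      edge_in_cone[OF n(3,4) pos(3) v(4) s3 s4 that]
      edge_in_cone[OF n(4,1) pos(4) v(1) supp(4,1) that] by blast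
  ultimately show ?thesis by blast
qed

lemma affine_cross:
  fixes L :: "int \<times> int \<Rightarrow> int \<times> int"
  assumes L: "bij L" "\<forall>u v. L (u + v) = L u + L v"
  shows "\<exists>\<epsilon>. \<bar>\<epsilon>\<bar> = 1 \<and> (\<forall>u v. cross (L u) (L v) = \<epsilon> * cross u v)" "L (scale k u) = scale k (L u)"
    "prim u \<Longrightarrow> prim (L u)"
proof -
  have coords: "fst (M u) = fst u * fst (M (1, 0)) + snd u * fst (M (0, 1))"
    "snd (M u) = fst u * snd (M (1, 0)) + snd u * snd (M (0, 1))"
    if "\<forall>u v. M (u + v) = M u + M v" for M :: "int \<times> int \<Rightarrow> int \<times> int" and u
  proof -
    have "additive (\<lambda>u. fst (M u))" "additive (\<lambda>u. snd (M u))"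
      using that unfolding additive_def by (metis fst_add, metis snd_add)
    from additive_int_formula[OF this(1), of u] additive_int_formula[OF this(2), of u]
    show "fst (M u) = fst u * fst (M (1, 0)) + snd u * fst (M (0, 1))"
      "snd (M u) = fst u * snd (M (1, 0)) + snd u * snd (M (0, 1))" by auto
  qed
  have det: "cross (M u) (M v) = cross (M (1, 0)) (M (0, 1)) * cross u v"
    if "\<forall>u v. M (u + v) = M u + M v" for M :: "int \<times> int \<Rightarrow> int \<times> int" and u v
    unfolding cross_def coords[OF that, of u] coords[OF that, of v] by (simp add: algebra_simps)
  define M where "M = inv_into UNIV L"
  have M: "\<forall>u v. M (u + v) = M u + M v" unfolding M_def using inv_additive[OF L] by blast
  have M_L: "M (L u) = u" for u unfolding M_def using L(1) by (simp add: bij_is_inj)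
  have "cross (1, 0) (0, 1) = cross (M (L (1, 0))) (M (L (0, 1)))" by (simp only: M_L)
  also have "\<dots> = cross (M (1, 0)) (M (0, 1)) * cross (L (1, 0)) (L (0, 1))" by (rule det[OF M])
  finally have "cross (M (1, 0)) (M (0, 1)) * cross (L (1, 0)) (L (0, 1)) = 1" by (simp add: cross_def)
  then have "\<bar>cross (L (1, 0)) (L (0, 1))\<bar> = 1"
    by (metis abs_zmult_eq_1 mult.commute abs_1)
  then show "\<exists>\<epsilon>. \<bar>\<epsilon>\<bar> = 1 \<and> (\<forall>u v. cross (L u) (L v) = \<epsilon> * cross u v)" using det[OF L(2)] by blast
  show "L (scale k u) = scale k (L u)"
    by (simp add: prod_eq_iff scale_def coords[OF L(2), of "(k * fst u, k * snd u)"] coords[OF L(2), of u] algebra_simps)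
  show "prim (L u)" if "prim u"
    unfolding prim_def
  proof (rule coprimeI)
    fix d assume d: "d dvd fst (L u)" "d dvd snd (L u)"
    have "d dvd fst (M (L u))" "d dvd snd (M (L u))"
      unfolding coords[OF M, of "L u"] using d by simp_all
    then show "is_unit d" using that unfolding M_L prim_def by (rule coprime_common_divisor[rotated])
  qed
qed

definition edge_map :: "(int \<times> int) set \<Rightarrow> (int \<times> int) set \<Rightarrow> (int \<times> int \<Rightarrow> int \<times> int) \<Rightarrow> bool" where
  "edge_map S S' T \<longleftrightarrow> inj T \<and> T ` Collect (edge S) \<subseteq> Collect (edge S') \<and>
     (\<forall>u v. \<bar>cross (T u) (T v)\<bar> = \<bar>cross u v\<bar>)"

text \<open>Orientation-reversing automorphisms reverse the cyclic order, hence the sign.\<close>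

lemma ex_edge_map:
  assumes \<psi>: "affine_lattice_aut \<psi>"
  shows "\<exists>T. edge_map S (\<psi> ` S) T"
proof -
  from \<psi> obtain L t where L: "bij L" "\<forall>u v. L (u + v) = L u + L v" "\<psi> = (\<lambda>u. L u + t)"
    by (auto simp: affine_lattice_aut_def)
  obtain \<epsilon> where e: "\<bar>\<epsilon>\<bar> = 1" "\<And>u v. cross (L u) (L v) = \<epsilon> * cross u v"
    using affine_cross(1)[OF L(1,2)] by blast
  have Ladd: "L (u + v) = L u + L v" for u v using L(2) by blast
  then have Ldiff: "L (u - v) = L u - L v" for u v
    by (metis add_diff_cancel_right' diff_add_cancel)
  have shift: "\<psi> s - \<psi> p = L (s - p)" for s p unfolding L(3) Ldiff by simp
  have shift': "\<psi> (p + scale k u) = \<psi> p + scale k (L u)" for p k u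
    unfolding L(3) Ladd affine_cross(2)[OF L(1,2)] by (simp only: ac_simps)
  from e(1) consider "\<epsilon> = 1" | "\<epsilon> = - 1" by linarith
  then show ?thesis
  proof cases
    case 1
    have "edge (\<psi> ` S) (L u)" if "edge S u" for u
    proof -
      from that obtain p k where p: "prim u" "p \<in> S" "k > 0" "p + scale k u \<in> S" "\<And>s. s \<in> S \<Longrightarrow> 0 \<le> cross u (s - p)"
        unfolding edge_def by blast
      show ?thesis
      proof (rule edgeI[OF affine_cross(3)[OF L(1,2) p(1)] imageI[OF p(2)] p(3)])
        show "\<psi> p + scale k (L u) \<in> \<psi> ` S" using p(4) unfolding shift'[symmetric] by (rule imageI)
        fix s assume "s \<in> \<psi> ` S"
        then obtain s' where s': "s' \<in> S" "s = \<psi> s'" by blast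
        show "0 \<le> cross (L u) (s - \<psi> p)" unfolding s'(2) shift e(2) using p(5)[OF s'(1)] 1 by simp
      qed
    qed
    then have "edge_map S (\<psi> ` S) L"
      unfolding edge_map_def using bij_is_inj[OF L(1)] e by (auto simp: abs_mult)
    then show ?thesis by blast
  next
    case 2
    have "edge (\<psi> ` S) (- L u)" if "edge S u" for u
    proof -
      from that obtain p k where p: "prim u" "p \<in> S" "k > 0" "p + scale k u \<in> S" "\<And>s. s \<in> S \<Longrightarrow> 0 \<le> cross u (s - p)"
        unfolding edge_def by blast
      have pr: "prim (- L u)" using affine_cross(3)[OF L(1,2) p(1)] by (simp add: prim_def)
      show ?thesis
      proof (rule edgeI[OF pr _ p(3)])
        show "\<psi> (p + scale k u) \<in> \<psi> ` S" using p(4) by (rule imageI)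
        have "scale k (- L u) = - scale k (L u)" by (simp add: scale_def)
        then have "\<psi> (p + scale k u) + scale k (- L u) = \<psi> p" unfolding shift' by simp
        then show "\<psi> (p + scale k u) + scale k (- L u) \<in> \<psi> ` S" using p(2) by simp
        fix s assume "s \<in> \<psi> ` S"
        then obtain s' where s': "s' \<in> S" "s = \<psi> s'" by blast
        have "cross (- L u) (s - \<psi> (p + scale k u)) = cross u (s' - (p + scale k u))"
          unfolding s'(2) shift cross_simps(7) e(2) using 2 by simp
        also have "\<dots> = cross u (s' - p)" by (simp add: cross_simps)
        finally show "0 \<le> cross (- L u) (s - \<psi> (p + scale k u))" using p(5)[OF s'(1)] by simp
      qed
    qed
    moreover have "inj (\<lambda>u. - L u)" using bij_is_inj[OF L(1)] by (auto simp: inj_def)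
    moreover have "\<bar>cross (- L u) (- L v)\<bar> = \<bar>cross u v\<bar>" for u v
      using e by (simp add: cross_simps abs_mult)
    ultimately have "edge_map S (\<psi> ` S) (\<lambda>u. - L u)" unfolding edge_map_def by blast
    then show ?thesis by blast
  qed
qed

subsection \<open>Newton polygons of the negative curves\<close>

lemma prim_1: "prim (1, k)"
  by (simp add: prim_def)

lemma prim_neg_nat: "coprime m q \<Longrightarrow> prim (- int m, - int q)"
  by (simp add: prim_def)

definition typeI :: "nat \<Rightarrow> nat \<Rightarrow> nat \<Rightarrow> (int \<times> int) set \<Rightarrow> bool" where
  "typeI K M N S \<longleftrightarrow> K \<ge> 3 \<and> M > 0 \<and> N > 0 \<and> coprime (M + N) (K * N) \<and> S \<subseteq> tri K (M + N) (K * N) \<and>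
     0 \<in> S \<and> (int M, 0) \<in> S \<and> (int (M + N), int (K * N)) \<in> S"

lemma edges_typeI:
  assumes "typeI K M N S"
  shows "Collect (edge S) = {(1, 0), (1, int K), (- int (M + N), - int (K * N))}"
proof -
  have h: "K \<ge> 3" "M > 0" "N > 0" "coprime (M + N) (K * N)" "S \<subseteq> tri K (M + N) (K * N)"
    "0 \<in> S" "(int M, 0) \<in> S" "(int (M + N), int (K * N)) \<in> S"
    using assms unfolding typeI_def by blast+
  have t: "0 \<le> snd s" "int (M + N) * snd s \<le> int (K * N) * fst s" "int (K * N) - int K * (int (M + N) - fst s) \<le> snd s"
    if "s \<in> S" for s using set_mp[OF h(5) that] by (simp_all add: tri_def)
  have v1: "0 + scale (int M) (1, 0) = (int M, 0)" by (simp add: scale_def)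
  have v2: "0 + scale (int M) (1, 0) + scale (int N) (1, int K) = (int (M + N), int (K * N))" by (simp add: scale_def)
  show ?thesis
  proof (rule edges_triangle[where v=0 and ?c1.0="int M" and ?c2.0="int N" and ?c3.0=1])
    show "prim (1, 0)" "prim (1, int K)" by (rule prim_1)+
    show "prim (- int (M + N), - int (K * N))" using h(4) by (rule prim_neg_nat)
    have "int (K * N) > 0" "int (K * M) > 0" "int K > 0" using h by simp_all
    then show "cross (1, 0) (1, int K) > 0" "cross (1, int K) (- int (M + N), - int (K * N)) > 0"
      "cross (- int (M + N), - int (K * N)) (1, 0) > 0"
      by (simp_all add: cross_def algebra_simps)
    show "scale (int M) (1, 0) + scale (int N) (1, int K) + scale 1 (- int (M + N), - int (K * N)) = 0"
      by (simp add: scale_def zero_prod_def)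
    show "0 + scale (int M) (1, 0) \<in> S" unfolding v1 by (rule h)
    show "0 + scale (int M) (1, 0) + scale (int N) (1, int K) \<in> S" unfolding v2 by (rule h)
    fix s assume s: "s \<in> S"
    show "0 \<le> cross (1, 0) (s - 0)" using t(1)[OF s] by (simp add: cross_def)
    show "0 \<le> cross (1, int K) (s - (0 + scale (int M) (1, 0)))"
      unfolding v1 using t(3)[OF s] by (simp add: cross_def algebra_simps)
    show "0 \<le> cross (- int (M + N), - int (K * N)) (s - 0)"
      using t(2)[OF s] by (simp add: cross_def algebra_simps)
  qed (use h in simp_all)
qed

text \<open>This fits the support of an \<open>RT\<close> curve with \<open>r = K - 1\<close>,
  \<open>a = degree A\<close> and \<open>b = degree B\<close>. As \<open>q = K (b + 1) - 1\<close>,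
  the third vertex of the triangle is \<open>(a + 1/K, 0)\<close>, and \<open>(a, 0)\<close> is the
  last lattice point before it. The equation in \<open>K\<close>, \<open>m\<close>, \<open>q\<close>
  is the original one for \<open>N = q - m\<close>; the two inequalities serve to keep determinants
  of edges away from 1.\<close>

definition typeR :: "nat \<Rightarrow> nat \<Rightarrow> nat \<Rightarrow> nat \<Rightarrow> nat \<Rightarrow> (int \<times> int) set \<Rightarrow> bool" where
  "typeR K m q a b S \<longleftrightarrow> K \<ge> 3 \<and> m = a + b + 1 \<and> q + 1 = K * (b + 1) \<and> a > 0 \<and> b > 0 \<and>
     m + 2 \<le> q \<and> q + m + 2 \<le> K * m \<and> K * m * q + 1 = K * m * m + q * q \<and> coprime m q \<and>
     S \<subseteq> tri K m q \<and> 0 \<in> S \<and> (int a, 0) \<in> S \<and> (int m, int q) \<in> S"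

text \<open>The parameter \<open>e\<close> is the multiplicity of \<open>0\<close> as a root of \<open>B\<close>, which is not known; for
  \<open>e = b\<close> the polygon degenerates to a triangle.\<close>

lemma edges_typeR:
  assumes "typeR K m q a b S"
  shows "(\<exists>e::nat. e < b \<and> Collect (edge S) =
      {(1, 0), (1 + int e, int K * (int e + 1) - 1), (1, int K), (- int m, - int q)}) \<or>
    Collect (edge S) = {(1, 0), (1 + int b, int q), (- int m, - int q)}"
proof -
  have h: "K \<ge> 3" "m = a + b + 1" "q + 1 = K * (b + 1)" "a > 0" "b > 0" "q + m + 2 \<le> K * m" "coprime m q"
    "S \<subseteq> tri K m q" "0 \<in> S" "(int a, 0) \<in> S" "(int m, int q) \<in> S"
    using assms unfolding typeR_def by blast+
  have mi: "int m = int a + int b + 1" using h(2) by simp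
  have "int (q + 1) = int (K * (b + 1))" by (simp only: h(3))
  then have qi: "int q = int K * (int b + 1) - 1" by (simp add: algebra_simps)
  have "int (q + m + 2) \<le> int (K * m)" using h(6) by (simp only: of_nat_le_iff)
  then have L: "int q + int m + 2 \<le> int K * int m" by simp
  have t: "0 \<le> snd s" "int m * snd s \<le> int q * fst s" "int K * (fst s - int a) - 1 \<le> snd s"
    if "s \<in> S" for s
    using set_mp[OF h(8) that] by (simp_all add: tri_def mi qi algebra_simps)
  \<comment> \<open>These are the lattice points with positive height on the right edge
    \<open>y = K (x - a) - 1\<close> of the triangle; \<open>e = b\<close> gives
    \<open>(m, q)\<close>. The lowest one in \<open>S\<close> is where the polygon leaves that
    edge.\<close>
  let ?P = "\<lambda>e::nat. (int a + 1 + int e, int K * (int e + 1) - 1) \<in> S"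
  have "?P b" using h(11) by (simp add: mi qi add_ac)
  define e where "e = (LEAST e. ?P e)"
  have e: "?P e" "e \<le> b" unfolding e_def using \<open>?P b\<close> by (rule LeastI, rule Least_le)
  have min: "int e \<le> fst s - int a - 1" if s: "s \<in> S" "snd s = int K * (fst s - int a) - 1" for s
  proof -
    have "fst s - int a \<ge> 1"
    proof (rule ccontr)
      assume "\<not> fst s - int a \<ge> 1"
      then have "int K * (fst s - int a) \<le> 0" by (simp add: mult_le_0_iff)
      then show False using t(1)[OF s(1)] s(2) by simp
    qed
    then have n: "int (nat (fst s - int a - 1)) = fst s - int a - 1" by simp
    have "s = (int a + 1 + int (nat (fst s - int a - 1)), int K * (int (nat (fst s - int a - 1)) + 1) - 1)"
      unfolding n by (simp add: prod_eq_iff s(2))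
    then have "?P (nat (fst s - int a - 1))" using s(1) by simp
    then have "e \<le> nat (fst s - int a - 1)" unfolding e_def by (rule Least_le)
    then show ?thesis using n by linarith
  qed
  let ?d = "int K * (int e + 1) - 1"
  have d: "?d \<ge> 2"
  proof -
    have "3 * 1 \<le> int K * (int e + 1)" using h(1) by (intro mult_mono) auto
    then show ?thesis by simp
  qed
  have supp: "0 \<le> cross (1 + int e, ?d) (s - (int a, 0))" if s: "s \<in> S" for s
  proof -
    define x where "x = fst s - int a"
    have j: "0 \<le> snd s" "int K * x - 1 \<le> snd s" using t[OF s] by (simp_all add: x_def)
    have "0 \<le> (1 + int e) * snd s - ?d * x"
    proof (cases "snd s = int K * x - 1")
      case True
      then have "int e + 1 \<le> x" using min[OF s] by (simp add: x_def)
      then show ?thesis unfolding True by (simp add: algebra_simps)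
    next
      case False
      \<comment> \<open>Off the right edge integrality gains 1, so the point lies on or above the
        line of slope \<open>K\<close> through \<open>(a, 0)\<close>, which is steeper than the
        direction \<open>(1 + e, ?d)\<close>.\<close>
      then have "int K * x \<le> snd s" using j by simp
      then have "(1 + int e) * (int K * x) \<le> (1 + int e) * snd s" by (intro mult_left_mono) auto
      moreover have "(1 + int e) * snd s \<ge> 0" using j by simp
      moreover have "?d * x = (1 + int e) * (int K * x) - x" by (simp add: algebra_simps)
      moreover have "?d * x \<le> 0" if "x < 0" using d that by (simp add: mult_le_0_iff)
      ultimately show ?thesis by (cases "x < 0") linarith+
    qed
    then show ?thesis by (simp add: cross_def x_def)
  qed
  have "prim (1 + int e, ?d)"
    unfolding prim_def
  proof (rule coprimeI)
    fix c assume c: "c dvd fst (1 + int e, ?d)" "c dvd snd (1 + int e, ?d)"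
    then have "c dvd int K * (1 + int e) - ?d"
      unfolding fst_conv snd_conv by (elim dvd_diff[OF dvd_mult])
    moreover have "int K * (1 + int e) - ?d = 1" by (simp add: algebra_simps)
    ultimately show "is_unit c" by simp
  qed
  note pr = prim_1[of 0] this prim_1[of "int K"] prim_neg_nat[OF h(7)]
  have s1: "0 \<le> cross (1, 0) (s - 0)" if "s \<in> S" for s using t(1)[OF that] by (simp add: cross_def)
  have s4: "0 \<le> cross (- int m, - int q) (s - 0)" if "s \<in> S" for s
    using t(2)[OF that] by (simp add: cross_def)
  have v1: "0 + scale (int a) (1, 0) = (int a, 0)" by (simp add: scale_def)
  have v2: "0 + scale (int a) (1, 0) + scale 1 (1 + int e, ?d) = (int a + 1 + int e, ?d)" by (simp add: scale_def)
  have "m + 2 \<le> q" using assms unfolding typeR_def by blast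
  then have q0: "int q > 0" by simp
  have c1: "cross (1, 0) (1 + int e, ?d) > 0" using d by (simp add: cross_def)
  have c4: "cross (- int m, - int q) (1, 0) > 0" using q0 by (simp add: cross_def)
  show ?thesis
  proof (cases "e < b")
    case True
    have v3: "0 + scale (int a) (1, 0) + scale 1 (1 + int e, ?d) + scale (int b - int e) (1, int K) = (int m, int q)"
      by (simp add: scale_def mi qi algebra_simps)
    have "Collect (edge S) = {(1, 0), (1 + int e, ?d), (1, int K), (- int m, - int q)}"
    proof (rule edges_quadrilateral[OF pr, where v=0 and ?c1.0="int a" and ?c2.0=1 and ?c3.0="int b - int e" and ?c4.0=1])
      show "cross (1 + int e, ?d) (1, int K) > 0" by (simp add: cross_def algebra_simps)
      show "cross (1, int K) (- int m, - int q) > 0" using L by (simp add: cross_def)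
      show "0 + scale (int a) (1, 0) \<in> S" unfolding v1 by (rule h)
      show "0 + scale (int a) (1, 0) + scale 1 (1 + int e, ?d) \<in> S" unfolding v2 by (rule e)
      show "0 + scale (int a) (1, 0) + scale 1 (1 + int e, ?d) + scale (int b - int e) (1, int K) \<in> S"
        unfolding v3 by (rule h)
      show "scale (int a) (1, 0) + scale 1 (1 + int e, ?d) + scale (int b - int e) (1, int K) + scale 1 (- int m, - int q) = 0"
        by (simp add: scale_def mi qi zero_prod_def algebra_simps)
      fix s assume s: "s \<in> S"
      show "0 \<le> cross (1 + int e, ?d) (s - (0 + scale (int a) (1, 0)))" unfolding v1 using s by (rule supp)
      show "0 \<le> cross (1, int K) (s - (0 + scale (int a) (1, 0) + scale 1 (1 + int e, ?d)))"
        unfolding v2 using t(3)[OF s] by (simp add: cross_def algebra_simps)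
      show "0 \<le> cross (1, 0) (s - 0)" "0 \<le> cross (- int m, - int q) (s - 0)"
        using s by (rule s1, rule s4)
    next
      show "cross (1, 0) (1 + int e, ?d) > 0" "cross (- int m, - int q) (1, 0) > 0" by (rule c1, rule c4)
      show "int a > 0" "int b - int e > 0" using h(4) True by simp_all
      show "0 \<in> S" by (rule h)
    qed simp_all
    then show ?thesis using True by blast
  next
    case False
    then have eb: "e = b" using e(2) by simp
    have dq: "int K * (int b + 1) - 1 = int q" using qi by simp
    have "Collect (edge S) = {(1, 0), (1 + int e, ?d), (- int m, - int q)}"
    proof (rule edges_triangle[OF pr(1,2,4), where v=0 and ?c1.0="int a" and ?c2.0=1 and ?c3.0=1])
      have "int a * int q > 0" using h(4) q0 by simp
      then show "cross (1 + int e, ?d) (- int m, - int q) > 0"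
        unfolding eb dq by (simp add: cross_def mi algebra_simps)
      show "0 + scale (int a) (1, 0) \<in> S" unfolding v1 by (rule h)
      show "0 + scale (int a) (1, 0) + scale 1 (1 + int e, ?d) \<in> S" unfolding v2 by (rule e)
      show "scale (int a) (1, 0) + scale 1 (1 + int e, ?d) + scale 1 (- int m, - int q) = 0"
        unfolding eb dq by (simp add: scale_def mi zero_prod_def)
      fix s assume s: "s \<in> S"
      show "0 \<le> cross (1 + int e, ?d) (s - (0 + scale (int a) (1, 0)))" unfolding v1 using s by (rule supp)
      show "0 \<le> cross (1, 0) (s - 0)" "0 \<le> cross (- int m, - int q) (s - 0)"
        using s by (rule s1, rule s4)
    next
      show "cross (1, 0) (1 + int e, ?d) > 0" "cross (- int m, - int q) (1, 0) > 0" by (rule c1, rule c4)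
      show "int a > 0" using h(4) by simp
      show "0 \<in> S" by (rule h)
    qed simp_all
    then have "Collect (edge S) = {(1, 0), (1 + int b, int q), (- int m, - int q)}"
      unfolding eb dq .
    then show ?thesis by (rule disjI2)
  qed
qed

definition dets :: "(int \<times> int) set \<Rightarrow> int set" where
  "dets S = {\<bar>cross u v\<bar> | u v. edge S u \<and> edge S v}"

text \<open>For a quadrilateral with a unique pair of edges of determinant one, this isolates the
  determinant of the two other edges.\<close>

definition opp :: "(int \<times> int) set \<Rightarrow> int set" where
  "opp S = {\<bar>cross u v\<bar> | u v x y. edge S u \<and> edge S v \<and> edge S x \<and> edge S y \<and>
     distinct [u, v, x, y] \<and> \<bar>cross x y\<bar> = 1}"

lemma edge_map_dets:
  assumes "edge_map S S' T"
  shows "dets S \<subseteq> dets S'" "opp S \<subseteq> opp S'"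
proof -
  have T: "edge S u \<Longrightarrow> edge S' (T u)" "\<bar>cross (T u) (T v)\<bar> = \<bar>cross u v\<bar>" "T u = T v \<longleftrightarrow> u = v" for u v
    using assms unfolding edge_map_def inj_def by blast+
  show "dets S \<subseteq> dets S'"
  proof
    fix c assume "c \<in> dets S"
    then obtain u v where "edge S u" "edge S v" "c = \<bar>cross u v\<bar>" unfolding dets_def by blast
    then have "edge S' (T u)" "edge S' (T v)" "c = \<bar>cross (T u) (T v)\<bar>" using T(1,2) by simp_all
    then show "c \<in> dets S'" unfolding dets_def by blast
  qed
  show "opp S \<subseteq> opp S'"
  proof
    fix c assume "c \<in> opp S"
    then obtain u v x y where "edge S u" "edge S v" "edge S x" "edge S y" "c = \<bar>cross u v\<bar>"
      "distinct [u, v, x, y]" "\<bar>cross x y\<bar> = 1" unfolding opp_def by blast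
    then have "edge S' (T u)" "edge S' (T v)" "edge S' (T x)" "edge S' (T y)" "c = \<bar>cross (T u) (T v)\<bar>"
      "distinct [T u, T v, T x, T y]" "\<bar>cross (T x) (T y)\<bar> = 1" using T by simp_all
    then show "c \<in> opp S'" unfolding opp_def by blast
  qed
qed

lemma dets_eq: "Collect (edge S) = E \<Longrightarrow> dets S = {\<bar>cross u v\<bar> | u v. u \<in> E \<and> v \<in> E}"
  unfolding dets_def by blast

lemma setcompr_eq_image2: "{f u v | u v. u \<in> E \<and> v \<in> E} = (\<lambda>(u, v). f u v) ` (E \<times> E)"
  by force

lemma dets_triangle:
  assumes "Collect (edge S) = {n1, n2, n3}"
  shows "dets S = {0, \<bar>cross n1 n2\<bar>, \<bar>cross n2 n3\<bar>, \<bar>cross n3 n1\<bar>}"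
proof -
  have "dets S = (\<lambda>(u, v). \<bar>cross u v\<bar>) ` ({n1, n2, n3} \<times> {n1, n2, n3})"
    unfolding dets_eq[OF assms] by (rule setcompr_eq_image2)
  also have "\<dots> = {0, \<bar>cross n1 n2\<bar>, \<bar>cross n2 n3\<bar>, \<bar>cross n3 n1\<bar>}"
    by (simp add: insert_Times_insert cross_swap[of n2 n1] cross_swap[of n3 n2] cross_swap[of n1 n3] cross_simps)
      blast
  finally show ?thesis .
qed

lemma dets_typeI:
  assumes "typeI K M N S"
  shows "dets S = {0, int K, int (K * M), int (K * N)}"
proof -
  have "cross (1, int K) (- int (M + N), - int (K * N)) = int (K * M)"
    "cross (- int (M + N), - int (K * N)) (1, 0) = int (K * N)" "cross (1, 0) (1, int K) = int K"
    by (simp_all add: cross_def algebra_simps)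
  then show ?thesis unfolding dets_triangle[OF edges_typeI[OF assms]] by simp
qed

text \<open>If the right side is broken, its two pieces have determinant 1 and any other two edges
  at least 2. Then \<open>opp\<close> returns the determinant \<open>q\<close> of the axis and the
  long edge, and the unknown \<open>e\<close> drops out.\<close>

lemma dets_typeR:
  assumes "typeR K m q a b S"
  shows "1 \<in> dets S \<and> opp S = {int q} \<or> dets S = {0, int q, int (a * q)}"
proof -
  have h: "K \<ge> 3" "m = a + b + 1" "q + 1 = K * (b + 1)" "m + 2 \<le> q" "q + m + 2 \<le> K * m"
    using assms unfolding typeR_def by blast+
  have mi: "int m = int a + int b + 1" using h(2) by simp
  have "int (q + m + 2) \<le> int (K * m)" using h(5) by (simp only: of_nat_le_iff)
  then have L: "int q + int m + 2 \<le> int K * int m" by simp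
  from edges_typeR[OF assms] show ?thesis
  proof (elim disjE exE conjE)
    fix e :: nat
    let ?d = "int K * (int e + 1) - 1"
    let ?n1 = "(1, 0)" and ?n2 = "(1 + int e, ?d)" and ?n3 = "(1, int K)" and ?n4 = "(- int m, - int q)"
    assume e: "e < b" and E: "Collect (edge S) = {?n1, ?n2, ?n3, ?n4}"
    have c: "cross ?n1 ?n2 = ?d" "cross ?n2 ?n3 = 1" "cross ?n3 ?n4 = int K * int m - int q"
      "cross ?n4 ?n1 = int q" "cross ?n1 ?n3 = int K"
      "cross ?n2 ?n4 = (int e + 1) * (int K * int m - int q) - int m"
      by (simp_all add: cross_def algebra_simps)
    have "3 * 1 \<le> int K * (int e + 1)" using h(1) by (intro mult_mono) auto
    then have d2: "?d \<ge> 2" by simp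
    define y where "y = int K * int m - int q"
    have y: "y \<ge> int m + 2" using L by (simp add: y_def)
    then have "0 \<le> int e * y" by simp
    then have "int e * y + y - int m \<ge> 2" using y by linarith
    then have c24: "cross ?n2 ?n4 \<ge> 2" unfolding c(6) y_def[symmetric] by (simp add: distrib_right)
    have ge: "\<bar>cross ?n1 ?n2\<bar> \<ge> 2" "\<bar>cross ?n3 ?n4\<bar> \<ge> 2" "\<bar>cross ?n4 ?n1\<bar> \<ge> 2" "\<bar>cross ?n1 ?n3\<bar> \<ge> 2"
      "\<bar>cross ?n2 ?n4\<bar> \<ge> 2"
      unfolding c(1,3-5) using d2 L h(1,4) c24 by linarith+
    have ed: "edge S u \<longleftrightarrow> u = ?n1 \<or> u = ?n2 \<or> u = ?n3 \<or> u = ?n4" for u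
      using E by blast
    have "1 \<in> dets S"
      unfolding dets_def using ed c(2) by (metis (mono_tags, lifting) abs_one mem_Collect_eq)
    moreover have pair: "x = ?n2 \<and> y = ?n3 \<or> x = ?n3 \<and> y = ?n2"
      if "edge S x" "edge S y" "\<bar>cross x y\<bar> = 1" for x y
      using that ge cross_swap[of ?n1 ?n2] cross_swap[of ?n3 ?n4] cross_swap[of ?n4 ?n1]
        cross_swap[of ?n1 ?n3] cross_swap[of ?n2 ?n4] cross_simps(8)
      unfolding ed by (elim disjE) (simp_all del: abs_le_iff)
    have "opp S \<subseteq> {int q}"
    proof
      fix z assume "z \<in> opp S"
      then obtain u v x y where z: "edge S u" "edge S v" "edge S x" "edge S y" "z = \<bar>cross u v\<bar>"
        "distinct [u, v, x, y]" "\<bar>cross x y\<bar> = 1" unfolding opp_def by blast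
      have "{x, y} = {?n2, ?n3}" using pair[OF z(3,4,7)] by blast
      then have "u \<notin> {?n2, ?n3}" "v \<notin> {?n2, ?n3}" "u \<noteq> v" using z(6) by auto
      then have "u = ?n1 \<and> v = ?n4 \<or> u = ?n4 \<and> v = ?n1" using z(1,2) unfolding ed by blast
      then show "z \<in> {int q}" using z(5) c(4) cross_swap[of ?n4 ?n1] by auto
    qed
    moreover have "int q \<in> opp S"
    proof -
      have "distinct [?n4, ?n1, ?n2, ?n3]" using d2 h(1,4) by auto
      moreover have "\<bar>cross ?n2 ?n3\<bar> = 1" "int q = \<bar>cross ?n4 ?n1\<bar>" unfolding c by simp_all
      moreover have "edge S ?n4" "edge S ?n1" "edge S ?n2" "edge S ?n3" unfolding ed by blast+
      ultimately show ?thesis unfolding opp_def by blast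
    qed
    ultimately show ?thesis by blast
  next
    let ?n1 = "(1, 0)" and ?n2 = "(1 + int b, int q)" and ?n3 = "(- int m, - int q)"
    assume E: "Collect (edge S) = {?n1, ?n2, ?n3}"
    have c: "cross ?n1 ?n2 = int q" "cross ?n2 ?n3 = int (a * q)" "cross ?n3 ?n1 = int q"
      by (simp_all add: cross_def mi algebra_simps)
    have "dets S = {0, int q, int (a * q)}"
      unfolding dets_triangle[OF E] c by auto
    then show ?thesis by blast
  qed
qed

subsection \<open>Distinguishing the negative curves\<close>

text \<open>For \<open>RT\<close> the support is known only up to the reflection below, so
  \<open>q\<close> is either the height of the triangle or that of the triangle for the conjugate
  solution.\<close>

fun shape :: "triangle \<Rightarrow> (int \<times> int) set \<Rightarrow> bool" where
  "shape (IT K M N) S \<longleftrightarrow> typeI K M N S"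
| "shape (RT K M N) S \<longleftrightarrow> (\<exists>q a b. typeR K M q a b S \<and> (q = M + N \<or> q + (M + N) = K * M))"

lemma solution_coprime: "solution K M N \<Longrightarrow> coprime (M + N) (K * N)" "solution K M N \<Longrightarrow> coprime M (M + N)"
proof -
  assume "solution K M N"
  then have sq: "(M + N)\<^sup>2 = K * M * N + 1" by (simp add: solution_def)
  then have "(M + N)\<^sup>2 = (K * N) * M + 1" "(M + N)\<^sup>2 = M * (K * N) + 1" by (simp_all add: mult_ac)
  then show "coprime (M + N) (K * N)" "coprime M (M + N)"
    using coprime_of_square coprime_commute by blast+
qed

lemma typeRI:
  assumes s: "solution K m n" "n \<ge> 2" "n' \<ge> 2" "m \<ge> 2" "n + n' = (K - 2) * m"
    and ab: "a + b + 1 = m" "(K - 1) + K * b = m + n"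
    and S: "S \<subseteq> tri K m (m + n)" "0 \<in> S" "(int a, 0) \<in> S" "(int m, int (m + n)) \<in> S"
  shows "typeR K m (m + n) a b S"
proof -
  have K: "K \<ge> 3" and sq: "(m + n)\<^sup>2 = K * m * n + 1" using s(1) by (auto simp: solution_def)
  have Km: "K * m = n + n' + 2 * m" using split_off_2[of K m] K s(5) by simp
  have q: "m + n + 1 = K * (b + 1)" using ab(2) K by simp
  have "a > 0"
  proof (rule ccontr)
    assume "\<not> a > 0"
    then have "b + 1 = m" using ab(1) by simp
    then have "m + n + 1 = K * m" using q by (simp only:)
    then show False using Km s(3,4) by simp
  qed
  moreover have "b > 0"
  proof (rule ccontr)
    assume "\<not> b > 0"
    then have "K = m + n + 1" using q by simp
    then have "(m + n) * (m + n) = (m + n + 1) * (m * n) + 1" using sq by (simp add: power2_eq_square algebra_simps)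
    moreover have "m + n \<le> m * n"
    proof -
      have "2 * n \<le> m * n" "m * 2 \<le> m * n" using s(2,4) by (intro mult_right_mono mult_left_mono; simp)+
      then show ?thesis by linarith
    qed
    then have "(m + n) * (m + n) \<le> (m + n + 1) * (m * n)" by (intro mult_mono) auto
    ultimately show False by linarith
  qed
  moreover have "K * m * (m + n) + 1 = K * m * m + (m + n) * (m + n)"
    using sq by (simp add: power2_eq_square distrib_left)
  ultimately show ?thesis
    unfolding typeR_def using K ab(1) q Km s(2,3) S solution_coprime(2)[OF s(1)] by simp
qed

text \<open>The other root of the quadratic in \<open>N\<close>: the product of the roots is
  \<open>M^2 - 1\<close> and \<open>N < M\<close>, so \<open>N'\<close> exceeds
  \<open>M\<close>.\<close>

lemma solution_conjugate:
  assumes s: "solution K M N" and MN: "M > N" "N > 1"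
  obtains N' where "solution K M N'" "N + N' = (K - 2) * M" "N' > M"
proof -
  have K: "K \<ge> 3" using s by (simp add: solution_def)
  define x where "x = (int K - 2) * int M - int N"
  define y where "y = (int K - 2) * int M"
  have "1 * int M \<le> y" unfolding y_def using K by (intro mult_right_mono) auto
  moreover have "x = y - int N" by (simp add: x_def y_def)
  ultimately have x0: "x > 0" using MN(1) by linarith
  have prod: "int N * x = int M * int M - 1"
    using solution_int[OF s] by (simp add: x_def algebra_simps)
  have "x > int M"
  proof (rule ccontr)
    assume "\<not> x > int M"
    then have "int N * x \<le> (int M - 1) * int M" using MN x0 by (intro mult_mono) auto
    then have "int M * int M - 1 \<le> int M * int M - int M" unfolding prod by (simp add: algebra_simps)
    then show False using MN by simp
  qed
  have nx: "int (nat x) = x" using x0 by simp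
  have "int (N + nat x) = int ((K - 2) * M)" using K nx by (simp add: x_def of_nat_diff)
  then have sum: "N + nat x = (K - 2) * M" by (simp only: of_nat_eq_iff)
  have "int ((M + nat x)\<^sup>2) = int (K * M * nat x + 1)"
  proof -
    have "int M * int M + x * x - (int K - 2) * int M * x = 1"
      using solution_int[OF s] by (simp add: x_def algebra_simps)
    then show ?thesis using nx by (simp add: power2_eq_square algebra_simps)
  qed
  then have "solution K M (nat x)" using K unfolding solution_def by (simp only: of_nat_eq_iff)
  then show ?thesis using that[of "nat x"] sum \<open>x > int M\<close> nx by simp
qed

text \<open>It exchanges the x-axis with the edge of slope \<open>K\<close>, and height
  \<open>q\<close> with \<open>K m - q\<close>, that is, \<open>N\<close> with its conjugate. On
  parametrizations it replaces \<open>X\<close> by the cofactor \<open>Z\<close>.\<close>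

definition reflect :: "nat \<Rightarrow> nat \<Rightarrow> nat \<Rightarrow> int \<times> int \<Rightarrow> int \<times> int" where
  "reflect K m q u = (int m - fst u, snd u - int K * fst u + (int K * int m - int q))"

lemma affine_reflect: "affine_lattice_aut (reflect K m q)"
proof -
  let ?L = "\<lambda>u::int\<times>int. (- fst u, snd u - int K * fst u)"
  have "bij ?L" by (rule bij_betw_byWitness[where f'="?L"]) auto
  moreover have "\<forall>u v. ?L (u + v) = ?L u + ?L v" by (simp add: algebra_simps)
  moreover have "reflect K m q = (\<lambda>u. ?L u + (int m, int K * int m - int q))"
    by (rule ext) (simp add: reflect_def)
  ultimately show ?thesis unfolding affine_lattice_aut_def by blast
qed

lemma reflect_tri:
  assumes "q + q' = K * m" "u \<in> tri K m q"
  shows "reflect K m q u \<in> tri K m q'"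
proof -
  have "int (q + q') = int (K * m)" by (simp only: assms(1))
  then have q': "int q' = int K * int m - int q" by simp
  show ?thesis using assms(2) unfolding tri_def reflect_def q'
    by (simp add: algebra_simps)
qed

lemma ex_shape:
  assumes t: "t \<in> distinguished_triangles"
  shows "\<exists>(f :: 'k::field_char_0 laurent) \<rho>. model (slope t) (vanishing_order t) (hgt t) f \<and>
    affine_lattice_aut \<rho> \<and> shape t (\<rho> ` keys f)"
proof -
  have id: "affine_lattice_aut (\<lambda>u. u)" using affine_lattice_aut_translate[of 0] by simp
  consider K M N where "t = IT K M N" "solution K M N" "M \<ge> N" "N > 0"
    | K M N where "t = RT K M N" "solution K M N" "M > N" "N > 1"
    using t unfolding distinguished_triangles_def by blast
  then show ?thesis
  proof cases
    case 1
    obtain f :: "'k laurent" where f: "model K (M + N) (K * N) f" "(int M, 0) \<in> keys f"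
      using ex_model_IT[OF 1(2)] by blast
    have "keys f \<subseteq> tri K (M + N) (K * N)" "0 \<in> keys f" "(int (M + N), int (K * N)) \<in> keys f"
      using f(1) unfolding model_def by blast+
    then have "typeI K M N ((\<lambda>u. u) ` keys f)"
      using f(2) 1 solution_coprime(1)[OF 1(2)] unfolding typeI_def solution_def image_ident by linarith
    then show ?thesis using f(1) id 1(1) by (intro exI[of _ f] exI[of _ "\<lambda>u. u"]) simp
  next
    case 2
    have K: "K \<ge> 3" using 2(2) by (simp add: solution_def)
    obtain N' where N': "solution K M N'" "N + N' = (K - 2) * M" "N' > M"
      using solution_conjugate[OF 2(2-4)] .
    have M: "M > 0" using 2(3) by simp
    have sum: "(M + N) + (M + N') = K * M" using split_off_2[of K M] K N'(2) by simp
    obtain f :: "'k laurent" and a b r where f: "model K M (M + N) f" "a + b + 1 = M" "r + K * b = M + N"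
      "r = 1 \<or> r = K - 1" "r = K - 1 \<Longrightarrow> (int a, 0) \<in> keys f"
      using ex_model_RT[OF 2(2) M] by blast
    have fk: "keys f \<subseteq> tri K M (M + N)" "moments_vanish M f" "0 \<in> keys f" "(int M, int (M + N)) \<in> keys f"
      using f(1) unfolding model_def by blast+
    show ?thesis
    proof (cases "r = K - 1")
      case True
      have "typeR K M (M + N) a b (keys f)"
        by (rule typeRI[OF 2(2) _ _ _ N'(2) f(2) _ fk(1,3) f(5)[OF True] fk(4)])
          (use 2 N'(3) f(3) True in simp_all)
      then have "shape t ((\<lambda>u. u) ` keys f)" using 2(1) by auto
      then show ?thesis using f(1) id 2(1) by (intro exI[of _ f] exI[of _ "\<lambda>u. u"]) simp
    next
      case False
      then have r1: "r = 1" using f(4) by simp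
      obtain g :: "'k laurent" and a' b' r' where g: "model K M (M + N') g" "a' + b' + 1 = M" "r' + K * b' = M + N'"
        "r' = 1 \<or> r' = K - 1" "r' = K - 1 \<Longrightarrow> (int a', 0) \<in> keys g"
        using ex_model_RT[OF N'(1) M] by blast
      \<comment> \<open>The degrees of \<open>X\<close> for the two conjugate solutions add up to
        \<open>K M\<close>, so \<open>K\<close> divides \<open>r + r'\<close>; two values 1 would
        give \<open>K dvd 2\<close>.\<close>
      have r': "r' = K - 1"
      proof (rule ccontr)
        assume "r' \<noteq> K - 1"
        then have "r' = 1" using g(4) by simp
        then have "2 + K * (b + b') = K * M" using sum f(3) g(3) r1 by (simp add: distrib_left)
        then have "K dvd 2 + K * (b + b')" by simp
        then have "K dvd 2" by (metis dvd_add_left_iff dvd_triv_left)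
        then show False using K by (auto dest: dvd_imp_le)
      qed
      let ?\<rho> = "reflect K M (M + N)"
      note bij = affine_lattice_aut_bij[OF affine_reflect[of K M "M + N"]]
      have gk: "keys g \<subseteq> tri K M (M + N')" "0 \<in> keys g" "(int M, int (M + N')) \<in> keys g"
        using g(1) unfolding model_def by blast+
      have "keys (act_exponents ?\<rho> f) \<subseteq> tri K M (M + N')"
        unfolding keys_act[OF bij] using reflect_tri[OF sum] fk(1) by blast
      moreover have "moments_vanish M (act_exponents ?\<rho> f)"
        using fk(2) affine_reflect by (rule moments_vanish_act)
      \<comment> \<open>Uniqueness in the conjugate triangle identifies the reflected curve with one
        whose vertex on the axis is known.\<close>
      ultimately obtain c where c: "act_exponents ?\<rho> f = mterm 0 c * g"
        using g(1) unfolding model_def by blast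
      have "c \<noteq> 0"
      proof
        assume "c = 0"
        then have "keys (act_exponents ?\<rho> f) = {}" unfolding c by simp
        then show False using fk(3) unfolding keys_act[OF bij] by blast
      qed
      then have "keys (mterm 0 c * g) = keys g" by (auto simp: in_keys_iff lookup_mterm_mult)
      then have img: "?\<rho> ` keys f = keys g" using keys_act[OF bij, of f] unfolding c by simp
      have "typeR K M (M + N') a' b' (keys g)"
        by (rule typeRI[OF N'(1) _ _ _ _ g(2) _ gk(1,2) g(5)[OF r'] gk(3), where n'=N])
          (use 2 N' g(3) r' in simp_all)
      moreover have "(M + N') + (M + N) = K * M" using sum by simp
      ultimately have "shape t (?\<rho> ` keys f)" using 2(1) unfolding img by auto
      then show ?thesis using f(1) affine_reflect 2(1) by (intro exI[of _ f] exI[of _ ?\<rho>]) simp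
    qed
  qed
qed

text \<open>\<open>K\<close> is the least positive determinant and \<open>K M\<close> the
  greatest.\<close>

lemma typeI_unique:
  assumes "typeI K M N S" "typeI K' M' N' S'" "dets S = dets S'" "M + N = M' + N'" "M \<ge> N" "M' \<ge> N'"
  shows "K = K' \<and> M = M' \<and> N = N'"
proof -
  have pos: "K \<ge> 3" "M > 0" "N > 0" "K' \<ge> 3" "M' > 0" "N' > 0"
    using assms(1,2) unfolding typeI_def by blast+
  have eq: "{0, int K, int (K * M), int (K * N)} = {0, int K', int (K' * M'), int (K' * N')}"
    using assms(3) unfolding dets_typeI[OF assms(1)] dets_typeI[OF assms(2)] .
  have lo: "a \<le> b" if "{0, int a, int (a * m), int (a * n)} = {0, int b, int (b * m'), int (b * n')}"
    "b > 0" "m > 0" "n > 0" for a b m n m' n' :: nat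
  proof -
    have "int b \<in> {0, int a, int (a * m), int (a * n)}" unfolding that(1) by simp
    then have "b = a \<or> b = a * m \<or> b = a * n"
      using that(2) by (simp only: insert_iff empty_iff of_nat_eq_iff of_nat_eq_0_iff) auto
    then show ?thesis using that(3,4) by auto
  qed
  have KK: "K = K'" using lo[OF eq] lo[OF eq[symmetric]] pos by (simp add: order.antisym)
  have hi: "M1 \<le> M2" if "{0, int a, int (a * M1), int (a * n)} = {0, int a, int (a * M2), int (a * N2)}"
    "a > 0" "M2 > 0" "M1 > 0" "M2 \<ge> N2" for a M1 n M2 N2 :: nat
  proof -
    have "int (a * M1) \<in> {0, int a, int (a * M2), int (a * N2)}" unfolding that(1)[symmetric] by simp
    then have "a * M1 = 0 \<or> a * M1 = a \<or> a * M1 = a * M2 \<or> a * M1 = a * N2"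
      by (simp only: insert_iff empty_iff of_nat_eq_iff of_nat_eq_0_iff) auto
    then show ?thesis using that(2-5) by auto
  qed
  have "M = M'"
    using hi[OF eq[folded KK]] hi[OF eq[folded KK, symmetric]] pos assms(5,6) by (simp add: order.antisym)
  then show ?thesis using KK assms(4) by simp
qed

text \<open>In type I no determinant is 1, so the other polygon must be the triangle with
  determinants \<open>q\<close> and \<open>a q\<close>. Comparison gives \<open>K = q\<close> and
  leaves only the values 1 and \<open>a\<close> for \<open>M\<close> and \<open>N\<close>. The
  equation excludes \<open>M = N > 1\<close>, so \<open>M + N <= a + 1 < m\<close>.\<close>

lemma typeI_typeR_distinct:
  assumes "typeI K M N S" "typeR K' m q a b S'" "dets S = dets S'" "M + N = m" "M \<ge> N"
    and sol: "solution K M N"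
  shows False
proof -
  have pos: "K \<ge> 3" "M > 0" "N > 0" using assms(1) unfolding typeI_def by blast+
  have R: "m = a + b + 1" "a > 0" "b > 0" "m + 2 \<le> q" using assms(2) unfolding typeR_def by blast+
  have KM: "K * M \<ge> K * 1" "K * N \<ge> K * 1" using pos by (simp_all only: mult_le_mono2 Suc_leI One_nat_def)
  from dets_typeR[OF assms(2)] have "dets S = {0, int q, int (a * q)}"
  proof
    assume "1 \<in> dets S' \<and> opp S' = {int q}"
    then have "1 \<in> {0, int K, int (K * M), int (K * N)}" using assms(3) dets_typeI[OF assms(1)] by simp
    then have "1 = K \<or> 1 = K * M \<or> 1 = K * N" by (metis empty_iff insert_iff of_nat_1_eq_iff one_neq_zero)
    then show ?thesis using KM pos(1) by linarith
  qed (simp only: assms(3))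
  then have eq: "{0, int K, int (K * M), int (K * N)} = {0, int q, int (a * q)}"
    using dets_typeI[OF assms(1)] by simp
  have "int q \<in> {0, int K, int (K * M), int (K * N)}" unfolding eq by simp
  then have "q = 0 \<or> q = K \<or> q = K * M \<or> q = K * N"
    by (simp only: insert_iff empty_iff of_nat_eq_iff of_nat_eq_0_iff) auto
  then have "K \<le> q" using KM R(4) by auto
  have "int K \<in> {0, int q, int (a * q)}" unfolding eq[symmetric] by simp
  then have "K = 0 \<or> K = q \<or> K = a * q"
    by (simp only: insert_iff empty_iff of_nat_eq_iff of_nat_eq_0_iff) auto
  moreover have "a * q \<ge> 1 * q" using R(2) by (intro mult_right_mono) auto
  ultimately have Kq: "K = q" using \<open>K \<le> q\<close> pos(1) by auto
  have "x = 1 \<or> x = a" if "x = M \<or> x = N" for x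
  proof -
    have "int (K * x) \<in> {0, int q, int (a * q)}" unfolding eq[symmetric] using that by auto
    then have "K * x = 0 \<or> K * x = q \<or> K * x = a * q"
      by (simp only: insert_iff empty_iff of_nat_eq_iff of_nat_eq_0_iff) auto
    then show ?thesis using Kq pos(1) that pos(2,3) by auto
  qed
  then have MN: "M = 1 \<or> M = a" "N = 1 \<or> N = a" by blast+
  have "M = 1 \<or> N = 1"
  proof (rule ccontr)
    assume "\<not> (M = 1 \<or> N = 1)"
    then have "M = N" "M \<noteq> 1" using MN by auto
    have "(M + M)\<^sup>2 = K * M * M + 1" using sol \<open>M = N\<close> by (simp add: solution_def)
    moreover have "(M + M)\<^sup>2 = (4 * M) * M" by (simp add: power2_eq_square algebra_simps)
    ultimately have "(4 * M) * M = (K * M) * M + 1" by simp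
    then have "M dvd 1" by (metis dvd_add_right_iff dvd_triv_right)
    then show False using \<open>M \<noteq> 1\<close> by simp
  qed
  then have "M + N \<le> a + 1" using MN R(2) by auto
  then show False using assms(4) R(1,3) by simp
qed

text \<open>Whether 1 is a determinant tells triangles from quadrilaterals, as
  \<open>q >= 2\<close>. For quadrilaterals \<open>opp\<close> yields \<open>q\<close>; for
  triangles \<open>q\<close> is the least positive determinant.\<close>

lemma typeR_height_unique:
  assumes "typeR K m q a b S" "typeR K' m q' a' b' S'" "dets S = dets S'" "opp S = opp S'"
  shows "q = q'"
proof -
  have R: "a > 0" "m + 2 \<le> q" "a' > 0" "m + 2 \<le> q'" using assms(1,2) unfolding typeR_def by blast+
  have aq: "a * q \<ge> 1 * q" "a' * q' \<ge> 1 * q'" using R(1,3) by (intro mult_right_mono; simp)+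
  have no: "1 \<notin> {0, int x, int (c * x)}" if "2 \<le> x" for x c :: nat
  proof
    assume "1 \<in> {0, int x, int (c * x)}"
    then have "1 = x \<or> 1 = c * x" by (metis empty_iff insert_iff of_nat_1_eq_iff one_neq_zero)
    then show False using that by auto
  qed
  from dets_typeR[OF assms(1)] dets_typeR[OF assms(2)] show ?thesis
  proof (elim disjE conjE)
    assume "opp S = {int q}" "opp S' = {int q'}"
    then show ?thesis using assms(4) by simp
  next
    assume "1 \<in> dets S" "dets S' = {0, int q', int (a' * q')}"
    then show ?thesis using no[of q' a'] R(4) assms(3) by auto
  next
    assume "dets S = {0, int q, int (a * q)}" "1 \<in> dets S'"
    then show ?thesis using no[of q a] R(2) assms(3) by auto
  next
    assume "dets S = {0, int q, int (a * q)}" "dets S' = {0, int q', int (a' * q')}"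
    then have eq: "{0, int q, int (a * q)} = {0, int q', int (a' * q')}" using assms(3) by simp
    have "int q \<in> {0, int q', int (a' * q')}" unfolding eq[symmetric] by simp
    then have "q = 0 \<or> q = q' \<or> q = a' * q'"
      by (simp only: insert_iff empty_iff of_nat_eq_iff of_nat_eq_0_iff) auto
    moreover have "int q' \<in> {0, int q, int (a * q)}" unfolding eq by simp
    then have "q' = 0 \<or> q' = q \<or> q' = a * q"
      by (simp only: insert_iff empty_iff of_nat_eq_iff of_nat_eq_0_iff) auto
    ultimately show ?thesis using aq R by auto
  qed
qed

text \<open>For given \<open>m\<close> and \<open>q\<close> the equation is linear in
  \<open>K\<close> with coefficient \<open>m (q - m)\<close>, which is positive.\<close>

lemma typeR_slope_unique:
  assumes "typeR K m q a b S" "typeR K' m q a' b' S'"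
  shows "K = K'"
proof -
  have "K * m * q + 1 = K * m * m + q * q" "K' * m * q + 1 = K' * m * m + q * q" "m + 2 \<le> q" "m = a + b + 1"
    using assms unfolding typeR_def by blast+
  then have "int K * int m * int q + 1 = int K * int m * int m + int q * int q"
    "int K' * int m * int q + 1 = int K' * int m * int m + int q * int q"
    by (metis of_nat_1 of_nat_add of_nat_mult)+
  then have "(int K - int K') * (int m * (int q - int m)) = 0" by (simp add: algebra_simps)
  then show ?thesis using \<open>m + 2 \<le> q\<close> \<open>m = a + b + 1\<close> by auto
qed

lemma shape_unique:
  assumes s: "s \<in> distinguished_triangles" "shape s S" and t: "t \<in> distinguished_triangles" "shape t S'"
    and inv: "dets S = dets S'" "opp S = opp S'" "vanishing_order s = vanishing_order t"
  shows "s = t"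
proof -
  have D: "(\<exists>K M N. t = IT K M N \<and> solution K M N \<and> M \<ge> N \<and> N > 0) \<or>
      (\<exists>K M N. t = RT K M N \<and> solution K M N \<and> M > N \<and> N > 1)"
    if "t \<in> distinguished_triangles" for t
    using that unfolding distinguished_triangles_def by blast
  from D[OF s(1)] D[OF t(1)] show ?thesis
  proof (elim disjE exE conjE)
    fix K M N K' M' N'
    assume st: "s = IT K M N" "t = IT K' M' N'" "N \<le> M" "N' \<le> M'"
    then have "typeI K M N S" "typeI K' M' N' S'" "M + N = M' + N'" using s(2) t(2) inv(3) by simp_all
    from typeI_unique[OF this(1,2) inv(1) this(3) st(3,4)] show ?thesis using st by simp
  next
    fix K M N K' M' N'
    assume st: "s = IT K M N" "t = RT K' M' N'" "N \<le> M" "solution K M N"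
    obtain q a b where "typeR K' M' q a b S'" using t(2) st(2) by auto
    moreover have "typeI K M N S" "M + N = M'" using s(2) inv(3) st(1,2) by simp_all
    ultimately show ?thesis using typeI_typeR_distinct inv(1) st(3,4) by blast
  next
    fix K M N K' M' N'
    assume st: "s = RT K M N" "t = IT K' M' N'" "N' \<le> M'" "solution K' M' N'"
    obtain q a b where "typeR K M q a b S" using s(2) st(1) by auto
    moreover have "typeI K' M' N' S'" "M' + N' = M" using t(2) inv(3) st(1,2) by simp_all
    ultimately show ?thesis using typeI_typeR_distinct inv(1)[symmetric] st(3,4) by blast
  next
    fix K M N K' M' N'
    assume st: "s = RT K M N" "t = RT K' M' N'" "N < M" "N' < M'" "solution K M N" "1 < N" "1 < N'"
    have M: "M' = M" using inv(3) st(1,2) by simp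
    obtain q a b where q: "typeR K M q a b S" "q = M + N \<or> q + (M + N) = K * M" using s(2) st(1) by auto
    obtain q' a' b' where q': "typeR K' M q' a' b' S'" "q' = M + N' \<or> q' + (M + N') = K' * M"
      using t(2) st(2) M by auto
    have qq: "q = q'" by (rule typeR_height_unique[OF q(1) q'(1) inv(1,2)])
    have KK: "K = K'" by (rule typeR_slope_unique[OF q(1) q'(1)[folded qq]])
    obtain N1 where N1: "N + N1 = (K - 2) * M" "N1 > M"
      using solution_conjugate[OF st(5,3,6)] by blast
    have K: "K \<ge> 3" using st(5) by (simp add: solution_def)
    have "K * M = 2 * M + (N + N1)" using split_off_2[of K M] K N1(1) by simp
    \<comment> \<open>Conjugate heights cannot be confused: \<open>M + N < 2 M < M + N1\<close>, and
      likewise for \<open>N'\<close>.\<close>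
    then have "N = N'" using q(2) q'(2) qq KK N1(2) st(3,4) M by auto
    then show ?thesis using st KK M by simp
  qed
qed

lemma distinguished_subset: "distinguished_triangles \<subseteq> all_triangles"
  unfolding distinguished_triangles_def all_triangles_def by fastforce

lemma not_isomorphic:
  fixes f g :: "'k::field_char_0 laurent"
  assumes st: "s \<in> distinguished_triangles" "t \<in> distinguished_triangles" "s \<noteq> t"
    and f: "supports_negative_curve (region s) (vanishing_order s) f"
    and g: "supports_negative_curve (region t) (vanishing_order t) g"
  shows "\<not> isomorphic_curves f g"
proof
  assume iso: "isomorphic_curves f g"
  have st': "s \<in> all_triangles" "t \<in> all_triangles" using st distinguished_subset by blast+
  obtain f0 :: "'k laurent" and \<rho> where f0: "model (slope s) (vanishing_order s) (hgt s) f0"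
    "affine_lattice_aut \<rho>" "shape s (\<rho> ` keys f0)" using ex_shape[OF st(1)] by blast
  obtain g0 :: "'k laurent" and \<sigma> where g0: "model (slope t) (vanishing_order t) (hgt t) g0"
    "affine_lattice_aut \<sigma>" "shape t (\<sigma> ` keys g0)" using ex_shape[OF st(2)] by blast
  obtain a where a: "a \<noteq> 0" "f = mterm 0 a * f0" using supports_imp_model[OF st'(1) f f0(1)] by blast
  obtain b where b: "b \<noteq> 0" "g = mterm 0 b * g0" using supports_imp_model[OF st'(2) g g0(1)] by blast
  note im = isomorphic_models[OF f0(1) region_properties(1)[OF st'(1)] g0(1) region_properties(1)[OF st'(2)]
      iso[unfolded a(2) b(2)] a(1) b(1)]
  obtain \<psi> where \<psi>: "affine_lattice_aut \<psi>" "keys g0 = \<psi> ` keys f0" using im(1) by blast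
  let ?S = "\<rho> ` keys f0" and ?S' = "\<sigma> ` keys g0"
  have inv_image: "inv_into UNIV \<phi> ` \<phi> ` X = X" if "affine_lattice_aut \<phi>" for \<phi> :: "int \<times> int \<Rightarrow> int \<times> int" and X
    using affine_lattice_aut_bij[OF that] by (simp add: bij_is_inj image_inv_f_f)
  have fwd: "\<exists>\<phi>. affine_lattice_aut \<phi> \<and> ?S' = \<phi> ` ?S"
  proof (intro exI conjI)
    show "affine_lattice_aut (\<sigma> \<circ> (\<psi> \<circ> inv_into UNIV \<rho>))"
      by (intro affine_lattice_aut_comp affine_lattice_aut_inv f0(2) g0(2) \<psi>(1))
    show "?S' = (\<sigma> \<circ> (\<psi> \<circ> inv_into UNIV \<rho>)) ` ?S"
      unfolding image_comp[symmetric] inv_image[OF f0(2)] \<psi>(2) ..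
  qed
  then obtain \<phi> where \<phi>: "affine_lattice_aut \<phi>" "?S' = \<phi> ` ?S" by blast
  \<comment> \<open>An edge map yields only inclusions of the invariants; the inverse automorphism
    supplies the reverse ones.\<close>
  have bwd: "?S = inv_into UNIV \<phi> ` ?S'" unfolding \<phi>(2) inv_image[OF \<phi>(1)] ..
  obtain T where "edge_map ?S ?S' T" using ex_edge_map[OF \<phi>(1), of ?S] unfolding \<phi>(2)[symmetric] by blast
  moreover obtain T' where "edge_map ?S' ?S T'"
    using ex_edge_map[OF affine_lattice_aut_inv[OF \<phi>(1)], of ?S'] unfolding bwd[symmetric] by blast
  ultimately have "dets ?S = dets ?S'" "opp ?S = opp ?S'" using edge_map_dets by blast+
  then have "s = t" using shape_unique[OF st(1) f0(3) st(2) g0(3)] im(2) by blast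
  then show False using st(3) by blast
qed

theorem theorem1p1:
  shows "(\<forall>t\<in>all_triangles. \<exists>f :: 'k::{alg_closed_field, field_char_0} laurent.
            supports_negative_curve (region t) (vanishing_order t) f) \<and>
         pairwise (\<lambda>s t. \<forall>f g :: 'k laurent.
            supports_negative_curve (region s) (vanishing_order s) f \<longrightarrow>
            supports_negative_curve (region t) (vanishing_order t) g \<longrightarrow>
            \<not> isomorphic_curves f g) distinguished_triangles"
proof
  show "\<forall>t\<in>all_triangles. \<exists>f :: 'k laurent. supports_negative_curve (region t) (vanishing_order t) f"
  proof
    fix t assume t: "t \<in> all_triangles"
    obtain f :: "'k laurent" where "model (slope t) (vanishing_order t) (hgt t) f"
      using ex_model[OF t] by blast
    then have "supports_negative_curve (region t) (vanishing_order t) f"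
      unfolding supports_iff[OF t] model_def by blast
    then show "\<exists>f :: 'k laurent. supports_negative_curve (region t) (vanishing_order t) f" by blast
  qed
qed (use not_isomorphic in \<open>unfold pairwise_def, blast\<close>)

end
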